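(* Let $d \ge 2$ and let $B^d\subset\mathbb{R}^d$ be the unit ball centered at the origin. Let $K \subset B^d$ be a convex body such that \[ \operatorname{width}(K) < \log\frac{1+\sqrt{\frac3{d+2}}}{1-\sqrt{\frac3{d+2}}} \] in the hyperbolic metric defined by $B^d$ as a Cayley–Klein model. Then there is a projective transformation $\phi$ with $\phi(B^d) = B^d$ such that the centroid of $\phi(K)$ is the center of $B^d$, and it is unique up to post-composition with orthogonal transformations. The bound is sharp: the constant on the right-hand side cannot be replaced by any larger one.
   Context: A convex body is a compact convex set with non-empty interior; the centroid is $\gamma(K) = \frac{1}{\operatorname{vol}(K)} \int_K x\, dx$. $\mathbb{R}^d$ is identified with the affine chart $\{x_0\ne 0\}$ of $\mathbb{R}\mathrm{P}^d$. Here $\operatorname{width}(K) = \operatorname{width}_{B^d}(K)$ is the maximum hyperbolic width of $K$: for convex bodies $K_1 \supset K_2$, \[ \operatorname{width}_{K_1}(K_2) = \sup_{\alpha \cap K_1 = \emptyset} \tfrac12 \log |\operatorname{cr}(m_2, \ell_2; \ell_1, m_1)|, \] where $\alpha$ ranges over the $(d-2)$-dimensional affine subspaces disjoint from $K_1$, and $\ell_i, m_i \supset \alpha$ are the two support hyperplanes of $K_i$ containing $\alpha$ (labelled so that the cross-ratio has absolute value at least $1$; the value $+\infty$ is allowed). The cross-ratio of four hyperplanes through $\alpha$ is that of their intersection points with a generic transversal line, with $\operatorname{cr}(p,q;a,b) = \frac{(p-a)(q-b)}{(p-b)(q-a)}$. For $K_1 = B^d$, the number $\frac12\log|\operatorname{cr}(m_2,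 \ell_2; \ell_1, m_1)|$ is the hyperbolic distance between the support hyperplanes $\ell_2$ and $m_2$ of $K_2$ in the Cayley–Klein model. *)

theory Defs
  imports "HOL-Analysis.Analysis"
begin

definition convex_body :: "'a::euclidean_space set \<Rightarrow> bool" where
  "convex_body K \<longleftrightarrow> compact K \<and> convex K \<and> interior K \<noteq> {}"

definition centroid :: "'a::euclidean_space set \<Rightarrow> 'a" where
  "centroid K = (1 / measure lborel K) *\<^sub>R (LINT x:K|lborel. x)"

text \<open>The projective completion of \<^typ>\<open>'a\<close>: lines through the origin in \<^typ>\<open>real \<times> 'a\<close>,
  the first component being the homogeneous coordinate \<open>x\<^sub>0\<close>.\<close>

typedef (overloaded) ('a::euclidean_space) proj_space =
  "{L :: (real \<times> 'a) set. \<exists>v. v \<noteq> 0 \<and> L = span {v}}"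
proof -
  have "(1 :: real, 0 :: 'a) \<noteq> 0" by (simp add: zero_prod_def)
  then show ?thesis by blast
qed

definition chart :: "'a::euclidean_space \<Rightarrow> 'a proj_space" where
  "chart x = Abs_proj_space (span {(1, x)})"

text \<open>Only meaningful for injective linear maps.\<close>

definition proj_map ::
    "(real \<times> 'a \<Rightarrow> real \<times> 'a) \<Rightarrow> 'a::euclidean_space proj_space \<Rightarrow> 'a proj_space" where
  "proj_map A L = Abs_proj_space (A ` Rep_proj_space L)"

definition projective_transformation ::
    "('a::euclidean_space proj_space \<Rightarrow> 'a proj_space) \<Rightarrow> bool" where
  "projective_transformation \<phi> \<longleftrightarrow> (\<exists>A. linear A \<and> bij A \<and> \<phi> = proj_map A)"

definition proj_ext ::
    "('a \<Rightarrow> 'a) \<Rightarrow> 'a::euclidean_space proj_space \<Rightarrow> 'a proj_space" where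
  "proj_ext U = proj_map (\<lambda>(t, x). (t, U x))"

lemma Rep_chart: "Rep_proj_space (chart x) = span {(1, x)}"
proof -
  have "(1 :: real, x) \<noteq> 0" by (simp add: zero_prod_def)
  then show ?thesis unfolding chart_def by (intro Abs_proj_space_inverse) blast
qed

lemma Rep_proj_map:
  assumes "linear A" "inj A"
  shows "Rep_proj_space (proj_map A L) = A ` Rep_proj_space L"
proof -
  obtain v where v: "v \<noteq> 0" "Rep_proj_space L = span {v}"
    using Rep_proj_space[of L] by auto
  have "A v \<noteq> 0"
    using v(1) assms linear_injective_0 by blast
  moreover have "A ` Rep_proj_space L = span {A v}"
    using linear_span_image[OF assms(1), of "{v}"] v(2) by simp
  ultimately show ?thesis
    unfolding proj_map_def by (intro Abs_proj_space_inverse) blast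
qed

lemma proj_ext_chart:
  assumes "linear U" "inj U"
  shows "proj_ext U (chart x) = chart (U x)"
proof -
  let ?A = "\<lambda>(t::real, x). (t, U x)"
  have lin: "linear ?A"
    using assms(1) by (auto intro!: linearI simp: linear_add linear_scale)
  have inj: "inj ?A"
    using assms(2) by (auto simp: inj_def)
  have "Rep_proj_space (proj_ext U (chart x)) = Rep_proj_space (chart (U x))"
    unfolding proj_ext_def Rep_proj_map[OF lin inj] Rep_chart
    using linear_span_image[OF lin, of "{(1, x)}"] by simp
  then show ?thesis
    by (simp add: Rep_proj_space_inject)
qed

definition support_hyperplane :: "'a::euclidean_space set \<Rightarrow> 'a set \<Rightarrow> bool" where
  "support_hyperplane K H \<longleftrightarrow>
     (\<exists>a b. a \<noteq> 0 \<and> H = {x. a \<bullet> x = b} \<and> K \<subseteq> {x. a \<bullet> x \<le> b} \<and> K \<inter> H \<noteq> {})"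

text \<open>A nonzero number divided by \<open>0\<close> gives an infinite value in \<^typ>\<open>ereal\<close>. The form \<open>0 / 0\<close>
  does not occur when \<open>p \<noteq> q\<close> and \<open>a \<noteq> b\<close>.\<close>

definition cr :: "real \<Rightarrow> real \<Rightarrow> real \<Rightarrow> real \<Rightarrow> ereal" where
  "cr p q a b = ereal ((p - a) * (q - b)) / ereal ((p - b) * (q - a))"

text \<open>\<open>c\<close> is the cross-ratio of the hyperplanes \<open>P, Q, A, B\<close> through \<open>\<alpha>\<close>, computed on some line
  that avoids \<open>\<alpha>\<close> and meets each of them in exactly one point. The points of the line are given
  by their affine parameters, on which the cross-ratio does not depend.\<close>

definition hyperplanes_cr ::
    "'a::euclidean_space set \<Rightarrow> 'a set \<Rightarrow> 'a set \<Rightarrow> 'a set \<Rightarrow> 'a set \<Rightarrow> ereal \<Rightarrow> bool" where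
  "hyperplanes_cr \<alpha> P Q A B c \<longleftrightarrow>
     (\<exists>x v p q a b.
        (\<forall>t. x + t *\<^sub>R v \<notin> \<alpha>) \<and>
        (\<forall>t. x + t *\<^sub>R v \<in> P \<longleftrightarrow> t = p) \<and> (\<forall>t. x + t *\<^sub>R v \<in> Q \<longleftrightarrow> t = q) \<and>
        (\<forall>t. x + t *\<^sub>R v \<in> A \<longleftrightarrow> t = a) \<and> (\<forall>t. x + t *\<^sub>R v \<in> B \<longleftrightarrow> t = b) \<and>
        c = cr p q a b)"

text \<open>The logarithm on \<open>[1, \<infinity>]\<close>.\<close>

definition ln_ereal :: "ereal \<Rightarrow> ereal" where
  "ln_ereal c = (if c = \<infinity> then \<infinity> else ereal (ln (real_of_ereal c)))"

text \<open>The condition \<open>\<bar>c\<bar> \<ge> 1\<close> selects the labelling of the support hyperplanes: exchanging two of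
  them inverts the cross-ratio.\<close>

definition rel_width :: "'a::euclidean_space set \<Rightarrow> 'a set \<Rightarrow> ereal" where
  "rel_width K\<^sub>1 K\<^sub>2 = Sup {ereal (1/2) * ln_ereal \<bar>c\<bar> | \<alpha> l\<^sub>1 m\<^sub>1 l\<^sub>2 m\<^sub>2 c.
     affine \<alpha> \<and> aff_dim \<alpha> = int DIM('a) - 2 \<and> \<alpha> \<inter> K\<^sub>1 = {} \<and>
     support_hyperplane K\<^sub>1 l\<^sub>1 \<and> support_hyperplane K\<^sub>1 m\<^sub>1 \<and> l\<^sub>1 \<noteq> m\<^sub>1 \<and>
     support_hyperplane K\<^sub>2 l\<^sub>2 \<and> support_hyperplane K\<^sub>2 m\<^sub>2 \<and> l\<^sub>2 \<noteq> m\<^sub>2 \<and>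
     \<alpha> \<subseteq> l\<^sub>1 \<and> \<alpha> \<subseteq> m\<^sub>1 \<and> \<alpha> \<subseteq> l\<^sub>2 \<and> \<alpha> \<subseteq> m\<^sub>2 \<and>
     hyperplanes_cr \<alpha> m\<^sub>2 l\<^sub>2 l\<^sub>1 m\<^sub>1 c \<and> \<bar>c\<bar> \<ge> 1}"

definition hyperbolic_width :: "'a::euclidean_space set \<Rightarrow> ereal" where
  "hyperbolic_width K = rel_width (cball 0 1) K"

text \<open>If \<open>\<phi>\<close> preserves the ball and \<open>K\<close> lies in it, then \<open>\<phi>(K)\<close> lies in the affine chart, so the
  preimage under \<^const>\<open>chart\<close> is all of \<open>\<phi>(K)\<close>.\<close>

definition centering ::
    "'a::euclidean_space set \<Rightarrow> ('a proj_space \<Rightarrow> 'a proj_space) \<Rightarrow> bool" where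
  "centering K \<phi> \<longleftrightarrow>
     projective_transformation \<phi> \<and>
     \<phi> ` chart ` cball 0 1 = chart ` cball 0 1 \<and>
     centroid (chart -` \<phi> ` chart ` K) = 0"

definition uniquely_centerable :: "'a::euclidean_space set \<Rightarrow> bool" where
  "uniquely_centerable K \<longleftrightarrow>
     (\<exists>\<phi>. centering K \<phi>) \<and>
     (\<forall>\<phi> \<psi>. centering K \<phi> \<and> centering K \<psi> \<longrightarrow>
        (\<exists>U. orthogonal_transformation U \<and> \<psi> = proj_ext U \<circ> \<phi>))"

definition width_bound :: "nat \<Rightarrow> real" where
  "width_bound d = ln ((1 + sqrt (3 / (real d + 2))) / (1 - sqrt (3 / (real d + 2))))"

end

theory Submission
  imports Defs "HOL-Real_Asymp.Real_Asymp"
begin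

text \<open>Lift the chart to Minkowski space: the points \<open>(hyp y, y)\<close> with \<open>hyp y = sqrt (1 + |y|\<^sup>2)\<close> form the
hyperboloid model of hyperbolic space, and every projective transformation that preserves the ball
is a boost sending one of these points to \<open>(1, 0)\<close>, followed by a rotation
(\<open>ball_preserving_decomposition\<close>). Centering \<open>K\<close> therefore means finding a point \<open>y\<close> of the
hyperboloid, and uniqueness up to rotations means that there is only one such point. In the chart,
the boost is a projective map \<open>hmap y\<close> whose Jacobian is \<open>(den y x) ^ -(d + 1)\<close>, where \<open>den y x\<close> is the
Lorentz product of \<open>(hyp y, y)\<close> and \<open>(1, x)\<close> up to sign. So the volume of the boosted body is
\<open>hvol K y = \<integral>\<^sub>K (den y x) ^ -(d + 1) dx\<close>, and its gradient on the hyperboloid is, up to a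
nonsingular linear map, the moment vector of the boosted body: the centering points are the
critical points of the volume.

Existence. A body of finite width has no point on the sphere (\<open>finite_width_imp_subset_ball\<close>), so the
volume is no larger far out than at the origin, and it attains its maximum
(\<open>hvol_attains_max\<close>, \<open>hvol_max_centered\<close>).

Uniqueness. Move one centering point to the origin and let \<open>h\<close> be the derivative of the volume, up to
the factor \<open>d + 1\<close>, along the geodesic to another one. At a zero of \<open>h\<close> the boosted body has mean zero in the
direction \<open>u\<close> of the geodesic, and the derivative of \<open>h\<close> is
\<open>(d + 2) \<integral> (u \<bullet> x)\<^sup>2 dx - vol\<close>, taken over the boosted body. If this is negative at every zero, then \<open>h\<close> cannot
vanish twice (\<open>no_two_descending_zeros\<close>). Now the second moment about the mean of a linear
functional over a convex body is at most \<open>L\<^sup>2/12\<close> times the volume, where \<open>L\<close> is the length of its range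
(\<open>convex_second_moment_le\<close>), and among the slabs of a given hyperbolic width the symmetric one has
the largest Euclidean width. A width below the bound thus gives \<open>L < 2 s\<close> with \<open>s\<^sup>2 = 3/(d + 2)\<close>
and a second moment below \<open>vol/(d + 2)\<close> (\<open>second_moment_less\<close>).

The estimate \<open>L\<^sup>2/12\<close> rests on the log-concavity of the marginals of a convex body, which
follows from the Prekopa-Leindler inequality by integrating out one direction after the other. A
log-concave density is then compared with the exponential density on the same interval that has the same
mass and mean: the two graphs cross at most twice, which orders the second moments.

The width enters through the numbers \<open>(1 - p \<bullet> x) / (1 - q \<bullet> x)\<close> for unit vectors \<open>p\<close>, \<open>q\<close>. They
parametrize the hyperplanes through the intersection of the tangent hyperplanes at \<open>p\<close> and \<open>q\<close>,
and the quotient of two of them is a cross-ratio (\<open>width_bounds_cross_ratio\<close>). The case of parallel hyperplanes, \<open>q = -p\<close>,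
is a limit.

Sharpness. For a thin cylinder around a chord of half-length slightly above \<open>s\<close>, the origin is a
centering point at which the volume has a positive second derivative along the chord, so the maximum lies elsewhere
and gives a second centering. The cylinder lies in a ball of radius close to \<open>s\<close>, which bounds
its width (\<open>hyperbolic_width_le_ball\<close>).\<close>

section \<open>Log-concave functions and the Prekopa-Leindler inequality on the line\<close>

text \<open>The convention \<open>0 powr t = 0\<close> makes the inequality trivial where \<open>f\<close> vanishes, so that
indicator functions of convex sets are included.\<close>

definition logconcave :: "('a::real_vector \<Rightarrow> real) \<Rightarrow> bool" where
  "logconcave f \<longleftrightarrow> (\<forall>x. 0 \<le> f x) \<and>
     (\<forall>x y t. 0 < t \<and> t < 1 \<longrightarrow>
        f x powr (1 - t) * f y powr t \<le> f ((1 - t) *\<^sub>R x + t *\<^sub>R y))"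

lemma logconcave_nonneg: "logconcave f \<Longrightarrow> 0 \<le> f x"
  by (simp add: logconcave_def)

lemma logconcaveD:
  "logconcave f \<Longrightarrow> 0 < t \<Longrightarrow> t < 1 \<Longrightarrow>
     f x powr (1 - t) * f y powr t \<le> f ((1 - t) *\<^sub>R x + t *\<^sub>R y)"
  by (simp add: logconcave_def)

lemma powr_mean_less:
  fixes a b c t :: real
  assumes "0 \<le> c" "c < a" "c < b" "0 < t" "t < 1"
  shows "c < a powr (1 - t) * b powr t"
proof (cases "c = 0")
  case False
  then have "c = c powr (1 - t) * c powr t"
    using assms by (simp flip: powr_add)
  also have "\<dots> < a powr (1 - t) * b powr t"
    using assms False by (intro mult_strict_mono powr_less_mono2) auto
  finally show ?thesis .
qed (use assms in auto)

text \<open>Applied to \<open>f\<close> times an exponential, this says that the graph of \<open>f\<close> lies above that of an exponential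
function over a convex set.\<close>

lemma convex_superlevel_logconcave:
  assumes "logconcave f"
  shows "convex {x. c < f x}"
proof (cases "c < 0")
  case True
  then have "{x. c < f x} = UNIV"
    using logconcave_nonneg[OF assms] by (auto intro: less_le_trans)
  then show ?thesis by simp
next
  case False
  have "c < f ((1 - t) *\<^sub>R x + t *\<^sub>R y)"
    if "c < f x" "c < f y" "0 < t" "t < 1" for x y t
    using powr_mean_less[of c "f x" "f y" t] logconcaveD[OF assms, of t x y] that False by auto
  then show ?thesis
    by (auto simp: convex_alt) (metis less_eq_real_def add.right_neutral diff_zero eq_iff_diff_eq_0 add.left_neutral scale_one scale_zero_left)
qed

lemma logconcave_mult:
  assumes "logconcave f" "logconcave g"
  shows "logconcave (\<lambda>x. f x * g x)"
  unfolding logconcave_def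
proof (intro conjI allI impI)
  fix x y :: 'a and t :: real assume t: "0 < t \<and> t < 1"
  have "(f x * g x) powr (1 - t) * (f y * g y) powr t =
        (f x powr (1 - t) * f y powr t) * (g x powr (1 - t) * g y powr t)"
    by (simp add: powr_mult logconcave_nonneg assms)
  also have "\<dots> \<le> f ((1 - t) *\<^sub>R x + t *\<^sub>R y) * g ((1 - t) *\<^sub>R x + t *\<^sub>R y)"
    using t by (intro mult_mono logconcaveD assms) (auto simp: logconcave_nonneg assms)
  finally show "(f x * g x) powr (1 - t) * (f y * g y) powr t
      \<le> f ((1 - t) *\<^sub>R x + t *\<^sub>R y) * g ((1 - t) *\<^sub>R x + t *\<^sub>R y)" .
qed (simp add: logconcave_nonneg assms)

lemma logconcave_indicator:
  assumes "convex K"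
  shows "logconcave (indicator K :: _ \<Rightarrow> real)"
  using convexD_alt[OF assms] by (auto simp: logconcave_def indicator_def)

lemma logconcave_exp:
  "logconcave (\<lambda>x::real. exp (k * x))"
  by (auto simp: logconcave_def powr_def algebra_simps simp flip: exp_add)

lemma powr_prod_le_convex_comb:
  fixes a b t :: real
  assumes "0 \<le> a" "0 \<le> b" "0 < t" "t < 1"
  shows "a powr (1 - t) * b powr t \<le> (1 - t) * a + t * b"
  using Youngs_inequality_0[of "1 - t" t a b] assms by (cases "a = 0 \<or> b = 0") auto

lemma integrable_bounded_support:
  fixes f :: "'a::euclidean_space \<Rightarrow> real"
  assumes "f \<in> borel_measurable borel" "bounded {x. f x \<noteq> 0}" "\<And>x. \<bar>f x\<bar> \<le> C"
  shows "integrable lborel f"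
proof -
  obtain a where a: "{x. f x \<noteq> 0} \<subseteq> cbox (-a) a"
    using bounded_subset_cbox_symmetric[OF assms(2)] by blast
  have "integrable lborel (\<lambda>x. indicator (cbox (-a) a) x *\<^sub>R C)"
    using emeasure_lborel_cbox_finite[of "-a" a]
    by (intro integrable_scaleR_left integrable_real_indicator) simp_all
  then show ?thesis
    by (rule Bochner_Integration.integrable_bound)
      (use assms a in \<open>auto simp: indicator_def intro!: AE_I2 order_trans[OF assms(3)]\<close>)
qed

text \<open>Fubini for the region below the graph.\<close>

lemma layer_cake:
  fixes f :: "'a \<Rightarrow> real"
  assumes "sigma_finite_measure M" "f \<in> borel_measurable M" "\<And>x. 0 \<le> f x"
  shows "(\<integral>\<^sup>+x. ennreal (f x) \<partial>M) =
         (\<integral>\<^sup>+c. emeasure M {x \<in> space M. c < f x} * indicator {0..} c \<partial>lborel)"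
proof -
  interpret M: sigma_finite_measure M by fact
  interpret pair_sigma_finite M lborel
    by (intro pair_sigma_finite.intro assms lborel.sigma_finite_measure_axioms)
  note [measurable] = assms(2)
  have "(\<integral>\<^sup>+x. ennreal (f x) \<partial>M) = (\<integral>\<^sup>+x. (\<integral>\<^sup>+c. indicator {c. 0 \<le> c \<and> c < f x} c \<partial>lborel) \<partial>M)"
  proof (rule nn_integral_cong)
    fix x
    have "{c. 0 \<le> c \<and> c < f x} = {0..<f x}" by auto
    then show "ennreal (f x) = (\<integral>\<^sup>+c. indicator {c. 0 \<le> c \<and> c < f x} c \<partial>lborel)"
      using assms(3)[of x] by simp
  qed
  also have "\<dots> = (\<integral>\<^sup>+c. (\<integral>\<^sup>+x. indicator {c. 0 \<le> c \<and> c < f x} c \<partial>M) \<partial>lborel)"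
    by (intro Fubini'[symmetric]) measurable
  also have "\<dots> = (\<integral>\<^sup>+c. emeasure M {x \<in> space M. c < f x} * indicator {0..} c \<partial>lborel)"
  proof (rule nn_integral_cong)
    fix c :: real
    have "(\<integral>\<^sup>+x. indicator {c. 0 \<le> c \<and> c < f x} c \<partial>M)
        = (\<integral>\<^sup>+x. indicator {x \<in> space M. c < f x} x * indicator {0..} c \<partial>M)"
      by (intro nn_integral_cong) (auto simp: indicator_def)
    also have "\<dots> = emeasure M {x \<in> space M. c < f x} * indicator {0..} c"
      by (subst nn_integral_multc) auto
    finally show "(\<integral>\<^sup>+x. indicator {c. 0 \<le> c \<and> c < f x} c \<partial>M)
        = emeasure M {x \<in> space M. c < f x} * indicator {0..} c" .
  qed
  finally show ?thesis .
qed

text \<open>Convex sets on the line are intervals up to their endpoints, and the infimum and supremum of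
a Minkowski combination are the combinations of those of the sets.\<close>

lemma brunn_minkowski_interval:
  fixes F G H :: "real set"
  assumes F: "convex F" "F \<noteq> {}" "bounded F" and G: "convex G" "G \<noteq> {}" "bounded G"
    and H: "H \<in> sets borel" and t: "0 < t" "t < 1"
    and FGH: "\<And>x y. x \<in> F \<Longrightarrow> y \<in> G \<Longrightarrow> (1 - t) * x + t * y \<in> H"
  shows "ennreal (1 - t) * emeasure lborel F + ennreal t * emeasure lborel G \<le> emeasure lborel H"
proof -
  have bd: "emeasure lborel S \<le> ennreal (Sup S - Inf S)" "Inf S \<le> Sup S"
    "\<And>x. Inf S < x \<Longrightarrow> x < Sup S \<Longrightarrow> x \<in> S"
    "Inf S = Sup S \<Longrightarrow> Inf S \<in> S"
    if "convex S" "S \<noteq> {}" "bounded S" for S :: "real set"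
  proof -
    have bb: "bdd_below S" "bdd_above S"
      using that bounded_imp_bdd_below bounded_imp_bdd_above by auto
    have sub: "S \<subseteq> {Inf S..Sup S}"
      using bb by (auto intro: cInf_lower cSup_upper)
    show le: "Inf S \<le> Sup S" using sub that by fastforce
    have "emeasure lborel S \<le> emeasure lborel {Inf S..Sup S}"
      by (intro emeasure_mono sub) simp
    then show "emeasure lborel S \<le> ennreal (Sup S - Inf S)" using le by simp
    show "x \<in> S" if x: "Inf S < x" "x < Sup S" for x
    proof -
      obtain y z where "y \<in> S" "y < x" "z \<in> S" "x < z"
        using x bb \<open>S \<noteq> {}\<close> by (meson cInf_less_iff less_cSup_iff)
      then show ?thesis
        using \<open>convex S\<close> by (meson is_interval_convex_1 mem_is_interval_1_I less_imp_le)
    qed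
    show "Inf S \<in> S" if "Inf S = Sup S"
      using sub that \<open>S \<noteq> {}\<close> by fastforce
  qed
  define a b where "a = (1 - t) * Inf F + t * Inf G" and "b = (1 - t) * Sup F + t * Sup G"
  have ab: "a \<le> b"
    unfolding a_def b_def using t bd(2)[OF F] bd(2)[OF G] by (intro add_mono mult_left_mono) auto
  have "{a<..<b} \<subseteq> H"
  proof
    fix z assume z: "z \<in> {a<..<b}"
    define s where "s = (z - a) / (b - a)"
    have s: "0 < s" "s < 1" using z by (auto simp: s_def)
    have zs: "z = (1 - s) * a + s * b"
    proof -
      have "s * (b - a) = z - a" using z by (simp add: s_def)
      then show ?thesis by (simp add: algebra_simps)
    qed
    have mem: "(1 - s) * Inf S + s * Sup S \<in> S" if S: "convex S" "S \<noteq> {}" "bounded S" for S :: "real set"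
    proof (cases "Inf S = Sup S")
      case True
      then show ?thesis using bd(4)[OF S True] by (simp add: algebra_simps)
    next
      case False
      then have lt: "Inf S < Sup S" using bd(2)[OF S] by simp
      have "0 < s * (Sup S - Inf S)" "0 < (1 - s) * (Sup S - Inf S)"
        using s lt by auto
      then show ?thesis by (intro bd(3)[OF S]) (auto simp: algebra_simps)
    qed
    have "(1 - t) * ((1 - s) * Inf F + s * Sup F) + t * ((1 - s) * Inf G + s * Sup G) \<in> H"
      by (intro FGH mem F G)
    also have "(1 - t) * ((1 - s) * Inf F + s * Sup F) + t * ((1 - s) * Inf G + s * Sup G) = z"
      unfolding zs a_def b_def by (simp add: algebra_simps)
    finally show "z \<in> H" .
  qed
  then have "emeasure lborel {a<..<b} \<le> emeasure lborel H"
    by (intro emeasure_mono) (use H in auto)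
  then have "ennreal (b - a) \<le> emeasure lborel H" using ab by simp
  moreover have "ennreal (1 - t) * emeasure lborel F + ennreal t * emeasure lborel G
      \<le> ennreal (1 - t) * ennreal (Sup F - Inf F) + ennreal t * ennreal (Sup G - Inf G)"
    by (intro add_mono mult_left_mono bd F G) auto
  moreover have "\<dots> = ennreal (b - a)"
  proof -
    have "0 \<le> (1 - t) * (Sup F - Inf F)" "0 \<le> t * (Sup G - Inf G)"
      using t bd(2)[OF F] bd(2)[OF G] by auto
    moreover have "b - a = (1 - t) * (Sup F - Inf F) + t * (Sup G - Inf G)"
      by (simp add: a_def b_def algebra_simps)
    ultimately show ?thesis
      using t by (simp add: ennreal_plus ennreal_mult')
  qed
  ultimately show ?thesis by order
qed

text \<open>If \<open>f\<close> and \<open>g\<close> have supremum 1, then for every level \<open>c < 1\<close> both superlevel sets are nonempty and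
their combination lies in that of \<open>h\<close>. Integrating the inequality of \<open>brunn_minkowski_interval\<close> over \<open>c\<close> gives a bound by the
arithmetic mean, stronger than the geometric mean.\<close>

lemma prekopa_leindler_line_normalized:
  fixes f g h :: "real \<Rightarrow> real"
  assumes fm: "f \<in> borel_measurable borel" and gm: "g \<in> borel_measurable borel"
    and hm: "h \<in> borel_measurable borel"
    and f0: "\<And>x. 0 \<le> f x" and g0: "\<And>x. 0 \<le> g x" and h0: "\<And>x. 0 \<le> h x"
    and fc: "\<And>c. convex {x. c < f x}" and gc: "\<And>c. convex {x. c < g x}"
    and fb: "bounded {x. f x \<noteq> 0}" and gb: "bounded {x. g x \<noteq> 0}"
    and fsup: "\<And>x. f x \<le> 1" "\<And>c. c < 1 \<Longrightarrow> \<exists>x. c < f x"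
    and gsup: "\<And>x. g x \<le> 1" "\<And>c. c < 1 \<Longrightarrow> \<exists>x. c < g x"
    and t: "0 < t" "t < 1"
    and fgh: "\<And>x y. f x powr (1 - t) * g y powr t \<le> h ((1 - t) * x + t * y)"
  shows "ennreal (1 - t) * (\<integral>\<^sup>+x. f x \<partial>lborel) + ennreal t * (\<integral>\<^sup>+x. g x \<partial>lborel)
    \<le> (\<integral>\<^sup>+x. h x \<partial>lborel)"
proof -
  note [measurable] = fm gm hm
  have lc: "(\<integral>\<^sup>+x. ennreal (k x) \<partial>lborel) =
      (\<integral>\<^sup>+c. emeasure lborel {x. c < k x} * indicator {0..} c \<partial>lborel)"
    if "k \<in> borel_measurable borel" "\<And>x. 0 \<le> k x" for k :: "real \<Rightarrow> real"
    using layer_cake[of lborel k] that by (simp add: lborel.sigma_finite_measure_axioms)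
  have em: "(\<lambda>c. emeasure lborel {x. c < k x}) \<in> borel_measurable lborel"
    if [measurable]: "k \<in> borel_measurable borel" for k :: "real \<Rightarrow> real"
  proof -
    have "(\<lambda>c. emeasure lborel (Pair c -` {p \<in> space (lborel \<Otimes>\<^sub>M lborel). fst p < k (snd p)}))
        \<in> borel_measurable lborel"
      by (intro lborel.measurable_emeasure_Pair) measurable
    then show ?thesis by (simp add: space_pair_measure)
  qed
  have "ennreal (1 - t) * (\<integral>\<^sup>+x. f x \<partial>lborel) + ennreal t * (\<integral>\<^sup>+x. g x \<partial>lborel)
    = (\<integral>\<^sup>+c. ennreal (1 - t) * (emeasure lborel {x. c < f x} * indicator {0..} c)
         + ennreal t * (emeasure lborel {x. c < g x} * indicator {0..} c) \<partial>lborel)"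
    unfolding lc[OF fm f0] lc[OF gm g0]
    using em[OF fm] em[OF gm] by (subst nn_integral_add; simp add: nn_integral_cmult)
  also have "\<dots> \<le> (\<integral>\<^sup>+c. emeasure lborel {x. c < h x} * indicator {0..} c \<partial>lborel)"
  proof (rule nn_integral_mono)
    fix c :: real
    show "ennreal (1 - t) * (emeasure lborel {x. c < f x} * indicator {0..} c)
         + ennreal t * (emeasure lborel {x. c < g x} * indicator {0..} c)
         \<le> emeasure lborel {x. c < h x} * indicator {0..} c"
    proof (cases "0 \<le> c \<and> c < 1")
      case True
      have "ennreal (1 - t) * emeasure lborel {x. c < f x} + ennreal t * emeasure lborel {x. c < g x}
        \<le> emeasure lborel {x. c < h x}"
      proof (rule brunn_minkowski_interval)
        show "{x. c < f x} \<noteq> {}" "{x. c < g x} \<noteq> {}" using fsup(2) gsup(2) True by auto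
        show "bounded {x. c < f x}" by (rule bounded_subset[OF fb]) (use True in auto)
        show "bounded {x. c < g x}" by (rule bounded_subset[OF gb]) (use True in auto)
        show "(1 - t) * x + t * y \<in> {x. c < h x}" if "x \<in> {x. c < f x}" "y \<in> {x. c < g x}" for x y
          using powr_mean_less[of c "f x" "g y" t] fgh[of x y] that True t by auto
      qed (use fc gc t in auto)
      then show ?thesis using True by simp
    next
      case False
      then have "c < 0 \<or> ({x. c < f x} = {} \<and> {x. c < g x} = {})"
        using fsup(1) gsup(1) by (metis (mono_tags, lifting) Collect_empty_eq leD less_eq_real_def linorder_not_le order_trans)
      then show ?thesis by auto
    qed
  qed
  also have "\<dots> = (\<integral>\<^sup>+x. h x \<partial>lborel)"
    by (rule lc[OF hm h0, symmetric])
  finally show ?thesis .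
qed

text \<open>Dividing \<open>f\<close> and \<open>g\<close> by their suprema reduces the inequality to the normalized one, followed by
the inequality of arithmetic and geometric means.\<close>

lemma prekopa_leindler_line:
  fixes f g h :: "real \<Rightarrow> real"
  assumes fm: "f \<in> borel_measurable borel" and gm: "g \<in> borel_measurable borel"
    and hi: "integrable lborel h"
    and f0: "\<And>x. 0 \<le> f x" and g0: "\<And>x. 0 \<le> g x" and h0: "\<And>x. 0 \<le> h x"
    and fc: "\<And>c. convex {x. c < f x}" and gc: "\<And>c. convex {x. c < g x}"
    and fb: "bounded {x. f x \<noteq> 0}" and gb: "bounded {x. g x \<noteq> 0}"
    and fC: "\<And>x. f x \<le> C" and gC: "\<And>x. g x \<le> C"
    and t: "0 < t" "t < 1"
    and fgh: "\<And>x y. f x powr (1 - t) * g y powr t \<le> h ((1 - t) * x + t * y)"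
  shows "(LINT x|lborel. f x) powr (1 - t) * (LINT x|lborel. g x) powr t \<le> (LINT x|lborel. h x)"
proof -
  have hm: "h \<in> borel_measurable borel" using hi by auto
  have Ih: "0 \<le> (LINT x|lborel. h x)" by (simp add: h0)
  have int: "integrable lborel k" if k: "k \<in> borel_measurable borel" "\<And>x. 0 \<le> k x"
      "bounded {x. k x \<noteq> 0}" "\<And>x. k x \<le> C" for k :: "real \<Rightarrow> real"
    by (rule integrable_bounded_support[where C = C]) (use k in auto)
  show ?thesis
  proof (cases "(\<exists>x. f x \<noteq> 0) \<and> (\<exists>x. g x \<noteq> 0)")
    case False
    then have "(LINT x|lborel. f x) = 0 \<or> (LINT x|lborel. g x) = 0" by auto
    then show ?thesis using Ih by auto
  next
    case True
    define A B where "A = (SUP x. f x)" and "B = (SUP x. g x)"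
    have bdd: "bdd_above (range f)" "bdd_above (range g)" using fC gC by (auto simp: bdd_above_def)
    have fA: "f x \<le> A" and gB: "g x \<le> B" for x
      unfolding A_def B_def using bdd by (auto intro: cSUP_upper)
    have A: "0 < A" and B: "0 < B"
      using True f0 g0 fA gB by (metis less_eq_real_def order_less_le_trans)+
    define P where "P = A powr (1 - t) * B powr t"
    have P: "0 < P" using A B by (simp add: P_def)
    have "ennreal (1 - t) * (\<integral>\<^sup>+x. ennreal (f x / A) \<partial>lborel) + ennreal t * (\<integral>\<^sup>+x. ennreal (g x / B) \<partial>lborel)
      \<le> (\<integral>\<^sup>+x. ennreal (h x / P) \<partial>lborel)"
    proof (rule prekopa_leindler_line_normalized)
      show "convex {x. c < f x / A}" "convex {x. c < g x / B}" for c
        using fc[of "c * A"] gc[of "c * B"] A B by (simp_all add: pos_less_divide_eq)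
      show "\<exists>x. c < f x / A" if "c < 1" for c
      proof -
        have "c * A < A" using that A by simp
        then obtain x where "c * A < f x" unfolding A_def using less_cSUP_iff[OF _ bdd(1)] by auto
        then show ?thesis using A by (auto simp: pos_less_divide_eq)
      qed
      show "\<exists>x. c < g x / B" if "c < 1" for c
      proof -
        have "c * B < B" using that B by simp
        then obtain x where "c * B < g x" unfolding B_def using less_cSUP_iff[OF _ bdd(2)] by auto
        then show ?thesis using B by (auto simp: pos_less_divide_eq)
      qed
      show "(f x / A) powr (1 - t) * (g y / B) powr t \<le> h ((1 - t) * x + t * y) / P" for x y
        using fgh[of x y] A B P by (simp add: powr_divide f0 g0 P_def divide_right_mono)
    qed (use fm gm hm f0 g0 h0 fA gB A B P fb gb t in auto)
    moreover have "(\<integral>\<^sup>+x. ennreal (k x / Q) \<partial>lborel) = ennreal ((LINT x|lborel. k x) / Q)"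
      if "integrable lborel k" "\<And>x. 0 \<le> k x" "0 < Q" for k :: "real \<Rightarrow> real" and Q
      using that by (subst nn_integral_eq_integral) auto
    ultimately have "ennreal (1 - t) * ennreal ((LINT x|lborel. f x) / A)
        + ennreal t * ennreal ((LINT x|lborel. g x) / B) \<le> ennreal ((LINT x|lborel. h x) / P)"
      using int[OF fm f0 fb fC] int[OF gm g0 gb gC] hi f0 g0 h0 A B P by simp
    then have "(1 - t) * ((LINT x|lborel. f x) / A) + t * ((LINT x|lborel. g x) / B)
        \<le> (LINT x|lborel. h x) / P"
      using t A B P Ih f0 g0 by (simp flip: ennreal_mult ennreal_plus)
    moreover have "((LINT x|lborel. f x) / A) powr (1 - t) * ((LINT x|lborel. g x) / B) powr t
        \<le> (1 - t) * ((LINT x|lborel. f x) / A) + t * ((LINT x|lborel. g x) / B)"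
      using t A B f0 g0 by (intro powr_prod_le_convex_comb) auto
    ultimately have "((LINT x|lborel. f x) / A) powr (1 - t) * ((LINT x|lborel. g x) / B) powr t
        \<le> (LINT x|lborel. h x) / P" by simp
    then show ?thesis
      using A B P f0 g0 by (simp add: powr_divide P_def divide_le_cancel)
  qed
qed

section \<open>Integrating out directions of a convex body\<close>

definition marginal :: "'a \<Rightarrow> ('a::euclidean_space \<Rightarrow> real) \<Rightarrow> 'a \<Rightarrow> real" where
  "marginal b f x = (LINT r|lborel. f (x + r *\<^sub>R b))"

lemma integrable_on_line:
  fixes f :: "'a::euclidean_space \<Rightarrow> real"
  assumes [measurable]: "f \<in> borel_measurable borel" and "\<And>x. 0 \<le> f x" "\<And>x. f x \<le> C"
    and b: "norm b = 1" and supp: "\<forall>x. f x \<noteq> 0 \<longrightarrow> \<bar>b \<bullet> x\<bar> \<le> R"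
  shows "bounded {r. f (x + r *\<^sub>R b) \<noteq> 0}" "integrable lborel (\<lambda>r. f (x + r *\<^sub>R b))"
proof -
  have "b \<bullet> b = 1" using b by (simp add: dot_square_norm)
  then have "{r. f (x + r *\<^sub>R b) \<noteq> 0} \<subseteq> {- R - b \<bullet> x..R - b \<bullet> x}"
    using supp by (fastforce simp: inner_add_right abs_le_iff)
  then show bd: "bounded {r. f (x + r *\<^sub>R b) \<noteq> 0}"
    using bounded_closed_interval bounded_subset by blast
  show "integrable lborel (\<lambda>r. f (x + r *\<^sub>R b))"
    by (rule integrable_bounded_support[OF _ bd, of C]) (use assms in auto)
qed

text \<open>Log-concavity of a marginal is the Prekopa-Leindler inequality on three parallel lines. The other
parts keep the function bounded and with bounded support in the remaining directions, so that the step can be repeated.\<close>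

lemma marginal_properties:
  fixes f :: "'a::euclidean_space \<Rightarrow> real"
  assumes f: "logconcave f" and fm[measurable]: "f \<in> borel_measurable borel" and C: "\<And>x. f x \<le> C"
    and b: "norm b = 1" and supp: "\<forall>x. f x \<noteq> 0 \<longrightarrow> \<bar>b \<bullet> x\<bar> \<le> R"
  shows "logconcave (marginal b f)"
    and "marginal b f \<in> borel_measurable borel"
    and "ennreal (marginal b f x) = (\<integral>\<^sup>+r. f (x + r *\<^sub>R b) \<partial>lborel)"
    and "marginal b f x \<le> C * (2 * \<bar>R\<bar>)"
    and "marginal b f (x + s *\<^sub>R b) = marginal b f x"
    and "marginal b f x \<noteq> 0 \<Longrightarrow> c \<bullet> b = 0 \<Longrightarrow> (\<And>y. f y \<noteq> 0 \<Longrightarrow> c \<bullet> y \<le> K) \<Longrightarrow> c \<bullet> x \<le> K"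
proof -
  note f0 = logconcave_nonneg[OF f]
  note line = integrable_on_line[of f C b R, OF fm f0 C b supp]
  show "logconcave (marginal b f)"
    unfolding logconcave_def
  proof (intro conjI allI impI)
    show "0 \<le> marginal b f x" for x by (simp add: marginal_def f0)
    fix x y :: 'a and t :: real assume t: "0 < t \<and> t < 1"
    have conv: "convex {r. c < f (x + r *\<^sub>R b)}" for x c
    proof -
      have "(1 - u) * r + u * s \<in> {r. c < f (x + r *\<^sub>R b)}"
        if "c < f (x + r *\<^sub>R b)" "c < f (x + s *\<^sub>R b)" "0 \<le> u" "u \<le> 1" for r s u
      proof -
        have "(1 - u) *\<^sub>R (x + r *\<^sub>R b) + u *\<^sub>R (x + s *\<^sub>R b) = x + ((1 - u) * r + u * s) *\<^sub>R b"
          by (simp add: algebra_simps)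
        then show ?thesis
          using convexD_alt[OF convex_superlevel_logconcave[OF f, of c], of "x + r *\<^sub>R b" "x + s *\<^sub>R b" u] that
          by simp
      qed
      then show ?thesis by (auto simp: convex_alt)
    qed
    have "(LINT r|lborel. f (x + r *\<^sub>R b)) powr (1 - t) * (LINT r|lborel. f (y + r *\<^sub>R b)) powr t
      \<le> (LINT r|lborel. f ((1 - t) *\<^sub>R x + t *\<^sub>R y + r *\<^sub>R b))"
    proof (rule prekopa_leindler_line[where C = C])
      fix r s :: real
      have "(1 - t) *\<^sub>R (x + r *\<^sub>R b) + t *\<^sub>R (y + s *\<^sub>R b)
          = (1 - t) *\<^sub>R x + t *\<^sub>R y + ((1 - t) * r + t * s) *\<^sub>R b"
        by (simp add: algebra_simps)
      then show "f (x + r *\<^sub>R b) powr (1 - t) * f (y + s *\<^sub>R b) powr t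
          \<le> f ((1 - t) *\<^sub>R x + t *\<^sub>R y + ((1 - t) * r + t * s) *\<^sub>R b)"
        using logconcaveD[OF f, of t "x + r *\<^sub>R b" "y + s *\<^sub>R b"] t by simp
    qed (use line f0 C t conv in auto)
    then show "marginal b f x powr (1 - t) * marginal b f y powr t \<le> marginal b f ((1 - t) *\<^sub>R x + t *\<^sub>R y)"
      by (simp add: marginal_def)
  qed
  show "marginal b f \<in> borel_measurable borel"
    unfolding marginal_def[abs_def] by measurable
  show "ennreal (marginal b f x) = (\<integral>\<^sup>+r. f (x + r *\<^sub>R b) \<partial>lborel)"
    unfolding marginal_def by (rule nn_integral_eq_integral[symmetric]) (use line f0 in auto)
  show "marginal b f x \<le> C * (2 * \<bar>R\<bar>)"
  proof -
    have bb: "b \<bullet> b = 1" using b by (simp add: dot_square_norm)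
    have "marginal b f x \<le> (LINT r|lborel. indicator {- \<bar>R\<bar> - b \<bullet> x..\<bar>R\<bar> - b \<bullet> x} r *\<^sub>R C)"
      unfolding marginal_def
    proof (rule integral_mono)
      fix r
      show "f (x + r *\<^sub>R b) \<le> indicator {- \<bar>R\<bar> - b \<bullet> x..\<bar>R\<bar> - b \<bullet> x} r *\<^sub>R C"
      proof (cases "f (x + r *\<^sub>R b) = 0")
        case True
        then show ?thesis using order_trans[OF f0 C] by (auto simp: indicator_def)
      next
        case False
        then have "\<bar>b \<bullet> (x + r *\<^sub>R b)\<bar> \<le> R" using supp by blast
          then show ?thesis using C bb by (auto simp: indicator_def inner_add_right)
      qed
    qed (use line in \<open>auto intro!: integrable_scaleR_left integrable_real_indicator\<close>)
    also have "\<dots> = C * (2 * \<bar>R\<bar>)" by simp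
    finally show ?thesis .
  qed
  show "marginal b f (x + s *\<^sub>R b) = marginal b f x"
    using lborel_integral_real_affine[of 1 "\<lambda>r. f (x + r *\<^sub>R b)" s]
    by (simp add: marginal_def algebra_simps)
  show "c \<bullet> x \<le> K" if c: "marginal b f x \<noteq> 0" "c \<bullet> b = 0" "\<And>y. f y \<noteq> 0 \<Longrightarrow> c \<bullet> y \<le> K"
  proof -
    have "\<exists>r. f (x + r *\<^sub>R b) \<noteq> 0"
    proof (rule ccontr)
      assume "\<not> ?thesis"
      then have "marginal b f x = 0" by (simp add: marginal_def)
      then show False using c by simp
    qed
    then obtain r where "c \<bullet> (x + r *\<^sub>R b) \<le> K" using c(3) by blast
    then show ?thesis using c(2) by (simp add: inner_add_right)
  qed
qed

text \<open>A substitute for Fubini's theorem in coordinates that works for any unit vector \<open>b\<close> without choosing a complement of the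
line: average \<open>f\<close> over its translates along \<open>b\<close> by all \<open>r\<close> with \<open>b \<bullet> x - r\<close> in \<open>[0, 1]\<close>, interchange
the two integrals and translate back.\<close>

lemma nn_integral_disintegrate_line:
  fixes f :: "'a::euclidean_space \<Rightarrow> ennreal"
  assumes fm: "f \<in> borel_measurable borel" and b: "norm b = 1"
  shows "(\<integral>\<^sup>+x. f x \<partial>lborel)
    = (\<integral>\<^sup>+x. indicator {x. 0 \<le> b \<bullet> x \<and> b \<bullet> x \<le> 1} x * (\<integral>\<^sup>+r. f (x + r *\<^sub>R b) \<partial>lborel) \<partial>lborel)"
proof -
  note [measurable] = fm
  have bb: "b \<bullet> b = 1" using b by (simp add: dot_square_norm)
  define w where "w = (\<lambda>s::real. indicator {0..1} s :: ennreal)"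
  have [measurable]: "w \<in> borel_measurable borel" by (simp add: w_def)
  have one: "(\<integral>\<^sup>+r. w (s - r) \<partial>lborel) = 1" for s
  proof -
    have "(\<integral>\<^sup>+r. w (s - r) \<partial>lborel) = (\<integral>\<^sup>+r. w r \<partial>lborel)"
      using nn_integral_real_affine[of w "-1" s] by simp
    then show ?thesis by (simp add: w_def)
  qed
  have "(\<integral>\<^sup>+x. f x \<partial>lborel) = (\<integral>\<^sup>+x. (\<integral>\<^sup>+r. f x * w (b \<bullet> x - r) \<partial>lborel) \<partial>lborel)"
    by (subst nn_integral_cmult) (simp_all add: one)
  also have "\<dots> = (\<integral>\<^sup>+r. (\<integral>\<^sup>+x. f x * w (b \<bullet> x - r) \<partial>lborel) \<partial>lborel)"
    by (intro lborel_pair.Fubini'[symmetric]) measurable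
  also have "\<dots> = (\<integral>\<^sup>+r. (\<integral>\<^sup>+x. f (x + r *\<^sub>R b) * w (b \<bullet> x) \<partial>lborel) \<partial>lborel)"
  proof (rule nn_integral_cong)
    fix r :: real
    have "(\<integral>\<^sup>+x. f x * w (b \<bullet> x - r) \<partial>lborel)
        = (\<integral>\<^sup>+x. f x * w (b \<bullet> x - r) \<partial>distr lborel borel ((+) (r *\<^sub>R b)))"
      by (simp add: lborel_distr_plus)
    also have "\<dots> = (\<integral>\<^sup>+x. f (x + r *\<^sub>R b) * w (b \<bullet> x) \<partial>lborel)"
      by (subst nn_integral_distr) (simp_all add: inner_add_right bb add.commute[of "r *\<^sub>R b"])
    finally show "(\<integral>\<^sup>+x. f x * w (b \<bullet> x - r) \<partial>lborel) = (\<integral>\<^sup>+x. f (x + r *\<^sub>R b) * w (b \<bullet> x) \<partial>lborel)" .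
  qed
  also have "\<dots> = (\<integral>\<^sup>+x. (\<integral>\<^sup>+r. f (x + r *\<^sub>R b) * w (b \<bullet> x) \<partial>lborel) \<partial>lborel)"
    by (intro lborel_pair.Fubini') measurable
  also have "\<dots> = (\<integral>\<^sup>+x. indicator {x. 0 \<le> b \<bullet> x \<and> b \<bullet> x \<le> 1} x * (\<integral>\<^sup>+r. f (x + r *\<^sub>R b) \<partial>lborel) \<partial>lborel)"
    by (intro nn_integral_cong, subst nn_integral_multc)
       (auto simp: w_def mult.commute indicator_def)
  finally show ?thesis .
qed

definition unit_slabs :: "'a::euclidean_space set \<Rightarrow> 'a set" where
  "unit_slabs J = {x. \<forall>b\<in>J. 0 \<le> b \<bullet> x \<and> b \<bullet> x \<le> 1}"

lemma measurable_unit_slabs [measurable]: "finite J \<Longrightarrow> unit_slabs J \<in> sets borel"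
proof -
  assume "finite J"
  have "unit_slabs J = (\<Inter>b\<in>J. {x. 0 \<le> b \<bullet> x \<and> b \<bullet> x \<le> 1})" by (auto simp: unit_slabs_def)
  moreover have "closed {x. 0 \<le> b \<bullet> x \<and> b \<bullet> x \<le> 1}" for b :: 'a
    by (intro closed_Collect_conj closed_Collect_le continuous_intros)
  ultimately have "closed (unit_slabs J)" by auto
  then show ?thesis by simp
qed

text \<open>\<open>f\<close> is the indicator function of \<open>K\<close> integrated along the span of \<open>J\<close>. It is constant along \<open>J\<close>, so its integral
over the whole space is infinite; restricting it to \<open>unit_slabs J\<close> repairs this, as the unit cube in the
span of \<open>J\<close> has volume 1.\<close>

definition integrated_out :: "'a::euclidean_space set \<Rightarrow> 'a set \<Rightarrow> ('a \<Rightarrow> real) \<Rightarrow> bool" where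
  "integrated_out K J f \<longleftrightarrow>
    logconcave f \<and> f \<in> borel_measurable borel \<and> (\<exists>C. \<forall>x. f x \<le> C) \<and>
    (\<forall>b\<in>J. \<forall>x s. f (x + s *\<^sub>R b) = f x) \<and>
    (\<forall>c k x. (\<forall>b\<in>J. c \<bullet> b = 0) \<longrightarrow> (\<forall>y\<in>K. c \<bullet> y \<le> k) \<longrightarrow> f x \<noteq> 0 \<longrightarrow> c \<bullet> x \<le> k) \<and>
    (\<forall>\<phi>::'a \<Rightarrow> ennreal. \<phi> \<in> borel_measurable borel \<longrightarrow> (\<forall>b\<in>J. \<forall>x s. \<phi> (x + s *\<^sub>R b) = \<phi> x) \<longrightarrow>
       (\<integral>\<^sup>+x. \<phi> x * indicator K x \<partial>lborel) = (\<integral>\<^sup>+x. \<phi> x * f x * indicator (unit_slabs J) x \<partial>lborel))"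

lemma iterated_marginal:
  fixes K :: "'a::euclidean_space set"
  assumes K: "compact K" "convex K" and J: "finite J"
    and "pairwise orthogonal J" "\<forall>b\<in>J. norm b = 1"
  shows "\<exists>f. integrated_out K J f"
  using J assms(4,5)
proof (induction J rule: finite_induct)
  case empty
  have "K \<in> sets borel" using K by (simp add: borel_compact)
  then show ?case
    using logconcave_indicator[OF K(2)] unfolding integrated_out_def
    by (intro exI[of _ "indicator K"])
      (auto simp: unit_slabs_def simp del: indicator_simps split: split_indicator
         intro!: nn_integral_cong exI[of _ 1])
next
  case (insert j J)
  have j: "norm j = 1" and jJ: "\<And>b. b \<in> J \<Longrightarrow> j \<bullet> b = 0"
    using insert by (auto simp: pairwise_insert orthogonal_def)
  have "pairwise orthogonal J" "\<forall>b\<in>J. norm b = 1"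
    using insert.prems by (auto simp: pairwise_insert)
  from insert.IH[OF this] obtain f where int_out: "integrated_out K J f" by blast
  then obtain C where C: "\<And>x. f x \<le> C" by (auto simp: integrated_out_def)
  have f: "logconcave f" and fm[measurable]: "f \<in> borel_measurable borel"
    and inv: "\<And>b x s. b \<in> J \<Longrightarrow> f (x + s *\<^sub>R b) = f x"
    and supp: "\<And>c k x. (\<forall>b\<in>J. c \<bullet> b = 0) \<Longrightarrow> (\<forall>y\<in>K. c \<bullet> y \<le> k) \<Longrightarrow> f x \<noteq> 0 \<Longrightarrow> c \<bullet> x \<le> k"
    and int: "\<And>\<phi>::'a \<Rightarrow> ennreal. \<phi> \<in> borel_measurable borel \<Longrightarrow> (\<forall>b\<in>J. \<forall>x s. \<phi> (x + s *\<^sub>R b) = \<phi> x) \<Longrightarrow>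
       (\<integral>\<^sup>+x. \<phi> x * indicator K x \<partial>lborel) = (\<integral>\<^sup>+x. \<phi> x * f x * indicator (unit_slabs J) x \<partial>lborel)"
    using int_out by (auto simp: integrated_out_def)
  obtain R where R: "\<And>y. y \<in> K \<Longrightarrow> norm y \<le> R"
    using compact_imp_bounded[OF K(1)] by (auto simp: bounded_iff)
  have R': "\<forall>x. f x \<noteq> 0 \<longrightarrow> \<bar>j \<bullet> x\<bar> \<le> R"
  proof (intro allI impI)
    fix x assume nz: "f x \<noteq> 0"
    have "\<bar>j \<bullet> y\<bar> \<le> R" if "y \<in> K" for y
      using Cauchy_Schwarz_ineq2[of j y] j R[OF that] by simp
    then have "j \<bullet> x \<le> R" "(- j) \<bullet> x \<le> R"
      by (intro supp[OF _ _ nz]; force simp: jJ abs_le_iff)+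
    then show "\<bar>j \<bullet> x\<bar> \<le> R" by simp
  qed
  note m = marginal_properties[OF f fm C j R']
  have [measurable]: "unit_slabs J \<in> sets borel" "unit_slabs (insert j J) \<in> sets borel"
    using insert by (auto intro!: measurable_unit_slabs)
  show ?case
    unfolding integrated_out_def
  proof (rule exI[of _ "marginal j f"], intro conjI allI impI ballI)
    show "\<exists>C. \<forall>x. marginal j f x \<le> C" using m(4) by blast
    show "marginal j f (x + s *\<^sub>R b) = marginal j f x" if "b \<in> insert j J" for b x s
    proof (cases "b = j")
      case False
      then have "f (x + s *\<^sub>R b + r *\<^sub>R j) = f (x + r *\<^sub>R j)" for r
        using inv[of b "x + r *\<^sub>R j" s] that by (simp add: algebra_simps)
      then show ?thesis by (simp add: marginal_def)
    qed (simp add: m)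
    show "c \<bullet> x \<le> k" if "\<forall>b\<in>insert j J. c \<bullet> b = 0" "\<forall>y\<in>K. c \<bullet> y \<le> k" "marginal j f x \<noteq> 0" for c k x
      by (rule m(6)[OF that(3)]) (use that supp[of c k] in auto)
    fix \<phi> :: "'a \<Rightarrow> ennreal"
    assume \<phi>[measurable]: "\<phi> \<in> borel_measurable borel" and \<phi>inv: "\<forall>b\<in>insert j J. \<forall>x s. \<phi> (x + s *\<^sub>R b) = \<phi> x"
    have slab: "indicator (unit_slabs J) (x + r *\<^sub>R j) = (indicator (unit_slabs J) x :: ennreal)" for x r
      by (auto simp: unit_slabs_def indicator_def inner_add_right jJ inner_commute[of _ j])
    have "(\<integral>\<^sup>+x. \<phi> x * indicator K x \<partial>lborel) = (\<integral>\<^sup>+x. \<phi> x * f x * indicator (unit_slabs J) x \<partial>lborel)"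
      by (rule int) (use \<phi> \<phi>inv in auto)
    also have "\<dots> = (\<integral>\<^sup>+x. indicator {x. 0 \<le> j \<bullet> x \<and> j \<bullet> x \<le> 1} x *
        (\<integral>\<^sup>+r. \<phi> (x + r *\<^sub>R j) * f (x + r *\<^sub>R j) * indicator (unit_slabs J) (x + r *\<^sub>R j) \<partial>lborel) \<partial>lborel)"
      by (rule nn_integral_disintegrate_line[OF _ j]) measurable
    also have "\<dots> = (\<integral>\<^sup>+x. \<phi> x * marginal j f x * indicator (unit_slabs (insert j J)) x \<partial>lborel)"
    proof (rule nn_integral_cong)
      fix x
      have "(\<integral>\<^sup>+r. \<phi> (x + r *\<^sub>R j) * f (x + r *\<^sub>R j) * indicator (unit_slabs J) (x + r *\<^sub>R j) \<partial>lborel)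
        = (\<integral>\<^sup>+r. (\<phi> x * indicator (unit_slabs J) x) * f (x + r *\<^sub>R j) \<partial>lborel)"
        using \<phi>inv by (intro nn_integral_cong) (simp add: slab mult_ac)
      also have "\<dots> = (\<phi> x * indicator (unit_slabs J) x) * marginal j f x"
        by (subst nn_integral_cmult) (simp_all add: m(3))
      finally show "indicator {x. 0 \<le> j \<bullet> x \<and> j \<bullet> x \<le> 1} x *
        (\<integral>\<^sup>+r. \<phi> (x + r *\<^sub>R j) * f (x + r *\<^sub>R j) * indicator (unit_slabs J) (x + r *\<^sub>R j) \<partial>lborel)
        = \<phi> x * marginal j f x * indicator (unit_slabs (insert j J)) x"
        by (auto simp: unit_slabs_def indicator_def)
    qed
    finally show "(\<integral>\<^sup>+x. \<phi> x * indicator K x \<partial>lborel)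
      = (\<integral>\<^sup>+x. \<phi> x * marginal j f x * indicator (unit_slabs (insert j J)) x \<partial>lborel)" .
  qed (use m in auto)
qed

text \<open>A cylinder is a product of a line with a section, and its section enters only through the volume
of a piece of length 1.\<close>

lemma nn_integral_cylinder:
  fixes Q :: "'a::euclidean_space set"
  assumes [measurable]: "Q \<in> sets borel" "\<phi> \<in> borel_measurable borel" and u: "norm u = 1"
    and Q: "\<And>x s. x + s *\<^sub>R u \<in> Q \<longleftrightarrow> x \<in> Q"
  shows "(\<integral>\<^sup>+x. \<phi> (u \<bullet> x) * indicator Q x \<partial>lborel)
    = (\<integral>\<^sup>+r. \<phi> r \<partial>lborel) * emeasure lborel {x\<in>Q. 0 \<le> u \<bullet> x \<and> u \<bullet> x \<le> 1}"
proof -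
  have uu: "u \<bullet> u = 1" using u by (simp add: dot_square_norm)
  have "(\<integral>\<^sup>+x. \<phi> (u \<bullet> x) * indicator Q x \<partial>lborel)
    = (\<integral>\<^sup>+x. indicator {x. 0 \<le> u \<bullet> x \<and> u \<bullet> x \<le> 1} x *
        (\<integral>\<^sup>+r. \<phi> (u \<bullet> (x + r *\<^sub>R u)) * indicator Q (x + r *\<^sub>R u) \<partial>lborel) \<partial>lborel)"
    by (rule nn_integral_disintegrate_line[OF _ u]) measurable
  also have "\<dots> = (\<integral>\<^sup>+x. (\<integral>\<^sup>+r. \<phi> r \<partial>lborel) * indicator {x\<in>Q. 0 \<le> u \<bullet> x \<and> u \<bullet> x \<le> 1} x \<partial>lborel)"
  proof (rule nn_integral_cong)
    fix x
    have "(\<integral>\<^sup>+r. \<phi> (u \<bullet> (x + r *\<^sub>R u)) * indicator Q (x + r *\<^sub>R u) \<partial>lborel)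
      = (\<integral>\<^sup>+r. \<phi> (u \<bullet> x + 1 * r) * indicator Q x \<partial>lborel)"
      using Q by (intro nn_integral_cong) (simp add: inner_add_right uu indicator_def)
    also have "\<dots> = (\<integral>\<^sup>+r. \<phi> r \<partial>lborel) * indicator Q x"
      using nn_integral_real_affine[of \<phi> 1 "u \<bullet> x"]
      by (subst nn_integral_multc) auto
    finally show "indicator {x. 0 \<le> u \<bullet> x \<and> u \<bullet> x \<le> 1} x *
        (\<integral>\<^sup>+r. \<phi> (u \<bullet> (x + r *\<^sub>R u)) * indicator Q (x + r *\<^sub>R u) \<partial>lborel)
      = (\<integral>\<^sup>+r. \<phi> r \<partial>lborel) * indicator {x\<in>Q. 0 \<le> u \<bullet> x \<and> u \<bullet> x \<le> 1} x"
      by (auto simp: indicator_def)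
  qed
  also have "\<dots> = (\<integral>\<^sup>+r. \<phi> r \<partial>lborel) * emeasure lborel {x\<in>Q. 0 \<le> u \<bullet> x \<and> u \<bullet> x \<le> 1}"
    by (rule nn_integral_cmult_indicator) measurable
  finally show ?thesis .
qed

text \<open>All directions of an orthonormal basis except \<open>u\<close> are integrated out. The remaining function depends
on \<open>u \<bullet> x\<close> alone.\<close>

lemma marginal_density:
  fixes K :: "'a::euclidean_space set"
  assumes K: "compact K" "convex K" and u: "norm u = 1" and ab: "\<And>x. x \<in> K \<Longrightarrow> a \<le> u \<bullet> x \<and> u \<bullet> x \<le> b"
  obtains f :: "real \<Rightarrow> real" where "logconcave f" "f \<in> borel_measurable borel" "\<exists>C. \<forall>r. f r \<le> C"
    "\<And>r. f r \<noteq> 0 \<Longrightarrow> a \<le> r \<and> r \<le> b"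
    "\<And>\<phi>. \<phi> \<in> borel_measurable borel \<Longrightarrow>
       (\<integral>\<^sup>+x. \<phi> (u \<bullet> x) * indicator K x \<partial>lborel) = (\<integral>\<^sup>+r. \<phi> r * ennreal (f r) \<partial>lborel)"
proof -
  have uu: "u \<bullet> u = 1" using u by (simp add: dot_square_norm)
  obtain S where S: "u \<in> S" "pairwise orthogonal S" "\<And>x. x \<in> S \<Longrightarrow> norm x = 1"
    "independent S" "card S = DIM('a)" "span S = UNIV"
    using vector_in_orthonormal_basis[OF u] by metis
  have fin: "finite S" using S by (metis independent_imp_finite)
  define J where "J = S - {u}"
  have J: "finite J" "pairwise orthogonal J" "\<forall>b\<in>J. norm b = 1"
    using fin S by (auto simp: J_def pairwise_def)
  have uJ: "b \<bullet> u = 0" if "b \<in> J" for b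
    using that S by (auto simp: J_def pairwise_def orthogonal_def)
  obtain M where int_out: "integrated_out K J M"
    using iterated_marginal[OF K J] by blast
  then obtain C where C: "\<And>x. M x \<le> C" by (auto simp: integrated_out_def)
  have M: "logconcave M" and fm[measurable]: "M \<in> borel_measurable borel"
    and inv: "\<And>b x s. b \<in> J \<Longrightarrow> M (x + s *\<^sub>R b) = M x"
    and supp: "\<And>c k x. (\<forall>b\<in>J. c \<bullet> b = 0) \<Longrightarrow> (\<forall>y\<in>K. c \<bullet> y \<le> k) \<Longrightarrow> M x \<noteq> 0 \<Longrightarrow> c \<bullet> x \<le> k"
    and int: "\<And>\<phi>::'a \<Rightarrow> ennreal. \<phi> \<in> borel_measurable borel \<Longrightarrow> (\<forall>b\<in>J. \<forall>x s. \<phi> (x + s *\<^sub>R b) = \<phi> x) \<Longrightarrow>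
       (\<integral>\<^sup>+x. \<phi> x * indicator K x \<partial>lborel) = (\<integral>\<^sup>+x. \<phi> x * M x * indicator (unit_slabs J) x \<partial>lborel)"
    using int_out by (auto simp: integrated_out_def)
  have expand: "x = (\<Sum>b\<in>S. (b \<bullet> x) *\<^sub>R b)" for x
  proof -
    have "x \<in> span S" using S by simp
    then obtain g where g: "x = (\<Sum>b\<in>S. g b *\<^sub>R b)"
      using fin by (auto simp: span_finite)
    have "b \<bullet> x = g b" if "b \<in> S" for b
    proof -
      have "b \<bullet> x = (\<Sum>c\<in>S. g c * (b \<bullet> c))" by (simp add: g inner_sum_right)
      also have "\<dots> = (\<Sum>c\<in>S. if c = b then g b else 0)"
        using S(2,3) that by (intro sum.cong) (auto simp: pairwise_def orthogonal_def dot_square_norm)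
      finally show ?thesis using fin that by simp
    qed
    then show ?thesis using g by simp
  qed
  have Mu: "M x = M ((u \<bullet> x) *\<^sub>R u)" for x
  proof -
    have step: "M (y + (\<Sum>b\<in>I. g b *\<^sub>R b)) = M y" if "finite I" "I \<subseteq> J" for I y and g :: "'a \<Rightarrow> real"
      using that
    proof (induction I rule: finite_induct)
      case (insert i I)
      have "M (y + (\<Sum>b\<in>insert i I. g b *\<^sub>R b)) = M ((y + (\<Sum>b\<in>I. g b *\<^sub>R b)) + g i *\<^sub>R i)"
        using insert by (simp add: algebra_simps)
      then show ?case using inv[of i] insert by simp
    qed simp
    have "x = (\<Sum>b\<in>S. (b \<bullet> x) *\<^sub>R b)" by (rule expand)
    also have "\<dots> = (u \<bullet> x) *\<^sub>R u + (\<Sum>b\<in>J. (b \<bullet> x) *\<^sub>R b)"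
      unfolding J_def using fin S(1) by (simp add: sum.remove)
    finally have "x = (u \<bullet> x) *\<^sub>R u + (\<Sum>b\<in>J. (b \<bullet> x) *\<^sub>R b)" .
    then show ?thesis using step[OF J(1) order_refl, of "(u \<bullet> x) *\<^sub>R u" "\<lambda>b. b \<bullet> x"] by simp
  qed
  define V where "V = {x \<in> unit_slabs J. 0 \<le> u \<bullet> x \<and> u \<bullet> x \<le> 1}"
  have VS: "V = unit_slabs S" using S(1) by (auto simp: V_def unit_slabs_def J_def)
  have "bounded V"
  proof -
    have "norm x \<le> real (card S)" if "x \<in> V" for x
    proof -
      have "norm x = norm (\<Sum>b\<in>S. (b \<bullet> x) *\<^sub>R b)" using expand[of x] by simp
      also have "\<dots> \<le> (\<Sum>b\<in>S. norm ((b \<bullet> x) *\<^sub>R b))" by (rule norm_sum)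
      also have "\<dots> \<le> (\<Sum>b\<in>S. 1)"
        using that S(3) by (intro sum_mono) (auto simp: VS unit_slabs_def)
      finally show ?thesis by simp
    qed
    then show ?thesis by (auto simp: bounded_iff)
  qed
  then have Vfin: "emeasure lborel V < \<infinity>"
    by (rule emeasure_bounded_finite)
  define v where "v = measure lborel V"
  have v: "emeasure lborel V = ennreal v" "0 \<le> v"
    using Vfin by (auto simp: v_def emeasure_eq_ennreal_measure)
  define f where "f r = v * M (r *\<^sub>R u)" for r
  show thesis
  proof (rule that[of f])
    have "logconcave (\<lambda>r. M (r *\<^sub>R u))"
      using logconcave_nonneg[OF M] logconcaveD[OF M, of _ "_ *\<^sub>R u" "_ *\<^sub>R u"]
      by (simp add: logconcave_def scaleR_add_left)
    moreover have "logconcave (\<lambda>r::real. v)"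
      using v(2) by (auto simp: logconcave_def simp flip: powr_add)
    ultimately show "logconcave f"
      unfolding f_def[abs_def] by (intro logconcave_mult)
    show "f \<in> borel_measurable borel" by (simp add: f_def[abs_def])
    show "\<exists>C. \<forall>r. f r \<le> C" using C v(2) by (auto simp: f_def intro!: exI[of _ "v * C"] mult_left_mono)
    show "a \<le> r \<and> r \<le> b" if "f r \<noteq> 0" for r
    proof -
      have nz: "M (r *\<^sub>R u) \<noteq> 0" using that by (auto simp: f_def)
      have "u \<bullet> (r *\<^sub>R u) \<le> b" by (rule supp[OF _ _ nz]) (use uJ ab in \<open>auto simp: inner_commute\<close>)
      moreover have "(- u) \<bullet> (r *\<^sub>R u) \<le> - a" by (rule supp[OF _ _ nz]) (use uJ ab in \<open>auto simp: inner_commute\<close>)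
      ultimately show ?thesis by (simp add: uu)
    qed
    fix \<phi> :: "real \<Rightarrow> ennreal" assume [measurable]: "\<phi> \<in> borel_measurable borel"
    have "(\<integral>\<^sup>+x. \<phi> (u \<bullet> x) * indicator K x \<partial>lborel)
      = (\<integral>\<^sup>+x. \<phi> (u \<bullet> x) * M x * indicator (unit_slabs J) x \<partial>lborel)"
      by (rule int) (auto simp: inner_add_right uJ inner_commute[of u])
    also have "\<dots> = (\<integral>\<^sup>+x. (\<lambda>r. \<phi> r * M (r *\<^sub>R u)) (u \<bullet> x) * indicator (unit_slabs J) x \<partial>lborel)"
      using Mu by simp
    also have "\<dots> = (\<integral>\<^sup>+r. \<phi> r * M (r *\<^sub>R u) \<partial>lborel) * emeasure lborel V"
      unfolding V_def
      by (rule nn_integral_cylinder) (use J uJ u in \<open>auto simp: unit_slabs_def inner_add_right\<close>)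
    also have "\<dots> = (\<integral>\<^sup>+r. \<phi> r * ennreal (f r) \<partial>lborel)"
      unfolding v(1) f_def
      by (subst nn_integral_multc[symmetric]) (auto simp: ennreal_mult' v mult_ac)
    finally show "(\<integral>\<^sup>+x. \<phi> (u \<bullet> x) * indicator K x \<partial>lborel) = (\<integral>\<^sup>+r. \<phi> r * ennreal (f r) \<partial>lborel)" .
  qed
qed

section \<open>Second moments of log-concave densities on an interval\<close>

text \<open>This is \<open>1/k\<^sup>2 - 1/(sinh k)\<^sup>2 \<le> 1/3\<close>, the estimate for the variance of the density
proportional to \<open>exp (k x)\<close> on \<open>[-1, 1]\<close>. In the variable \<open>z = 2 k\<close> the difference of the two sides vanishes at 0
together with its first three derivatives, and differentiating until the sign is evident proves it.\<close>

lemma sinh_square_bound: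
  fixes k :: real
  assumes "0 \<le> k"
  shows "(3 - k\<^sup>2) * (exp k - exp (- k))\<^sup>2 \<le> 12 * k\<^sup>2"
proof -
  have mono: "0 \<le> f z" if "f 0 = 0" "\<And>x. 0 \<le> x \<Longrightarrow> (f has_real_derivative f' x) (at x)"
      "\<And>x. 0 \<le> x \<Longrightarrow> 0 \<le> f' x" "0 \<le> z" for f f' :: "real \<Rightarrow> real" and z
    using DERIV_nonneg_imp_nondecreasing[of 0 z f] that by force
  have 1: "0 \<le> z * cosh z - sinh z" if "0 \<le> z" for z :: real
    by (rule mono[of _ "\<lambda>z. z * sinh z"]) (use that in \<open>auto intro!: derivative_eq_intros\<close>)
  have 2: "0 \<le> 10 - 10 * cosh z + 4 * (z * sinh z) + z * z * cosh z" if "0 \<le> z" for z :: real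
  proof (rule mono[of "\<lambda>z. 10 - 10 * cosh z + 4 * (z * sinh z) + z * z * cosh z" "\<lambda>z. 6 * (z * cosh z - sinh z) + z * z * sinh z"])
    show "0 \<le> 6 * (z * cosh z - sinh z) + z * z * sinh z" if "0 \<le> z" for z :: real
      using 1[OF that] that by (intro add_nonneg_nonneg) auto
  qed (use that in \<open>auto intro!: derivative_eq_intros simp: algebra_simps\<close>)
  have 3: "0 \<le> 2 * z * (cosh z + 5) + z * z * sinh z - 12 * sinh z" if "0 \<le> z" for z :: real
    by (rule mono[OF _ _ 2]) (use that in \<open>auto intro!: derivative_eq_intros simp: algebra_simps\<close>)
  have 4: "0 \<le> z * z * (cosh z + 5) - 12 * cosh z + 12" if "0 \<le> z" for z :: real
    by (rule mono[OF _ _ 3]) (use that in \<open>auto intro!: derivative_eq_intros simp: algebra_simps\<close>)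
  have "cosh (2 * k) = ((exp k)\<^sup>2 + (exp (- k))\<^sup>2) / 2"
    by (simp add: cosh_field_def power2_eq_square flip: exp_add)
  moreover have "(exp k - exp (- k))\<^sup>2 = (exp k)\<^sup>2 + (exp (- k))\<^sup>2 - 2"
    by (simp add: power2_diff flip: exp_add)
  ultimately have ch: "cosh (2 * k) = 1 + (exp k - exp (- k))\<^sup>2 / 2"
    by (simp add: diff_divide_distrib)
  define s where "s = (exp k - exp (- k))\<^sup>2"
  have "0 \<le> 2 * k * (2 * k) * (1 + s / 2 + 5) - 12 * (1 + s / 2) + 12"
    using 4[of "2 * k"] assms unfolding ch s_def by simp
  also have "\<dots> = 2 * (12 * k\<^sup>2 - (3 - k\<^sup>2) * s)"
    by (simp add: algebra_simps power2_eq_square)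
  finally show ?thesis by (simp add: s_def)
qed

text \<open>The set where \<open>f\<close> exceeds the exponential function is convex, with endpoints \<open>p\<close> and \<open>q\<close> say. So
\<open>(x - p) (x - q) (f x - g x) \<le> 0\<close> everywhere, and integrating this quadratic polynomial
against two densities with equal mass and mean compares their second moments.\<close>

lemma logconcave_compare_exponential:
  fixes f :: "real \<Rightarrow> real"
  assumes f: "logconcave f" and fm: "f \<in> borel_measurable borel" and fC: "\<And>x. f x \<le> B"
    and supp: "\<And>x. f x \<noteq> 0 \<Longrightarrow> -1 \<le> x \<and> x \<le> 1" and C: "0 < C"
    and g_def: "\<And>x. g x = C * exp (k * x) * indicator {-1..1} x"
    and m0: "(LINT x|lborel. f x) = (LINT x|lborel. g x)"
    and m1: "(LINT x|lborel. x * f x) = (LINT x|lborel. x * g x)"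
  shows "(LINT x|lborel. x\<^sup>2 * f x) \<le> (LINT x|lborel. x\<^sup>2 * g x)"
proof -
  note [measurable] = fm
  have [measurable]: "g \<in> borel_measurable borel" unfolding g_def[abs_def] by measurable
  have g0: "0 \<le> g x" for x using C by (simp add: g_def)
  have gC: "g x \<le> C * exp \<bar>k\<bar>" for x
  proof (cases "\<bar>x\<bar> \<le> 1")
    case True
    then have "\<bar>k\<bar> * \<bar>x\<bar> \<le> \<bar>k\<bar>" by (simp add: mult_left_le)
    then have "k * x \<le> \<bar>k\<bar>" using abs_ge_self[of "k * x"] by (simp add: abs_mult)
    then show ?thesis using C by (simp add: g_def indicator_def)
  next
    case False
    then show ?thesis using C by (auto simp: g_def indicator_def)
  qed
  have int: "integrable lborel (\<lambda>x. x ^ n * h x)"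
    if h[measurable]: "h \<in> borel_measurable borel" and h0: "\<And>x. 0 \<le> h x" and hD: "\<And>x. h x \<le> D"
      and hs: "\<And>x. h x \<noteq> 0 \<Longrightarrow> -1 \<le> x \<and> x \<le> 1" for h :: "real \<Rightarrow> real" and D n
  proof (rule integrable_bounded_support[where C = D])
    have "{x. x ^ n * h x \<noteq> 0} \<subseteq> {-1..1}" using hs by auto
    then show "bounded {x. x ^ n * h x \<noteq> 0}" using bounded_closed_interval bounded_subset by blast
    show "\<bar>x ^ n * h x\<bar> \<le> D" for x
    proof (cases "h x = 0")
      case True
      then show ?thesis using hD[of x] by simp
    next
      case False
      then have "\<bar>x\<bar> ^ n \<le> 1" using hs[OF False] by (intro power_le_one) auto
      then have "\<bar>x ^ n * h x\<bar> \<le> 1 * h x"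
        unfolding abs_mult power_abs using h0[of x] by (intro mult_mono) auto
      then show ?thesis using hD[of x] by simp
    qed
  qed measurable
  have gs: "-1 \<le> x \<and> x \<le> 1" if "g x \<noteq> 0" for x using that by (auto simp: g_def indicator_def split: if_splits)
  have fi: "integrable lborel (\<lambda>x. x ^ n * f x)" for n
    by (rule int[OF fm _ fC]) (use supp logconcave_nonneg[OF f] in auto)
  have gi: "integrable lborel (\<lambda>x. x ^ n * g x)" for n
    by (rule int[OF _ g0 gC]) (use gs in auto)
  define S where "S = {x. C * exp (k * x) < f x}"
  have S1: "S \<subseteq> {-1..1}"
  proof
    fix x assume "x \<in> S"
    moreover have "0 < C * exp (k * x)" using C by simp
    ultimately have "f x \<noteq> 0" by (auto simp: S_def)
    then show "x \<in> {-1..1}" using supp by auto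
  qed
  have "S = {x. C < f x * exp ((- k) * x)}"
    unfolding S_def by (simp add: exp_minus pos_less_divide_eq flip: divide_inverse)
  then have conv: "convex S"
    using convex_superlevel_logconcave[OF logconcave_mult[OF f logconcave_exp[of "- k"]]] by simp
  have fg: "f x \<le> g x" if "x \<notin> S" for x
    using that supp[of x] g0[of x] by (cases "f x = 0") (auto simp: S_def g_def indicator_def)
  show ?thesis
  proof (cases "S = {}")
    case True
    show ?thesis
      using fi[of 2] gi[of 2] True fg by (intro integral_mono) (auto intro: mult_left_mono)
  next
    case False
    define p q where "p = Inf S" and "q = Sup S"
    have bdd: "bdd_below S" "bdd_above S" 
      using bdd_below_mono[OF bdd_below_Icc S1] bdd_above_mono[OF bdd_above_Icc S1] by auto
    have sign: "(x - p) * (x - q) * (f x - g x) \<le> 0" for x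
    proof (cases "x \<in> S")
      case True
      then have "p \<le> x" "x \<le> q" unfolding p_def q_def using bdd by (auto intro: cInf_lower cSup_upper)
      moreover have "g x \<le> f x" using True S1 by (auto simp: S_def g_def indicator_def)
      ultimately show ?thesis by (simp add: mult_le_0_iff zero_le_mult_iff)
    next
      case xS: False
      have "x \<le> p \<or> q \<le> x"
      proof (rule ccontr)
        assume "\<not> ?thesis"
        then have "Inf S < x" "x < Sup S" by (auto simp: p_def q_def)
        then obtain y z where "y \<in> S" "y < x" "z \<in> S" "x < z"
          using cInf_less_iff[OF False bdd(1)] less_cSup_iff[OF False bdd(2)] by blast
        then have "x \<in> S"
          using conv mem_is_interval_1_I[of S y z x] by (simp add: is_interval_convex_1)
        then show False using xS by simp
      qed
      moreover have "p \<le> q" unfolding p_def q_def using False bdd by (auto intro: cInf_le_cSup)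
      ultimately have "0 \<le> (x - p) * (x - q)" by (auto simp: zero_le_mult_iff)
      then show ?thesis using fg[OF xS] by (simp add: mult_le_0_iff)
    qed
    have "0 \<le> (LINT x|lborel. - ((x - p) * (x - q) * (f x - g x)))"
      using sign by (intro Bochner_Integration.integral_nonneg) (simp add: neg_le_iff_le)
    also have "(LINT x|lborel. - ((x - p) * (x - q) * (f x - g x)))
      = (LINT x|lborel. (x\<^sup>2 * g x - x\<^sup>2 * f x) + (p + q) * (x * f x - x * g x) + p * q * (g x - f x))"
      by (intro Bochner_Integration.integral_cong) (auto simp: algebra_simps power2_eq_square)
    also have "\<dots> = (LINT x|lborel. x\<^sup>2 * g x) - (LINT x|lborel. x\<^sup>2 * f x)"
      using fi[of 0] fi[of 1] fi[of 2] gi[of 0] gi[of 1] gi[of 2] m0 m1 by simp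
    finally show ?thesis by simp
  qed
qed

lemma exponential_moments:
  fixes k :: real
  assumes k: "0 < k"
  defines "S \<equiv> exp k - exp (- k)" and "T \<equiv> exp k + exp (- k)"
  shows "(LINT x|lborel. exp (k * x) * indicator {-1..1} x) = S / k"
    and "(LINT x|lborel. (x * exp (k * x)) * indicator {-1..1} x) = T / k - S / k\<^sup>2"
    and "(LINT x|lborel. (x\<^sup>2 * exp (k * x)) * indicator {-1..1} x) = S / k - 2 * T / k\<^sup>2 + 2 * S / k ^ 3"
proof -
  have "(LINT x|lborel. exp (k * x) * indicator {-1..1} x) = exp (k * 1) / k - exp (k * (-1)) / k"
    by (rule integral_FTC_Icc_real) (use k in \<open>auto intro!: derivative_eq_intros continuous_intros\<close>)
  then show "(LINT x|lborel. exp (k * x) * indicator {-1..1} x) = S / k"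
    by (simp add: S_def diff_divide_distrib)
  have "(LINT x|lborel. (x * exp (k * x)) * indicator {-1..1} x)
     = exp (k * 1) * (1 / k - 1 / k\<^sup>2) - exp (k * (-1)) * ((-1) / k - 1 / k\<^sup>2)"
    by (rule integral_FTC_Icc_real)
      (use k in \<open>auto intro!: derivative_eq_intros continuous_intros simp: field_simps power2_eq_square\<close>)
  then show "(LINT x|lborel. (x * exp (k * x)) * indicator {-1..1} x) = T / k - S / k\<^sup>2"
    by (simp add: S_def T_def algebra_simps add_divide_distrib diff_divide_distrib)
  have "(LINT x|lborel. (x\<^sup>2 * exp (k * x)) * indicator {-1..1} x)
     = exp (k * 1) * (1\<^sup>2 / k - 2 * 1 / k\<^sup>2 + 2 / k ^ 3) - exp (k * (-1)) * ((-1)\<^sup>2 / k - 2 * (-1) / k\<^sup>2 + 2 / k ^ 3)"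
    by (rule integral_FTC_Icc_real)
      (use k in \<open>auto intro!: derivative_eq_intros continuous_intros simp: field_simps power2_eq_square power3_eq_cube\<close>)
  then show "(LINT x|lborel. (x\<^sup>2 * exp (k * x)) * indicator {-1..1} x) = S / k - 2 * T / k\<^sup>2 + 2 * S / k ^ 3"
    by (simp add: S_def T_def ring_distribs add_divide_distrib diff_divide_distrib mult.commute[of _ 2])
qed

lemma ex_exponential_with_mean:
  fixes \<mu> :: real
  assumes "0 < \<mu>" "\<mu> < 1"
  shows "\<exists>k>0. (exp k + exp (- k)) / (exp k - exp (- k)) - 1 / k = \<mu>"
proof -
  define m where "m k = (exp k + exp (- k)) / (exp k - exp (- k)) - 1 / k" for k :: real
  have "(m \<longlongrightarrow> 0) (at_right 0)" unfolding m_def by real_asymp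
  then have "eventually (\<lambda>k. m k < \<mu>) (at_right 0)" using assms by (auto dest: order_tendstoD)
  then obtain k1 where k1: "0 < k1" "m k1 < \<mu>"
    using eventually_happens[OF eventually_conj[OF _ eventually_at_right_less]] by (metis trivial_limit_at_right_real)
  have "(m \<longlongrightarrow> 1) at_top" unfolding m_def by real_asymp
  then have "eventually (\<lambda>k. \<mu> < m k) at_top" using assms by (auto dest: order_tendstoD)
  then obtain k2 where k2: "k1 \<le> k2" "\<mu> < m k2"
    unfolding eventually_at_top_linorder by (metis linorder_linear)
  have "continuous_on {k1..k2} m"
    unfolding m_def using k1 by (intro continuous_intros) auto
  then obtain k where "k1 \<le> k" "m k = \<mu>"
    using IVT'[of m k1 \<mu> k2] k1 k2 by auto
  then show ?thesis using k1 by (intro exI[of _ k]) (auto simp: m_def)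
qed

text \<open>Among log-concave densities on \<open>[-1, 1]\<close> of given mass and mean the exponential one has the largest
variance, and that of the exponential is largest, namely 1/3, in the uniform case. The mean is taken nonnegative to have a
nonnegative exponent.\<close>

lemma logconcave_variance_symmetric_interval:
  fixes f :: "real \<Rightarrow> real"
  assumes f: "logconcave f" and fm: "f \<in> borel_measurable borel" and fC: "\<And>x. f x \<le> B"
    and supp: "\<And>x. f x \<noteq> 0 \<Longrightarrow> -1 \<le> x \<and> x \<le> 1"
    and m0: "0 < (LINT x|lborel. f x)"
    and m1: "0 \<le> (LINT x|lborel. x * f x)" "(LINT x|lborel. x * f x) < (LINT x|lborel. f x)"
  shows "(LINT x|lborel. x\<^sup>2 * f x) * (LINT x|lborel. f x) - (LINT x|lborel. x * f x)\<^sup>2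
    \<le> (LINT x|lborel. f x)\<^sup>2 / 3"
proof -
  define M N where "M = (LINT x|lborel. f x)" and "N = (LINT x|lborel. x * f x)"
  have MN: "0 < M" "0 \<le> N" "N < M" using m0 m1 by (auto simp: M_def N_def)
  show ?thesis
  proof (cases "N = 0")
    case True
    have c: "(LINT x|lborel. 1 * indicator {-1..1::real} x) = (2::real)"
      using integral_FTC_Icc_real[of "-1" 1 "\<lambda>x. x" "\<lambda>_. 1"] by simp
    have "(LINT x|lborel. x * indicator {-1..1::real} x) = 1\<^sup>2 / 2 - (-1)\<^sup>2 / (2::real)"
      by (rule integral_FTC_Icc_real) (auto intro!: derivative_eq_intros)
    moreover have "(LINT x|lborel. x\<^sup>2 * indicator {-1..1::real} x) = 1 ^ 3 / 3 - (-1) ^ 3 / (3::real)"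
      by (rule integral_FTC_Icc_real) (auto intro!: derivative_eq_intros)
    ultimately have mom: "(LINT x|lborel. x * ((M / 2) * exp (0 * x) * indicator {-1..1} x)) = 0"
      "(LINT x|lborel. x\<^sup>2 * ((M / 2) * exp (0 * x) * indicator {-1..1} x)) = M / 3"
      by (simp_all add: mult.left_commute[of _ "M / 2"] mult.left_commute[of _ "M"])
    have "(LINT x|lborel. x\<^sup>2 * f x) \<le> (LINT x|lborel. x\<^sup>2 * ((M / 2) * exp (0 * x) * indicator {-1..1} x))"
      by (rule logconcave_compare_exponential[OF f fm fC supp, of "M / 2" _ 0])
        (use MN True c mom in \<open>simp_all add: M_def[symmetric] N_def[symmetric]\<close>)
    then have "(LINT x|lborel. x\<^sup>2 * f x) * M \<le> M / 3 * M"
      unfolding mom using MN by (intro mult_right_mono) auto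
    then show ?thesis using True by (simp add: M_def[symmetric] N_def[symmetric] power2_eq_square)
  next
    case False
    then obtain k where k: "0 < k" "(exp k + exp (- k)) / (exp k - exp (- k)) - 1 / k = N / M"
      using ex_exponential_with_mean[of "N / M"] MN by auto
    define S T where "S = exp k - exp (- k)" and "T = exp k + exp (- k)"
    have S: "0 < S" using k by (simp add: S_def)
    define C where "C = M * k / S"
    have C: "0 < C" using MN k S by (simp add: C_def)
    note mom = exponential_moments[OF k(1), folded S_def T_def]
    define g where "g x = C * exp (k * x) * indicator {-1..1} x" for x
    have g0: "(LINT x|lborel. g x) = C * (S / k)"
      unfolding g_def mom(1)[symmetric] by (simp add: mult.assoc)
    have g1: "(LINT x|lborel. x * g x) = C * (T / k - S / k\<^sup>2)"
      unfolding g_def mom(2)[symmetric] by (subst Bochner_Integration.integral_mult_right_zero[symmetric]) (simp add: mult_ac)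
    have g2: "(LINT x|lborel. x\<^sup>2 * g x) = C * (S / k - 2 * T / k\<^sup>2 + 2 * S / k ^ 3)"
      unfolding g_def mom(3)[symmetric] by (subst Bochner_Integration.integral_mult_right_zero[symmetric]) (simp add: mult_ac)
    have NM: "T / S - 1 / k = N / M" using k by (simp add: S_def T_def)
    have MC: "M = C * (S / k)" using k S by (simp add: C_def)
    have NC: "N = C * (T / k - S / k\<^sup>2)"
    proof -
      have "N = M * (T / S - 1 / k)" using NM MN by simp
      also have "\<dots> = C * (T / k - S / k\<^sup>2)"
        unfolding MC using S k by (simp add: field_simps power2_eq_square)
      finally show ?thesis .
    qed
    have le: "(LINT x|lborel. x\<^sup>2 * f x) \<le> (LINT x|lborel. x\<^sup>2 * g x)"
      by (rule logconcave_compare_exponential[OF f fm fC supp C g_def])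
        (simp_all add: g0 g1 MC NC flip: M_def N_def)
    have TS: "T\<^sup>2 = S\<^sup>2 + 4"
      by (simp add: S_def T_def power2_eq_square algebra_simps flip: exp_add)
    have bound: "(S / k - 2 * T / k\<^sup>2 + 2 * S / k ^ 3) * (S / k) - (T / k - S / k\<^sup>2)\<^sup>2 \<le> (S / k)\<^sup>2 / 3"
    proof -
      have "(S / k - 2 * T / k\<^sup>2 + 2 * S / k ^ 3) * (S / k) - (T / k - S / k\<^sup>2)\<^sup>2
        = (S\<^sup>2 - T\<^sup>2) / k\<^sup>2 + S\<^sup>2 / k ^ 4"
        using k(1) by (simp add: field_simps power2_eq_square power3_eq_cube power4_eq_xxxx)
      also have "\<dots> = S\<^sup>2 / k ^ 4 - 4 / k\<^sup>2" unfolding TS by simp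
      also have "\<dots> \<le> (S / k)\<^sup>2 / 3"
      proof -
        have "S\<^sup>2 / k ^ 4 - 4 / k\<^sup>2 - (S / k)\<^sup>2 / 3 = ((3 - k\<^sup>2) * S\<^sup>2 - 12 * k\<^sup>2) / (3 * k ^ 4)"
          using k(1) by (simp add: field_simps power2_eq_square power4_eq_xxxx)
        also have "\<dots> \<le> 0"
          using sinh_square_bound[of k] k(1) unfolding S_def[symmetric]
          by (intro divide_nonpos_nonneg) auto
        finally show ?thesis by simp
      qed
      finally show ?thesis .
    qed
    have "(LINT x|lborel. x\<^sup>2 * f x) * M - N\<^sup>2 \<le> (LINT x|lborel. x\<^sup>2 * g x) * M - N\<^sup>2"
      using le MN by (simp add: mult_right_mono)
    also have "\<dots> = C\<^sup>2 * ((S / k - 2 * T / k\<^sup>2 + 2 * S / k ^ 3) * (S / k) - (T / k - S / k\<^sup>2)\<^sup>2)"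
      unfolding g2 MC NC by (simp add: algebra_simps power2_eq_square)
    also have "\<dots> \<le> C\<^sup>2 * ((S / k)\<^sup>2 / 3)"
      using bound by (intro mult_left_mono) auto
    also have "\<dots> = M\<^sup>2 / 3" unfolding MC power_mult_distrib by (rule times_divide_eq_right)
    finally show ?thesis by (simp add: M_def N_def)
  qed
qed

lemma logconcave_affine:
  fixes f :: "real \<Rightarrow> real"
  assumes "logconcave f"
  shows "logconcave (\<lambda>x. f (c + h * x))"
  unfolding logconcave_def
proof (intro conjI allI impI)
  fix x y t :: real assume t: "0 < t \<and> t < 1"
  have eq: "(1 - t) *\<^sub>R (c + h * x) + t *\<^sub>R (c + h * y) = c + h * ((1 - t) *\<^sub>R x + t *\<^sub>R y)"
    unfolding real_scaleR_def by (simp add: algebra_simps)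
  show "f (c + h * x) powr (1 - t) * f (c + h * y) powr t \<le> f (c + h * ((1 - t) *\<^sub>R x + t *\<^sub>R y))"
    using logconcaveD[OF assms, of t "c + h * x" "c + h * y"] t unfolding eq by blast
qed (simp add: logconcave_nonneg assms)

text \<open>The case of mean zero on an arbitrary interval, by rescaling it to \<open>[-1, 1]\<close>. The uniform density shows where the
constant 12 comes from.\<close>

lemma logconcave_second_moment:
  fixes f :: "real \<Rightarrow> real"
  assumes f: "logconcave f" and fm: "f \<in> borel_measurable borel" and fC: "\<And>x. f x \<le> B"
    and supp: "\<And>x. f x \<noteq> 0 \<Longrightarrow> a \<le> x \<and> x \<le> b" and ab: "a < b"
    and mean: "(LINT x|lborel. x * f x) = 0"
  shows "(LINT x|lborel. x\<^sup>2 * f x) \<le> (b - a)\<^sup>2 / 12 * (LINT x|lborel. f x)"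
proof -
  note [measurable] = fm
  note f0 = logconcave_nonneg[OF f]
  have int: "integrable lborel (\<lambda>x. q x * f x)" if "continuous_on UNIV q" for q :: "real \<Rightarrow> real"
  proof -
    have "bounded (q ` {a..b})"
      using that by (intro compact_imp_bounded compact_continuous_image) (auto intro: continuous_on_subset)
    then obtain D where "\<forall>x\<in>{a..b}. \<bar>q x\<bar> \<le> D" by (auto simp: bounded_iff)
    then have D: "\<And>x. a \<le> x \<Longrightarrow> x \<le> b \<Longrightarrow> \<bar>q x\<bar> \<le> D" by auto
    have [measurable]: "q \<in> borel_measurable borel" using that by (rule borel_measurable_continuous_onI)
    show ?thesis
    proof (rule integrable_bounded_support[where C = "\<bar>D\<bar> * B"])
      have "{x. q x * f x \<noteq> 0} \<subseteq> {a..b}" using supp by auto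
      then show "bounded {x. q x * f x \<noteq> 0}" using bounded_closed_interval bounded_subset by blast
      show "\<bar>q x * f x\<bar> \<le> \<bar>D\<bar> * B" for x
      proof (cases "f x = 0")
        case True
        then show ?thesis using fC[of x] by simp
      next
        case False
        then have "\<bar>q x\<bar> \<le> \<bar>D\<bar>" using supp[OF False] D[of x] by auto
        then have "\<bar>q x\<bar> * f x \<le> \<bar>D\<bar> * B" using fC[of x] f0[of x] by (intro mult_mono) auto
        then show ?thesis using f0[of x] by (simp add: abs_mult)
      qed
    qed measurable
  qed
  define M where "M = (LINT x|lborel. f x)"
  have M0: "0 \<le> M" by (simp add: M_def f0)
  have intf: "integrable lborel f" using int[of "\<lambda>_. 1"] by simp
  have intxf: "integrable lborel (\<lambda>x. x * f x)" using int[of "\<lambda>x. x"] by simp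
  have intx2f: "integrable lborel (\<lambda>x. x\<^sup>2 * f x)" by (rule int) (auto intro!: continuous_intros)
  show ?thesis
  proof (cases "M = 0")
    case True
    then have "AE x in lborel. f x = 0"
      using integral_nonneg_eq_0_iff_AE[OF intf] f0 by (simp add: M_def)
    then have "(LINT x|lborel. x\<^sup>2 * f x) = (LINT x|(lborel::real measure). 0)"
      by (intro integral_cong_AE) auto
    then show ?thesis using True by (simp add: M_def)
  next
    case False
    then have M: "0 < M" using M0 by simp
    define c h where "c = (a + b) / 2" and "h = (b - a) / 2"
    have h: "0 < h" using ab by (simp add: h_def)
    have scale: "(LINT x|lborel. q x * f x) = h * (LINT x|lborel. q (c + h * x) * f (c + h * x))" for q
      using lborel_integral_real_affine[of h "\<lambda>x. q x * f x" c] h by simp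
    have a0: "a < 0" and b0: "0 < b"
    proof -
      have nz: "\<not> (AE x in lborel. f x = 0)"
      proof
        assume "AE x in lborel. f x = 0"
        then have "M = (LINT x|(lborel::real measure). 0)"
          unfolding M_def by (intro integral_cong_AE) auto
        then show False using M by simp
      qed
      have ne: "AE x in lborel. x \<noteq> (0::real)" by (rule AE_lborel_singleton)
      show "a < 0"
      proof (rule ccontr)
        assume "\<not> a < 0"
        then have "0 \<le> x * f x" for x
          using supp[of x] f0[of x] by (cases "f x = 0") auto
        then have "AE x in lborel. x * f x = 0"
          using integral_nonneg_eq_0_iff_AE[OF intxf] mean by auto
        then have "AE x in lborel. f x = 0" using ne by eventually_elim auto
        then show False using nz by simp
      qed
      show "0 < b"
      proof (rule ccontr)
        assume "\<not> 0 < b"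
        then have "0 \<le> - (x * f x)" for x
          using supp[of x] f0[of x] by (cases "f x = 0") (auto simp: mult_le_0_iff)
        moreover have "(LINT x|lborel. - (x * f x)) = 0" using mean by simp
        ultimately have "AE x in lborel. - (x * f x) = 0"
          using integral_nonneg_eq_0_iff_AE[of lborel "\<lambda>x. - (x * f x)"] intxf by auto
        then have "AE x in lborel. f x = 0" using ne by eventually_elim auto
        then show False using nz by simp
      qed
    qed
    \<comment> \<open>The rescaling reverses the orientation when the mean would otherwise become negative.\<close>
  have "\<exists>e::real. (e = 1 \<or> e = -1) \<and> e * c \<le> 0"
      by (cases "c \<le> 0") (auto intro: exI[of _ 1] exI[of _ "-1"])
    then obtain e :: real where e: "e = 1 \<or> e = -1" "e * c \<le> 0" by blast
    define F where "F x = f (c + (e * h) * x)" for x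
    have eh: "\<bar>e * h\<bar> = h" "e * h \<noteq> 0" using e h by auto
    have sc: "(LINT x|lborel. q x * f x) = h * (LINT x|lborel. q (c + e * h * x) * F x)" for q
      using lborel_integral_real_affine[of "e * h" "\<lambda>x. q x * f x" c] eh by (simp add: F_def)
    have Fl: "logconcave F" unfolding F_def[abs_def] by (rule logconcave_affine[OF f])
    have [measurable]: "F \<in> borel_measurable borel" unfolding F_def[abs_def] by measurable
    have Fs: "-1 \<le> x \<and> x \<le> 1" if "F x \<noteq> 0" for x
    proof -
      have "a \<le> c + e * h * x" "c + e * h * x \<le> b" using supp that by (auto simp: F_def)
      then have "\<bar>e * h * x\<bar> \<le> h" by (simp add: c_def h_def abs_le_iff field_simps)
      then have "h * \<bar>x\<bar> \<le> h" unfolding abs_mult[of "e * h"] eh(1) .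
      then show ?thesis using h by (simp add: abs_le_iff)
    qed
    have FI: "integrable lborel (\<lambda>x. x ^ n * F x)" for n
    proof -
      have "integrable lborel (\<lambda>x. (((x - c) / (e * h)) ^ n) * f x)"
        using eh by (intro int continuous_intros) auto
      then have "integrable lborel (\<lambda>x. (((c + (e * h) * x - c) / (e * h)) ^ n) * f (c + (e * h) * x))"
        using eh by (subst lborel_integrable_real_affine_iff) auto
      then show ?thesis using eh by (simp add: F_def)
    qed
    define A0 A1 A2 where "A0 = (LINT x|lborel. F x)" and "A1 = (LINT x|lborel. x * F x)"
      and "A2 = (LINT x|lborel. x\<^sup>2 * F x)"
    note FI012 = FI[of 0] FI[of 1] FI[of 2]
    have ee: "e * e = 1" using e by auto
    have E0: "M = h * A0" using sc[of "\<lambda>_. 1"] by (simp add: M_def A0_def)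
    have E1: "0 = h * (c * A0 + e * h * A1)"
    proof -
      have "0 = h * (LINT x|lborel. (c + e * h * x) * F x)" using sc[of "\<lambda>x. x"] mean by simp
      also have "(LINT x|lborel. (c + e * h * x) * F x) = (LINT x|lborel. c * F x + e * h * (x * F x))"
        by (simp add: algebra_simps)
      finally show ?thesis using FI012 by (simp add: A0_def A1_def)
    qed
    have E2: "(LINT x|lborel. x\<^sup>2 * f x) = h * (c\<^sup>2 * A0 + 2 * c * e * h * A1 + h\<^sup>2 * A2)"
    proof -
      have "(LINT x|lborel. x\<^sup>2 * f x) = h * (LINT x|lborel. (c + e * h * x)\<^sup>2 * F x)" by (rule sc)
      also have "(LINT x|lborel. (c + e * h * x)\<^sup>2 * F x)
        = (LINT x|lborel. c\<^sup>2 * F x + 2 * c * e * h * (x * F x) + (e * e) * h\<^sup>2 * (x\<^sup>2 * F x))"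
        by (simp add: algebra_simps power2_eq_square)
      finally show ?thesis using FI012 unfolding ee by (simp add: A0_def A1_def A2_def)
    qed
    have A0: "0 < A0" using M h unfolding E0 by (simp add: zero_less_mult_iff)
    have hA1: "h * A1 = - (e * c) * A0"
    proof -
      have "c * A0 + e * h * A1 = 0" using E1 h by simp
      then have "e * (c * A0 + e * h * A1) = 0" by simp
      then have "e * c * A0 + (e * e) * h * A1 = 0" by (simp add: algebra_simps)
      then show ?thesis unfolding ee by simp
    qed
    have "\<bar>e * c\<bar> < h" using e a0 b0 by (auto simp: c_def h_def abs_less_iff field_simps)
    then have "h * A1 < h * A0" unfolding hA1 using A0 by (intro mult_strict_right_mono) auto
    then have A10: "A1 < A0" using h by simp
    have "0 \<le> h * A1" unfolding hA1 using e A0 by (intro mult_nonneg_nonneg) auto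
    then have A1: "0 \<le> A1" using h by (simp add: zero_le_mult_iff)
    have "A2 * A0 - A1\<^sup>2 \<le> A0\<^sup>2 / 3"
      unfolding A0_def A1_def A2_def
      by (rule logconcave_variance_symmetric_interval[OF Fl _ _ Fs, of B])
        (use A0 A1 A10 fC in \<open>auto simp: A0_def A1_def F_def\<close>)
    then have "h\<^sup>2 * (A2 * A0 - A1\<^sup>2) \<le> h\<^sup>2 * (A0\<^sup>2 / 3)" by (intro mult_left_mono) auto
    moreover have "(c\<^sup>2 * A0 + 2 * c * e * h * A1 + h\<^sup>2 * A2) * A0 = h\<^sup>2 * (A2 * A0 - A1\<^sup>2)"
    proof -
      have "(c\<^sup>2 * A0 + 2 * c * e * h * A1 + h\<^sup>2 * A2) * A0
        = c\<^sup>2 * A0\<^sup>2 + 2 * c * e * (h * A1) * A0 + h\<^sup>2 * A2 * A0"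
        by (simp add: algebra_simps power2_eq_square)
      also have "\<dots> = (c * A0)\<^sup>2 - 2 * (e * e) * (c * A0)\<^sup>2 + h\<^sup>2 * A2 * A0"
        unfolding hA1 by (simp add: algebra_simps power2_eq_square)
      also have "\<dots> = h\<^sup>2 * A2 * A0 - (e * e) * (c * A0)\<^sup>2" unfolding ee by simp
      also have "\<dots> = h\<^sup>2 * A2 * A0 - (h * A1)\<^sup>2"
        unfolding hA1 by (simp add: power2_eq_square)
      finally show ?thesis by (simp add: algebra_simps power2_eq_square)
    qed
    ultimately have "(c\<^sup>2 * A0 + 2 * c * e * h * A1 + h\<^sup>2 * A2) * A0 \<le> (h\<^sup>2 / 3 * A0) * A0"
      by (simp add: power2_eq_square)
    then have "c\<^sup>2 * A0 + 2 * c * e * h * A1 + h\<^sup>2 * A2 \<le> h\<^sup>2 / 3 * A0"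
      using A0 by (simp only: mult_le_cancel_right)
    then have "(LINT x|lborel. x\<^sup>2 * f x) \<le> h * (h\<^sup>2 / 3 * A0)"
      unfolding E2 using h by (intro mult_left_mono) auto
    also have "\<dots> = (b - a)\<^sup>2 / 12 * M" unfolding E0 h_def by (simp add: power_divide)
    finally show ?thesis by (simp add: M_def)
  qed
qed

lemma nn_integral_eq_imp_LINT_eq:
  fixes f :: "'a \<Rightarrow> real" and g :: "'b \<Rightarrow> real"
  assumes f: "f \<in> borel_measurable M" and g: "integrable N g"
    and "(\<integral>\<^sup>+x. ennreal (f x) \<partial>M) = (\<integral>\<^sup>+x. ennreal (g x) \<partial>N)"
    and "(\<integral>\<^sup>+x. ennreal (- f x) \<partial>M) = (\<integral>\<^sup>+x. ennreal (- g x) \<partial>N)"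
  shows "integrable M f \<and> (LINT x|M. f x) = (LINT x|N. g x)"
proof -
  have "integrable M f"
    using assms real_integrable_def[of N g] real_integrable_def[of M f] by simp
  then show ?thesis using assms by (simp add: real_lebesgue_integral_def)
qed

text \<open>The variance of a linear functional under the uniform distribution on a convex body is largest, for a given range of the functional,
when its values are uniformly distributed.\<close>

lemma convex_second_moment_le:
  fixes K :: "'a::euclidean_space set"
  assumes K: "compact K" "convex K" and u: "norm u = 1"
    and ab: "\<And>x. x \<in> K \<Longrightarrow> a \<le> u \<bullet> x \<and> u \<bullet> x \<le> b" "a < b"
    and mean: "(LINT x:K|lborel. u \<bullet> x) = 0"
  shows "(LINT x:K|lborel. (u \<bullet> x)\<^sup>2) \<le> (b - a)\<^sup>2 / 12 * measure lborel K"
proof -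
  have Kb[measurable]: "K \<in> sets borel" using K by (simp add: borel_compact)
  obtain f where f: "logconcave f" and fm[measurable]: "f \<in> borel_measurable borel"
    and "\<exists>B. \<forall>r. f r \<le> B"
    and supp: "\<And>r. f r \<noteq> 0 \<Longrightarrow> a \<le> r \<and> r \<le> b"
    and int: "\<And>\<phi>. \<phi> \<in> borel_measurable borel \<Longrightarrow>
       (\<integral>\<^sup>+x. \<phi> (u \<bullet> x) * indicator K x \<partial>lborel) = (\<integral>\<^sup>+r. \<phi> r * ennreal (f r) \<partial>lborel)"
    by (rule marginal_density[OF K u ab(1)]) (assumption | rule that)+
  then obtain B where B: "\<And>r. f r \<le> B" by blast
  note f0 = logconcave_nonneg[OF f]
  have eq: "(LINT r|lborel. q r * f r) = (LINT x:K|lborel. q (u \<bullet> x))"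
    if q: "continuous_on UNIV q" for q :: "real \<Rightarrow> real"
  proof -
    have [measurable]: "q \<in> borel_measurable borel" using q by (rule borel_measurable_continuous_onI)
    have "integrable lborel (\<lambda>x. indicator K x *\<^sub>R q (u \<bullet> x))"
      using K(1) q by (intro borel_integrable_compact continuous_on_compose2[OF q] continuous_intros) auto
    moreover have "(\<integral>\<^sup>+r. ennreal (s * (q r * f r)) \<partial>lborel) = (\<integral>\<^sup>+x. ennreal (s * (indicator K x *\<^sub>R q (u \<bullet> x))) \<partial>lborel)"
      for s :: real
    proof -
      have "(\<integral>\<^sup>+r. ennreal (s * (q r * f r)) \<partial>lborel) = (\<integral>\<^sup>+r. ennreal (s * q r) * ennreal (f r) \<partial>lborel)"
        using f0 by (intro nn_integral_cong) (simp add: ennreal_mult'' mult.assoc[symmetric])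
      also have "\<dots> = (\<integral>\<^sup>+x. ennreal (s * q (u \<bullet> x)) * indicator K x \<partial>lborel)"
        by (rule int[symmetric]) measurable
      also have "\<dots> = (\<integral>\<^sup>+x. ennreal (s * (indicator K x *\<^sub>R q (u \<bullet> x))) \<partial>lborel)"
        by (intro nn_integral_cong) (auto simp: indicator_def)
      finally show ?thesis .
    qed
    from this[of 1] this[of "-1"]
    have "(\<integral>\<^sup>+r. ennreal (q r * f r) \<partial>lborel) = (\<integral>\<^sup>+x. ennreal (indicator K x *\<^sub>R q (u \<bullet> x)) \<partial>lborel)"
      "(\<integral>\<^sup>+r. ennreal (- (q r * f r)) \<partial>lborel) = (\<integral>\<^sup>+x. ennreal (- (indicator K x *\<^sub>R q (u \<bullet> x))) \<partial>lborel)"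
      by simp_all
    ultimately show ?thesis
      unfolding set_lebesgue_integral_def
      using nn_integral_eq_imp_LINT_eq[of "\<lambda>r. q r * f r" lborel lborel "\<lambda>x. indicator K x *\<^sub>R q (u \<bullet> x)"] by simp
  qed
  have "(LINT r|lborel. r\<^sup>2 * f r) \<le> (b - a)\<^sup>2 / 12 * (LINT r|lborel. f r)"
  proof (rule logconcave_second_moment[OF f fm B _ ab(2)])
    show "(LINT r|lborel. r * f r) = 0"
      using eq[OF continuous_on_id] mean by simp
  qed (use supp in auto)
  then show ?thesis
    using eq[of "\<lambda>r. r\<^sup>2"] eq[of "\<lambda>_. 1"] by (simp add: continuous_intros set_lebesgue_integral_def)
qed

section \<open>Hyperbolic width and cross-ratios\<close>

lemma support_hyperplane_cball:
  fixes l :: "'a::euclidean_space set"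
  assumes "support_hyperplane (cball 0 1) l"
  obtains p where "norm p = 1" "l = {x. p \<bullet> x = 1}"
proof -
  obtain a b where a: "a \<noteq> 0" and l: "l = {x. a \<bullet> x = b}" and le: "cball 0 1 \<subseteq> {x. a \<bullet> x \<le> b}"
    and ne: "cball 0 1 \<inter> l \<noteq> {}"
    using assms by (auto simp: support_hyperplane_def)
  have "a /\<^sub>R norm a \<in> cball 0 1" using a by simp
  then have "a \<bullet> (a /\<^sub>R norm a) \<le> b" using le by blast
  moreover have "a \<bullet> (a /\<^sub>R norm a) = norm a" using a by (simp add: dot_square_norm power2_eq_square)
  ultimately have 1: "norm a \<le> b" by simp
  from ne l obtain y where "y \<in> cball 0 1" "a \<bullet> y = b" by blast
  then have "norm y \<le> 1" "a \<bullet> y = b" by simp_all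
  then have "b \<le> norm a"
    using norm_cauchy_schwarz[of a y] mult_left_mono[of "norm y" 1 "norm a"] by simp
  with 1 have b: "b = norm a" by simp
  show thesis
  proof (rule that[of "a /\<^sub>R norm a"])
    show "l = {x. (a /\<^sub>R norm a) \<bullet> x = 1}"
      unfolding l b using a by (auto simp: field_simps)
  qed (use a in simp)
qed

text \<open>The pencil of hyperplanes spanned by the tangent hyperplanes of the unit sphere at \<open>p\<close> (where \<open>t = 0\<close>) and
\<open>q\<close> (where \<open>t = 1\<close>). The plane with parameter \<open>t\<close> meets the line through \<open>p\<close> and \<open>q\<close> at \<open>p + t (q - p)\<close>.\<close>

definition pencil_plane :: "'a::euclidean_space \<Rightarrow> 'a \<Rightarrow> real \<Rightarrow> 'a set" where
  "pencil_plane p q t = {x. 1 - p \<bullet> x = t * (2 - (p + q) \<bullet> x)}"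

lemma inner_unit_less_one:
  assumes "norm p = 1" "norm q = 1" "p \<noteq> q"
  shows "p \<bullet> q < 1"
proof -
  have "0 < (norm (p - q))\<^sup>2" using assms by simp
  also have "(norm (p - q))\<^sup>2 = 2 - 2 * (p \<bullet> q)"
    using assms by (simp add: power2_norm_eq_inner inner_diff inner_commute norm_eq_1)
  finally show ?thesis by simp
qed

lemma inner_le_one_cball:
  assumes "norm p = 1" "norm x \<le> 1"
  shows "p \<bullet> x \<le> 1"
  using norm_cauchy_schwarz[of p x] assms by simp

lemma inner_eq_one_cball:
  assumes "norm p = 1" "norm x \<le> 1" "p \<bullet> x = 1"
  shows "x = p"
proof -
  have "(norm x)\<^sup>2 \<le> 1" using assms(2) by (simp add: power_le_one)
  then have "(norm (x - p))\<^sup>2 \<le> 0"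
    using assms by (simp add: power2_norm_eq_inner inner_diff inner_commute norm_eq_1)
  then show ?thesis by simp
qed

locale tangent_pencil =
  fixes p q :: "'a::euclidean_space"
  assumes p: "norm p = 1" and q: "norm q = 1" and pq: "p \<noteq> q" "p \<noteq> - q"
begin

lemma pp: "p \<bullet> p = 1" and qq: "q \<bullet> q = 1"
  using p q by (simp_all add: norm_eq_1)

lemma ineq: "p \<bullet> q < 1" "- 1 < p \<bullet> q"
  using inner_unit_less_one[OF p q pq(1)] inner_unit_less_one[of p "- q"] p q pq by auto

definition pencil_axis where "pencil_axis = {x. p \<bullet> x = 1} \<inter> {x. q \<bullet> x = 1}"

text \<open>The parameter of the plane of the pencil through \<open>x\<close>. It stays finite at the points of tangency,
unlike the ratio \<open>(1 - p \<bullet> x) / (1 - q \<bullet> x)\<close>.\<close>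

definition param :: "'a \<Rightarrow> real" where
  "param x = (1 - p \<bullet> x) / (2 - (p + q) \<bullet> x)"

lemma denominator_pos:
  assumes "norm x \<le> 1" shows "0 < 2 - (p + q) \<bullet> x"
proof -
  have "p \<bullet> x \<le> 1" "q \<bullet> x \<le> 1" using inner_le_one_cball assms p q by auto
  moreover have "\<not> (p \<bullet> x = 1 \<and> q \<bullet> x = 1)"
    using inner_eq_one_cball[OF p assms] inner_eq_one_cball[OF q assms] pq by auto
  ultimately show ?thesis by (auto simp: inner_add_left)
qed

lemma param_bounds:
  assumes "norm x \<le> 1" shows "0 \<le> param x" "param x \<le> 1"
  using denominator_pos[OF assms] inner_le_one_cball[OF p assms] inner_le_one_cball[OF q assms]
  by (auto simp: param_def divide_le_eq_1 inner_add_left)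

lemma pencil_plane_normal:
  "pencil_plane p q t = {x. (t *\<^sub>R (p + q) - p) \<bullet> x = 2 * t - 1}"
  by (auto simp: pencil_plane_def inner_diff_left inner_add_left algebra_simps)

lemma normal_nonzero: "t *\<^sub>R (p + q) - p \<noteq> 0"
proof
  assume *: "t *\<^sub>R (p + q) - p = 0"
  then have "(t *\<^sub>R (p + q) - p) \<bullet> p = 0" "(t *\<^sub>R (p + q) - p) \<bullet> q = 0" by simp_all
  then have 1: "t * (1 + p \<bullet> q) = 1" "t * (1 + p \<bullet> q) = p \<bullet> q"
    by (simp_all add: inner_diff_left inner_add_left pp qq inner_commute[of q p] algebra_simps)
  then show False using ineq by simp
qed

lemma in_plane_iff_param: "norm x \<le> 1 \<Longrightarrow> x \<in> pencil_plane p q t \<longleftrightarrow> param x = t"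
  using denominator_pos[of x] by (auto simp: pencil_plane_def param_def field_simps)

lemma transversal: "p + s *\<^sub>R (q - p) \<in> pencil_plane p q t \<longleftrightarrow> s = t"
proof -
  have 1: "1 - p \<bullet> (p + s *\<^sub>R (q - p)) = s * (1 - p \<bullet> q)"
    by (simp add: inner_add_right inner_diff_right pp algebra_simps)
  have 2: "2 - (p + q) \<bullet> (p + s *\<^sub>R (q - p)) = 1 - p \<bullet> q"
    by (simp add: inner_add inner_diff_right pp qq inner_commute[of q p] algebra_simps)
  show ?thesis unfolding pencil_plane_def mem_Collect_eq 1 2 using ineq by simp
qed

lemma pencil_axis_subset: "pencil_axis \<subseteq> pencil_plane p q t"
  by (auto simp: pencil_axis_def pencil_plane_def inner_add_left)

lemma plane_0: "pencil_plane p q 0 = {x. p \<bullet> x = 1}"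
  and plane_1: "pencil_plane p q 1 = {x. q \<bullet> x = 1}"
  by (auto simp: pencil_plane_def inner_add_left)

lemma pencil_axis_avoids_ball: "pencil_axis \<inter> cball 0 1 = {}"
proof -
  have False if "p \<bullet> x = 1" "q \<bullet> x = 1" "norm x \<le> 1" for x
    using inner_eq_one_cball[OF p that(3,1)] inner_eq_one_cball[OF q that(3,2)] pq by simp
  then show ?thesis by (auto simp: pencil_axis_def)
qed

lemma affine_pencil_axis: "affine pencil_axis"
  unfolding pencil_axis_def by (intro affine_Int affine_hyperplane)

lemma aff_dim_pencil_axis: "aff_dim pencil_axis = int DIM('a) - 2"
proof -
  have "(1 / (1 + p \<bullet> q)) *\<^sub>R (p + q) \<in> pencil_axis"
    using ineq by (simp add: pencil_axis_def inner_add_right pp qq inner_commute[of q p])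
  then have ne: "{x. p \<bullet> x = 1} \<inter> {x. q \<bullet> x = 1} \<noteq> {}" unfolding pencil_axis_def by blast
  have "p \<in> {x. p \<bullet> x = 1} - {x. q \<bullet> x = 1}" using ineq by (simp add: pp inner_commute[of q p])
  then have ns: "\<not> {x. p \<bullet> x = 1} \<subseteq> {x. q \<bullet> x = 1}" by auto
  have "p \<noteq> 0" using p by auto
  then show ?thesis
    unfolding pencil_axis_def
    using aff_dim_affine_Int_hyperplane[OF affine_hyperplane, of p 1 q 1] ne ns
    by (simp add: aff_dim_hyperplane)
qed

lemma support_tangent: "support_hyperplane (cball 0 1) (pencil_plane p q 0)"
  "support_hyperplane (cball 0 1) (pencil_plane p q 1)"
proof -
  have "support_hyperplane (cball 0 1) {x. u \<bullet> x = 1}" if u: "norm u = 1" for u :: 'a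
  proof -
    have "u \<in> cball 0 1 \<inter> {x. u \<bullet> x = 1}" "u \<noteq> 0" using u by (auto simp: dot_square_norm)
    then show ?thesis
      unfolding support_hyperplane_def using inner_le_one_cball[OF u]
      by (intro exI[of _ u] exI[of _ 1]) auto
  qed
  then show "support_hyperplane (cball 0 1) (pencil_plane p q 0)"
    "support_hyperplane (cball 0 1) (pencil_plane p q 1)"
    unfolding plane_0 plane_1 using p q by auto
qed

text \<open>The planes of the pencil that support \<open>K\<close> are those with the extreme parameters.\<close>

lemma support_extremal:
  assumes K: "K \<subseteq> cball 0 1" and x1: "x1 \<in> K"
    and ext: "(\<forall>x\<in>K. param x \<le> param x1) \<or> (\<forall>x\<in>K. param x1 \<le> param x)"
  shows "support_hyperplane K (pencil_plane p q (param x1))"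
proof -
  have mem: "x1 \<in> K \<inter> pencil_plane p q (param x1)"
    using x1 K in_plane_iff_param[of x1 "param x1"] by auto
  define a where "a = param x1 *\<^sub>R (p + q) - p"
  have diff: "a \<bullet> x - (2 * param x1 - 1) = (param x - param x1) * (2 - (p + q) \<bullet> x)" if "x \<in> K" for x
  proof -
    have "param x * (2 - (p + q) \<bullet> x) = 1 - p \<bullet> x"
      using denominator_pos[of x] that K by (auto simp: param_def)
    then show ?thesis by (simp add: a_def inner_diff_left algebra_simps)
  qed
  have den: "0 < 2 - (p + q) \<bullet> x" if "x \<in> K" for x
    using denominator_pos[of x] that K by auto
  from ext show ?thesis
  proof
    assume "\<forall>x\<in>K. param x \<le> param x1"
    then have "a \<bullet> x \<le> 2 * param x1 - 1" if "x \<in> K" for x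
      using diff[OF that] den[OF that] that mult_nonpos_nonneg[of "param x - param x1" "2 - (p + q) \<bullet> x"] by auto
    then show ?thesis
      unfolding support_hyperplane_def using mem normal_nonzero[of "param x1"]
      by (intro exI[of _ a] exI[of _ "2 * param x1 - 1"]) (auto simp: pencil_plane_normal a_def)
  next
    assume "\<forall>x\<in>K. param x1 \<le> param x"
    then have "0 \<le> (param x - param x1) * (2 - (p + q) \<bullet> x)" if "x \<in> K" for x
      using den[OF that] that by (intro mult_nonneg_nonneg) auto
    then have "(- a) \<bullet> x \<le> - (2 * param x1 - 1)" if "x \<in> K" for x
      using diff[OF that] that by fastforce
    moreover have "pencil_plane p q (param x1) = {x. (- a) \<bullet> x = - (2 * param x1 - 1)}"
      unfolding pencil_plane_normal a_def[symmetric] by auto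
    moreover have "- a \<noteq> 0" using normal_nonzero[of "param x1"] by (simp add: a_def)
    ultimately show ?thesis
      unfolding support_hyperplane_def using mem
      by (intro exI[of _ "- a"] exI[of _ "- (2 * param x1 - 1)"]) auto
  qed
qed

text \<open>The line through \<open>p\<close> and \<open>q\<close> is the transversal on which the cross-ratio is read off. Strictness comes
from the interior of \<open>K\<close>, which no single plane of the pencil contains.\<close>

lemma hyperbolic_width_ge:
  assumes K: "convex_body K" "K \<subseteq> cball 0 1"
    and x1: "x1 \<in> K" "\<And>x. x \<in> K \<Longrightarrow> param x \<le> param x1"
    and x2: "x2 \<in> K" "\<And>x. x \<in> K \<Longrightarrow> param x2 \<le> param x"
  shows "param x2 < param x1"
    and "ereal (1/2) * ln_ereal \<bar>cr (param x1) (param x2) 0 1\<bar> \<le> hyperbolic_width K"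
proof -
  show lt: "param x2 < param x1"
  proof (rule ccontr)
    assume "\<not> ?thesis"
    then have "param x = param x1" if "x \<in> K" for x using x1(2)[OF that] x2(2)[OF that] by simp
    then have "K \<subseteq> {x. (param x1 *\<^sub>R (p + q) - p) \<bullet> x = 2 * param x1 - 1}"
      unfolding pencil_plane_normal[symmetric] using K(2) in_plane_iff_param by auto
    then have "interior K \<subseteq> interior {x. (param x1 *\<^sub>R (p + q) - p) \<bullet> x = 2 * param x1 - 1}"
      by (rule interior_mono)
    also have "\<dots> = {}" by (rule interior_hyperplane[OF normal_nonzero])
    finally show False using K(1) by (simp add: convex_body_def)
  qed
  define s t where "s = param x1" and "t = param x2"
  have st: "0 \<le> t" "t < s" "s \<le> 1"
    using lt param_bounds(1)[of x2] param_bounds(2)[of x1] x1 x2 K by (auto simp: s_def t_def)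
  have distinct: "pencil_plane p q a \<noteq> pencil_plane p q b" if "a \<noteq> b" for a b
    using transversal[of a a] transversal[of a b] that by auto
  have "hyperplanes_cr pencil_axis (pencil_plane p q s) (pencil_plane p q t) (pencil_plane p q 0) (pencil_plane p q 1)
      (cr s t 0 1)"
    unfolding hyperplanes_cr_def
  proof (intro exI conjI allI)
    show "p + a *\<^sub>R (q - p) \<notin> pencil_axis" for a
      using pencil_axis_subset transversal[of a 0] transversal[of a 1] by (metis subsetD zero_neq_one)
  qed (rule transversal refl)+
  moreover have "1 \<le> \<bar>cr s t 0 1\<bar>"
  proof (cases "(s - 1) * t = 0")
    case True
    have "s * (t - 1) < 0" using st by (intro mult_pos_neg) auto
    moreover have "s \<noteq> 0" "t \<noteq> 1" using st by auto
    ultimately show ?thesis using True by (simp add: cr_def divide_ereal_def)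
  next
    case False
    then have "0 < (1 - s) * t" using st by auto
    moreover have "(1 - s) * t \<le> s * (1 - t)" using st by (simp add: algebra_simps)
    moreover have "s * (t - 1) / ((s - 1) * t) = s * (1 - t) / ((1 - s) * t)"
    proof -
      have "s * (t - 1) = - (s * (1 - t))" "(s - 1) * t = - ((1 - s) * t)" by (simp_all add: algebra_simps)
      then show ?thesis by simp
    qed
    ultimately show ?thesis using False st by (simp add: cr_def)
  qed
  moreover have "support_hyperplane K (pencil_plane p q s)" "support_hyperplane K (pencil_plane p q t)"
    using support_extremal[OF K(2) x1(1)] support_extremal[OF K(2) x2(1)] x1(2) x2(2)
    by (auto simp: s_def t_def)
  ultimately have "affine pencil_axis \<and> aff_dim pencil_axis = int DIM('a) - 2 \<and> pencil_axis \<inter> cball 0 1 = {} \<and>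
     support_hyperplane (cball 0 1) (pencil_plane p q 0) \<and>
     support_hyperplane (cball 0 1) (pencil_plane p q 1) \<and> pencil_plane p q 0 \<noteq> pencil_plane p q 1 \<and>
     support_hyperplane K (pencil_plane p q t) \<and> support_hyperplane K (pencil_plane p q s) \<and>
     pencil_plane p q t \<noteq> pencil_plane p q s \<and>
     pencil_axis \<subseteq> pencil_plane p q 0 \<and> pencil_axis \<subseteq> pencil_plane p q 1 \<and>
     pencil_axis \<subseteq> pencil_plane p q t \<and> pencil_axis \<subseteq> pencil_plane p q s \<and>
     hyperplanes_cr pencil_axis (pencil_plane p q s) (pencil_plane p q t) (pencil_plane p q 0) (pencil_plane p q 1)
       (cr s t 0 1) \<and> 1 \<le> \<bar>cr s t 0 1\<bar>"
    using st by (intro conjI affine_pencil_axis aff_dim_pencil_axis pencil_axis_avoids_ball support_tangent pencil_axis_subset distinct) auto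
  then show "ereal (1/2) * ln_ereal \<bar>cr (param x1) (param x2) 0 1\<bar> \<le> hyperbolic_width K"
    unfolding hyperbolic_width_def rel_width_def s_def[symmetric] t_def[symmetric]
    by (intro Sup_upper CollectI exI) (rule conjI[OF refl])
qed

lemma extremal_points:
  assumes "compact K" "K \<noteq> {}" "K \<subseteq> cball 0 1"
  obtains x1 x2 where "x1 \<in> K" "\<And>x. x \<in> K \<Longrightarrow> param x \<le> param x1"
    "x2 \<in> K" "\<And>x. x \<in> K \<Longrightarrow> param x2 \<le> param x"
proof -
  have "continuous_on K param"
    unfolding param_def[abs_def] using denominator_pos assms(3)
    by (intro continuous_intros) force
  then show thesis
    using continuous_attains_sup[OF assms(1,2)] continuous_attains_inf[OF assms(1,2)] that by metis
qed

end

lemma ln_ereal_infinity: "ereal (1/2) * ln_ereal \<infinity> = \<infinity>"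
  by (simp add: ln_ereal_def)

lemma ex_unit_orthogonal:
  fixes p :: "'a::euclidean_space"
  assumes "2 \<le> DIM('a)"
  obtains e where "norm e = 1" "p \<bullet> e = 0"
proof -
  obtain y where "y \<noteq> 0" "orthogonal p y" using orthogonal_to_vector_exists[OF assms] by blast
  then show thesis by (intro that[of "y /\<^sub>R norm y"]) (auto simp: orthogonal_def)
qed

text \<open>At a point of \<open>K\<close> on the sphere the tangent hyperplane supports both \<open>K\<close> and the ball, and the
cross-ratio formed with another tangent hyperplane of the ball is infinite.\<close>

lemma finite_width_imp_subset_ball:
  fixes K :: "'a::euclidean_space set"
  assumes d: "2 \<le> DIM('a)" and K: "convex_body K" "K \<subseteq> cball 0 1"
    and fin: "hyperbolic_width K < \<infinity>"
  shows "K \<subseteq> ball 0 1"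
proof (rule ccontr)
  assume "\<not> K \<subseteq> ball 0 1"
  then obtain p where pK: "p \<in> K" and p: "norm p = 1" using K(2) by force
  obtain q where q: "norm q = 1" "p \<bullet> q = 0" using ex_unit_orthogonal[OF d] by metis
  have "p \<bullet> p = 1" using p by (simp add: norm_eq_1)
  then interpret tangent_pencil p q using p q by unfold_locales auto
  have K': "compact K" "K \<noteq> {}" using K(1) pK by (auto simp: convex_body_def)
  obtain x1 x2 where x: "x1 \<in> K" "\<And>x. x \<in> K \<Longrightarrow> param x \<le> param x1"
    "x2 \<in> K" "\<And>x. x \<in> K \<Longrightarrow> param x2 \<le> param x"
    using extremal_points[OF K' K(2)] by metis
  have "param p = 0" by (simp add: param_def pp)
  then have 0: "param x2 = 0"
    using x(4)[OF pK] param_bounds(1)[of x2] x(3) K(2) by auto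
  note w = hyperbolic_width_ge[OF K x]
  have "\<bar>cr (param x1) (param x2) 0 1\<bar> = \<infinity>"
    using w(1) by (simp add: 0 cr_def divide_ereal_def)
  then show False using w(2) fin by (simp add: ln_ereal_infinity)
qed

text \<open>For a set in the open ball, the cross-ratios that define the width are bounded by \<open>C\<close>, the exponential of
twice the width. They are the quotients of \<open>(1 - p \<bullet> x) / (1 - q \<bullet> x)\<close> at two points of the set; multiplied out, the condition also
makes sense for antipodal and for equal \<open>p\<close> and \<open>q\<close>, and it is closed in \<open>p\<close> and \<open>q\<close>.\<close>

definition cr_bounded :: "real \<Rightarrow> 'a::euclidean_space set \<Rightarrow> bool" where
  "cr_bounded C K \<longleftrightarrow> (\<forall>p q x x'. norm p = 1 \<and> norm q = 1 \<and> x \<in> K \<and> x' \<in> K \<longrightarrow>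
     (1 - p \<bullet> x) * (1 - q \<bullet> x') \<le> C * ((1 - q \<bullet> x) * (1 - p \<bullet> x')))"

text \<open>For independent \<open>p\<close> and \<open>q\<close> the ratio \<open>r\<close> is an increasing function of the parameter of the pencil, so
its extreme values give the cross-ratio of \<open>hyperbolic_width_ge\<close>. For \<open>q = -p\<close> the planes of the
pencil are parallel and meet in no affine subspace; turning \<open>q\<close> slightly and passing to the limit
covers this case.\<close>

lemma width_bounds_cross_ratio:
  fixes K :: "'a::euclidean_space set"
  assumes d: "2 \<le> DIM('a)" and K: "convex_body K" "K \<subseteq> cball 0 1"
    and W: "hyperbolic_width K \<le> ereal W" "0 \<le> W"
  shows "cr_bounded (exp (2 * W)) K"
proof -
  have KB: "K \<subseteq> ball 0 1"
    by (rule finite_width_imp_subset_ball[OF d K]) (use W(1) in \<open>auto intro: le_less_trans\<close>)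
  have pos: "0 < 1 - p \<bullet> x" if "norm p = 1" "x \<in> K" for p x
    using norm_cauchy_schwarz[of p x] that KB by auto
  have gen: "(1 - p \<bullet> x) * (1 - q \<bullet> x') \<le> exp (2 * W) * ((1 - q \<bullet> x) * (1 - p \<bullet> x'))"
    if pq: "norm p = 1" "norm q = 1" "p \<noteq> q" "p \<noteq> - q" and x: "x \<in> K" "x' \<in> K" for p q x x'
  proof -
    interpret tangent_pencil p q using pq by unfold_locales
    have K': "compact K" "K \<noteq> {}" using K(1) x by (auto simp: convex_body_def)
    obtain x1 x2 where e: "x1 \<in> K" "\<And>x. x \<in> K \<Longrightarrow> param x \<le> param x1"
      "x2 \<in> K" "\<And>x. x \<in> K \<Longrightarrow> param x2 \<le> param x"
      using extremal_points[OF K' K(2)] by metis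
    define r where "r x = (1 - p \<bullet> x) / (1 - q \<bullet> x)" for x
    have rpos: "0 < r x" if "x \<in> K" for x using pos[OF p that] pos[OF q that] by (simp add: r_def)
    have param_r: "param x = r x / (1 + r x)" "0 < param x" "param x < 1" if "x \<in> K" for x
    proof -
      have *: "0 < 1 - p \<bullet> x" "0 < 1 - q \<bullet> x" using pos p q that by auto
      then have "2 - (p + q) \<bullet> x = (1 - q \<bullet> x) * (1 + r x)"
        by (simp add: r_def inner_add_left distrib_left)
      then show "param x = r x / (1 + r x)" using * by (simp add: param_def r_def)
      then show "0 < param x" "param x < 1" using rpos[OF that] by simp_all
    qed
    have mono: "r y \<le> r z" if "param y \<le> param z" "y \<in> K" "z \<in> K" for y z
      using that rpos[OF that(2)] rpos[OF that(3)] by (simp add: param_r(1) field_simps)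
    note w = hyperbolic_width_ge[OF K e]
    have "cr (param x1) (param x2) 0 1 = ereal (r x1 / r x2)"
    proof -
      have "param x1 - 1 = - (1 / (1 + r x1))" "param x2 - 1 = - (1 / (1 + r x2))"
        using rpos[OF e(1)] rpos[OF e(3)] by (simp_all add: param_r(1) e divide_simps)
      then have "param x1 * (param x2 - 1) / ((param x1 - 1) * param x2) = r x1 / r x2"
        using rpos[OF e(1)] rpos[OF e(3)] by (simp add: param_r(1) e)
      then show ?thesis
        using param_r(2,3)[OF e(1)] param_r(2,3)[OF e(3)] by (simp add: cr_def)
    qed
    then have "1 / 2 * ln (r x1 / r x2) \<le> W"
      using w(2) W(1) rpos[OF e(1)] rpos[OF e(3)] order_trans by (fastforce simp: ln_ereal_def)
    then have "ln (r x1 / r x2) \<le> 2 * W" by simp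
    then have "r x1 / r x2 \<le> exp (2 * W)"
      using rpos[OF e(1)] rpos[OF e(3)] by (metis exp_le_cancel_iff exp_ln divide_pos_pos)
    then have r12: "r x1 \<le> exp (2 * W) * r x2" using rpos[OF e(3)] by (simp add: pos_divide_le_eq)
    have "r x \<le> r x1" "r x2 \<le> r x'" using mono e x by auto
    then have "r x \<le> exp (2 * W) * r x'"
      using r12 by (meson exp_ge_zero mult_left_mono order_trans)
    then show ?thesis
      using pos[OF q x(1)] pos[OF q x(2)] by (simp add: r_def field_simps)
  qed
  show ?thesis
    unfolding cr_bounded_def
  proof (intro allI impI, elim conjE)
    fix p q x x' :: 'a assume *: "norm p = 1" "norm q = 1" "x \<in> K" "x' \<in> K"
    consider "p = q" | "p \<noteq> q" "p \<noteq> - q" | "q = - p" by fastforce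
    then show "(1 - p \<bullet> x) * (1 - q \<bullet> x') \<le> exp (2 * W) * ((1 - q \<bullet> x) * (1 - p \<bullet> x'))"
    proof cases
      case 1
      have "1 * ((1 - p \<bullet> x) * (1 - p \<bullet> x')) \<le> exp (2 * W) * ((1 - p \<bullet> x) * (1 - p \<bullet> x'))"
        using pos[of p x] pos[of p x'] * W(2) by (intro mult_right_mono) auto
      then show ?thesis using 1 by simp
    next
      case 2
      then show ?thesis using gen * by blast
    next
      case 3
      obtain e where e: "norm e = 1" "p \<bullet> e = 0" using ex_unit_orthogonal[OF d] by metis
      define \<theta> where "\<theta> n = 1 / real (Suc n)" for n
      \<comment> \<open>Unit vectors that tend to \<open>-p\<close> without being parallel to it.\<close>
  define Q where "Q n = (- cos (\<theta> n)) *\<^sub>R p + sin (\<theta> n) *\<^sub>R e" for n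
      have \<theta>: "\<theta> \<longlonglongrightarrow> 0" unfolding \<theta>_def by (rule LIMSEQ_Suc[OF lim_1_over_n])
      have "Q \<longlonglongrightarrow> (- cos 0) *\<^sub>R p + sin 0 *\<^sub>R e"
        unfolding Q_def by (intro tendsto_intros \<theta>)
      then have lim: "Q \<longlonglongrightarrow> q" using 3 by simp
      have pp: "p \<bullet> p = 1" "e \<bullet> e = 1" using * e by (simp_all add: norm_eq_1)
      have "(1 - p \<bullet> x) * (1 - Q n \<bullet> x') \<le> exp (2 * W) * ((1 - Q n \<bullet> x) * (1 - p \<bullet> x'))" for n
      proof (rule gen)
        have "Q n \<bullet> Q n = 1"
          using e(2) sin_cos_squared_add[of "\<theta> n"]
          by (simp add: Q_def inner_add inner_diff pp inner_commute[of e p] power2_eq_square)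
        then show "norm (Q n) = 1" by (simp add: norm_eq_1)
        have "0 < \<theta> n" "\<theta> n \<le> 1" by (simp_all add: \<theta>_def)
        then have "0 < sin (\<theta> n)" using pi_gt3 by (intro sin_gt_zero) auto
        moreover have "e \<bullet> Q n = sin (\<theta> n)" using e(2) by (simp add: Q_def inner_add_right inner_diff_right pp inner_commute[of e p])
        ultimately have "e \<bullet> Q n \<noteq> 0" by simp
        moreover have "e \<bullet> p = 0" using e(2) by (simp add: inner_commute)
        ultimately show "p \<noteq> Q n" "p \<noteq> - Q n" by auto
      qed (use * in auto)
      moreover have "(\<lambda>n. (1 - p \<bullet> x) * (1 - Q n \<bullet> x')) \<longlonglongrightarrow> (1 - p \<bullet> x) * (1 - q \<bullet> x')"
        by (intro tendsto_intros lim)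
      moreover have "(\<lambda>n. exp (2 * W) * ((1 - Q n \<bullet> x) * (1 - p \<bullet> x')))
          \<longlonglongrightarrow> exp (2 * W) * ((1 - q \<bullet> x) * (1 - p \<bullet> x'))"
        by (intro tendsto_intros lim)
      ultimately show ?thesis by (meson LIMSEQ_le)
    qed
  qed
qed

text \<open>Each factor \<open>1 - p \<bullet> x\<close> lies between \<open>1 - \<rho>\<close> and \<open>1 + \<rho>\<close>, so a quotient of two
ratios is at most \<open>((1 + \<rho>) / (1 - \<rho>))\<^sup>2\<close>. It has to be shown that every admissible cross-ratio is
such a quotient.\<close>

lemma hyperbolic_width_le_ball:
  fixes K :: "'a::euclidean_space set"
  assumes K: "K \<subseteq> cball 0 \<rho>" and \<rho>: "0 < \<rho>" "\<rho> < 1" and d: "2 \<le> DIM('a)"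
  shows "hyperbolic_width K \<le> ereal (ln ((1 + \<rho>) / (1 - \<rho>)))"
  unfolding hyperbolic_width_def rel_width_def
proof (rule Sup_least, clarify)
  fix \<alpha> l1 m1 l2 m2 :: "'a set" and c
  assume \<alpha>: "affine \<alpha>" "aff_dim \<alpha> = int DIM('a) - 2" "\<alpha> \<inter> cball 0 1 = {}"
    and s1: "support_hyperplane (cball 0 1) l1" "support_hyperplane (cball 0 1) m1" "l1 \<noteq> m1"
    and s2: "support_hyperplane K l2" "support_hyperplane K m2" "l2 \<noteq> m2"
    and sub: "\<alpha> \<subseteq> l1" "\<alpha> \<subseteq> m1" "\<alpha> \<subseteq> l2" "\<alpha> \<subseteq> m2"
    and cr: "hyperplanes_cr \<alpha> m2 l2 l1 m1 c" and c1: "1 \<le> \<bar>c\<bar>"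
  obtain p where p: "norm p = 1" and l1: "l1 = {x. p \<bullet> x = 1}" using support_hyperplane_cball[OF s1(1)] by metis
  obtain q where q: "norm q = 1" and m1: "m1 = {x. q \<bullet> x = 1}" using support_hyperplane_cball[OF s1(2)] by metis
  have pq: "p \<noteq> q" using s1(3) l1 m1 by auto
  have bnd: "1 - \<rho> \<le> 1 - u \<bullet> x" "1 - u \<bullet> x \<le> 1 + \<rho>" if "norm u = 1" "x \<in> K" for u x
  proof -
    have "\<bar>u \<bullet> x\<bar> \<le> \<rho>" using Cauchy_Schwarz_ineq2[of u x] that K by fastforce
    then show "1 - \<rho> \<le> 1 - u \<bullet> x" "1 - u \<bullet> x \<le> 1 + \<rho>" by auto
  qed
  have hyp: "affine l" "aff_dim l = int DIM('a) - 1" if "support_hyperplane S l" for S l :: "'a set"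
    using that by (auto simp: support_hyperplane_def affine_hyperplane aff_dim_hyperplane)
  have axis: "l1 \<inter> m1 = \<alpha>"
  proof -
    have ne: "\<alpha> \<noteq> {}" using \<alpha>(2) d by (auto simp: aff_dim_empty_eq)
    have "p \<in> l1 - m1"
      using inner_unit_less_one[OF p q pq] p by (simp add: l1 m1 norm_eq_1 inner_commute)
    then have "aff_dim (l1 \<inter> m1) = int DIM('a) - 2"
      using aff_dim_affine_Int_hyperplane[OF hyp(1)[OF s1(1)], of q 1] hyp(2)[OF s1(1)] ne sub m1 by auto
    then show ?thesis
      using affine_dim_equal[of \<alpha> "l1 \<inter> m1"] \<alpha> ne sub hyp(1)[OF s1(1)] hyp(1)[OF s1(2)] affine_Int by auto
  qed
  define r where "r x = (1 - p \<bullet> x) / (1 - q \<bullet> x)" for x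
  have r: "0 < r x" "r x \<le> (1 + \<rho>) / (1 - \<rho>)" "1 / r x \<le> (1 + \<rho>) / (1 - \<rho>)" if "x \<in> K" for x
    using bnd[OF p that] bnd[OF q that] \<rho> by (auto simp: r_def intro!: frac_le divide_pos_pos)
  \<comment> \<open>A support hyperplane of \<open>K\<close> through \<open>\<alpha>\<close> is determined by the point where it touches \<open>K\<close>.\<close>
  have plane: "\<exists>x\<in>K. \<forall>z\<in>l. 1 - p \<bullet> z = r x * (1 - q \<bullet> z)"
    if l: "support_hyperplane K l" "\<alpha> \<subseteq> l" for l
  proof -
    obtain x where x: "x \<in> K" "x \<in> l" using l by (auto simp: support_hyperplane_def)
    have "norm x \<le> 1" using x K \<rho> by fastforce
    then have "x \<notin> \<alpha>" using \<alpha>(3) by auto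
    then have "aff_dim (insert x \<alpha>) = int DIM('a) - 1"
      using \<alpha> by (simp add: aff_dim_insert hull_same)
    then have "affine hull (insert x \<alpha>) = l"
      using hyp[OF l(1)] x l by (intro affine_dim_equal) (auto simp: hull_minimal)
    moreover have "affine hull (insert x \<alpha>) \<subseteq> {z. (p - r x *\<^sub>R q) \<bullet> z = 1 - r x}"
    proof (rule hull_minimal)
      have "1 - q \<bullet> x \<noteq> 0" using bnd(1)[OF q x(1)] \<rho> by auto
      then have "1 - p \<bullet> x = r x * (1 - q \<bullet> x)" by (simp add: r_def)
      then have "(p - r x *\<^sub>R q) \<bullet> x = 1 - r x" by (simp add: inner_diff_left algebra_simps)
      moreover have "(p - r x *\<^sub>R q) \<bullet> z = 1 - r x" if "z \<in> \<alpha>" for z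
      proof -
        have "p \<bullet> z = 1" "q \<bullet> z = 1" using that sub(1,2) l1 m1 by blast+
        then show ?thesis by (simp add: inner_diff_left)
      qed
      ultimately show "insert x \<alpha> \<subseteq> {z. (p - r x *\<^sub>R q) \<bullet> z = 1 - r x}" by blast
    qed (rule affine_hyperplane)
    ultimately show ?thesis using x(1) by (force simp: inner_diff_left algebra_simps)
  qed
  obtain x2 where x2: "x2 \<in> K" "\<And>z. z \<in> l2 \<Longrightarrow> 1 - p \<bullet> z = r x2 * (1 - q \<bullet> z)"
    using plane[OF s2(1) sub(3)] by blast
  obtain x3 where x3: "x3 \<in> K" "\<And>z. z \<in> m2 \<Longrightarrow> 1 - p \<bullet> z = r x3 * (1 - q \<bullet> z)"
    using plane[OF s2(2) sub(4)] by blast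
  obtain x v tm tl a b where line: "\<And>t. x + t *\<^sub>R v \<notin> \<alpha>"
    and tm: "\<And>t. x + t *\<^sub>R v \<in> m2 \<longleftrightarrow> t = tm" and tl: "\<And>t. x + t *\<^sub>R v \<in> l2 \<longleftrightarrow> t = tl"
    and ta: "\<And>t. x + t *\<^sub>R v \<in> l1 \<longleftrightarrow> t = a" and tb: "\<And>t. x + t *\<^sub>R v \<in> m1 \<longleftrightarrow> t = b"
    and c: "c = cr tm tl a b"
    using cr unfolding hyperplanes_cr_def by blast
  have A: "1 - p \<bullet> (x + t *\<^sub>R v) = - (p \<bullet> v) * (t - a)" and B: "1 - q \<bullet> (x + t *\<^sub>R v) = - (q \<bullet> v) * (t - b)" for t
    using ta[of a] tb[of b] by (auto simp: l1 m1 inner_add_right algebra_simps)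
  have nz: "p \<bullet> v \<noteq> 0" "q \<bullet> v \<noteq> 0"
    using ta[of "a + 1"] tb[of "b + 1"] A[of "a + 1"] B[of "b + 1"] by (auto simp: l1 m1)
  have ab: "a \<noteq> b" using ta[of a] tb[of a] line[of a] axis by auto
  have El: "(p \<bullet> v) * (tl - a) = r x2 * ((q \<bullet> v) * (tl - b))"
    using x2(2)[of "x + tl *\<^sub>R v"] tl[of tl] unfolding A B by simp
  have Em: "(p \<bullet> v) * (tm - a) = r x3 * ((q \<bullet> v) * (tm - b))"
    using x3(2)[of "x + tm *\<^sub>R v"] tm[of tm] unfolding A B by simp
  have nl: "tl - a \<noteq> 0" "tl - b \<noteq> 0" using El nz ab r(1)[OF x2(1)] by auto
  have nm: "tm - a \<noteq> 0" "tm - b \<noteq> 0" using Em nz ab r(1)[OF x3(1)] by auto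
  have El': "(tl - b) / (tl - a) = (p \<bullet> v) / (r x2 * (q \<bullet> v))"
    using El nl nz r(1)[OF x2(1)] by (simp add: field_simps)
  have Em': "(tm - a) / (tm - b) = r x3 * (q \<bullet> v) / (p \<bullet> v)"
    using Em nm nz r(1)[OF x3(1)] by (simp add: field_simps)
  have "(tm - a) * (tl - b) / ((tm - b) * (tl - a)) = ((tm - a) / (tm - b)) * ((tl - b) / (tl - a))"
    by simp
  also have "\<dots> = r x3 / r x2" unfolding El' Em' using nz by simp
  finally have c': "c = ereal (r x3 / r x2)" unfolding c cr_def using nl nm by simp
  have "r x3 * (1 / r x2) \<le> ((1 + \<rho>) / (1 - \<rho>)) * ((1 + \<rho>) / (1 - \<rho>))"
    using r[OF x3(1)] r[OF x2(1)] \<rho> by (intro mult_mono) auto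
  then have "r x3 / r x2 \<le> ((1 + \<rho>) / (1 - \<rho>))\<^sup>2" by (simp add: power2_eq_square)
  then have "ln (r x3 / r x2) \<le> ln (((1 + \<rho>) / (1 - \<rho>))\<^sup>2)"
    using r(1)[OF x3(1)] r(1)[OF x2(1)] \<rho> by (intro iffD2[OF ln_le_cancel_iff]) auto
  also have "\<dots> = 2 * ln ((1 + \<rho>) / (1 - \<rho>))" using \<rho> by (simp add: ln_realpow)
  finally show "ereal (1/2) * ln_ereal \<bar>c\<bar> \<le> ereal (ln ((1 + \<rho>) / (1 - \<rho>)))"
    using r(1)[OF x3(1)] r(1)[OF x2(1)] by (simp add: c' ln_ereal_def)
qed

section \<open>Boosts of the Cayley-Klein model\<close>

text \<open>The time coordinate of the point of the hyperboloid above \<open>y\<close>.\<close>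

definition hyp :: "'a::euclidean_space \<Rightarrow> real" where
  "hyp y = sqrt (1 + y \<bullet> y)"

lemma hyp_square: "hyp y * hyp y = 1 + y \<bullet> y"
  by (simp add: hyp_def add_nonneg_nonneg flip: power2_eq_square)

lemma hyp_ge_one: "1 \<le> hyp y"
  by (simp add: hyp_def)

lemma hyp_minus [simp]: "hyp (- y) = hyp y"
  by (simp add: hyp_def)

lemma norm_less_hyp: "norm y < hyp y"
  by (simp add: hyp_def norm_eq_sqrt_inner)

text \<open>Minus the Lorentz product of \<open>(hyp y, y)\<close> and \<open>(1, x)\<close>.\<close>

definition den :: "'a::euclidean_space \<Rightarrow> 'a \<Rightarrow> real" where
  "den y x = hyp y - y \<bullet> x"

lemma den_pos:
  assumes "norm x \<le> 1" shows "0 < den y x"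
proof -
  have "y \<bullet> x \<le> norm y * norm x" by (rule norm_cauchy_schwarz)
  also have "\<dots> \<le> norm y" using assms by (simp add: mult_left_le)
  finally show ?thesis using norm_less_hyp[of y] by (simp add: den_def)
qed

definition stretch :: "'a::euclidean_space \<Rightarrow> 'a \<Rightarrow> 'a" where
  "stretch y x = x + ((y \<bullet> x) / (1 + hyp y)) *\<^sub>R y"

text \<open>The Lorentz boost in the plane spanned by \<open>(1, 0)\<close> and \<open>(hyp y, y)\<close> that sends the second of
these vectors to the first.\<close>

definition boost :: "'a::euclidean_space \<Rightarrow> real \<times> 'a \<Rightarrow> real \<times> 'a" where
  "boost y = (\<lambda>(t, x). (hyp y * t - y \<bullet> x, stretch y x - t *\<^sub>R y))"

text \<open>The boost as a map of the affine chart.\<close>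

definition hmap :: "'a::euclidean_space \<Rightarrow> 'a \<Rightarrow> 'a" where
  "hmap y x = (stretch y x - y) /\<^sub>R den y x"

definition lform :: "real \<times> 'a::euclidean_space \<Rightarrow> real \<times> 'a \<Rightarrow> real" where
  "lform v w = fst v * fst w - snd v \<bullet> snd w"

lemma inner_self_div_hyp: "(y \<bullet> y) / (1 + hyp y) = hyp y - 1"
proof -
  have "1 + hyp y \<noteq> 0" using hyp_ge_one[of y] by simp
  moreover have "y \<bullet> y = (hyp y - 1) * (1 + hyp y)" using hyp_square[of y] by (simp add: algebra_simps)
  ultimately show ?thesis by simp
qed

lemma inner_stretch: "y \<bullet> stretch y x = hyp y * (y \<bullet> x)"
proof -
  have "y \<bullet> stretch y x = y \<bullet> x + (y \<bullet> x) * ((y \<bullet> y) / (1 + hyp y))"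
    by (simp add: stretch_def inner_add_right)
  then show ?thesis unfolding inner_self_div_hyp by (simp add: algebra_simps)
qed

lemma boost_inverse: "boost (- y) (boost y v) = v"
proof (cases v)
  case (Pair t x)
  have nz: "1 + hyp y \<noteq> 0" using hyp_ge_one[of y] by simp
  have yy: "y \<bullet> y = (hyp y - 1) * (1 + hyp y)" using hyp_square[of y] by (simp add: algebra_simps)
  define Z where "Z = y \<bullet> (stretch y x - t *\<^sub>R y)"
  have 1: "Z = hyp y * (y \<bullet> x) - t * ((hyp y - 1) * (1 + hyp y))"
    by (simp add: Z_def inner_diff_right inner_stretch yy)
  have c: "(y \<bullet> x) / (1 + hyp y) - t + Z / (1 + hyp y) + (hyp y * t - y \<bullet> x) = 0"
  proof -
    have "(y \<bullet> x) / (1 + hyp y) + hyp y * (y \<bullet> x) / (1 + hyp y) = (1 + hyp y) * (y \<bullet> x) / (1 + hyp y)"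
      by (simp add: add_divide_distrib[symmetric] distrib_right)
    then have "(y \<bullet> x) / (1 + hyp y) + hyp y * (y \<bullet> x) / (1 + hyp y) = y \<bullet> x" using nz by simp
    moreover have "Z / (1 + hyp y) = hyp y * (y \<bullet> x) / (1 + hyp y) - t * (hyp y - 1)"
      unfolding 1 using nz by (simp add: diff_divide_distrib)
    ultimately show ?thesis by (simp add: algebra_simps)
  qed
  have "stretch (- y) (stretch y x - t *\<^sub>R y) - (hyp y * t - y \<bullet> x) *\<^sub>R (- y)
     = x + ((y \<bullet> x) / (1 + hyp y) - t + Z / (1 + hyp y) + (hyp y * t - y \<bullet> x)) *\<^sub>R y"
    unfolding stretch_def[of "- y"] hyp_minus inner_minus_left Z_def[symmetric]
    by (simp add: stretch_def scaleR_left_distrib scaleR_left_diff_distrib)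
  also have "\<dots> = x" unfolding c by simp
  finally have 2: "stretch (- y) (stretch y x - t *\<^sub>R y) - (hyp y * t - y \<bullet> x) *\<^sub>R (- y) = x" .
  have "hyp y * (hyp y * t - y \<bullet> x) + y \<bullet> (stretch y x - t *\<^sub>R y) = t"
    unfolding Z_def[symmetric] 1 by (simp add: algebra_simps)
  then show ?thesis using 2 by (simp add: Pair boost_def)
qed

lemma linear_boost: "linear (boost y)"
  by (rule linearI)
    (auto simp: boost_def stretch_def inner_add_right algebra_simps add_divide_distrib)

lemma bij_boost: "bij (boost y)"
  using boost_inverse[of y] boost_inverse[of "- y"] by (intro o_bij[of "boost (- y)"]) (auto simp: fun_eq_iff)

lemma lform_boost: "lform (boost y v) w = lform v (boost (- y) w)"
  by (cases v; cases w)
    (simp add: lform_def boost_def stretch_def inner_add inner_diff inner_commute algebra_simps)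

lemma lform_boost_boost: "lform (boost y v) (boost y w) = lform v w"
  using lform_boost[of y v "boost y w"] boost_inverse[of y w] by simp

lemma boost_chart:
  assumes "norm x \<le> 1"
  shows "boost y (1, x) = den y x *\<^sub>R (1, hmap y x)"
  using den_pos[OF assms, of y] by (simp add: boost_def den_def[symmetric] hmap_def)

lemma form_hmap:
  assumes "norm x \<le> 1" "norm z \<le> 1"
  shows "den y x * den y z * (1 - hmap y x \<bullet> hmap y z) = 1 - x \<bullet> z"
proof -
  have "lform (boost y (1, x)) (boost y (1, z)) = lform (1, x) (1, z)" by (rule lform_boost_boost)
  then show ?thesis
    unfolding boost_chart[OF assms(1)] boost_chart[OF assms(2)] by (simp add: lform_def algebra_simps)
qed

lemma norm_hmap:
  assumes "norm x \<le> 1"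
  shows "(den y x)\<^sup>2 * (1 - (norm (hmap y x))\<^sup>2) = 1 - (norm x)\<^sup>2"
  using form_hmap[OF assms assms, of y] unfolding power2_norm_eq_inner by (simp add: power2_eq_square)

lemma norm_hmap_cases:
  shows "norm x \<le> 1 \<Longrightarrow> norm (hmap y x) \<le> 1" "norm x < 1 \<Longrightarrow> norm (hmap y x) < 1"
    "norm x = 1 \<Longrightarrow> norm (hmap y x) = 1"
proof -
  have sq: "0 \<le> 1 - (norm z)\<^sup>2 \<longleftrightarrow> norm z \<le> 1" "0 < 1 - (norm z)\<^sup>2 \<longleftrightarrow> norm z < 1"
    "1 - (norm z)\<^sup>2 = 0 \<longleftrightarrow> norm z = 1" for z :: 'a
    by (auto simp: abs_square_le_1 abs_square_less_1 power2_eq_1_iff) (smt (verit) norm_ge_zero)+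
  have d: "0 < (den y x)\<^sup>2" if "norm x \<le> 1" using den_pos[OF that, of y] by simp
  show "norm x \<le> 1 \<Longrightarrow> norm (hmap y x) \<le> 1"
    using norm_hmap[of x y] d sq(1)[of x] sq(1)[of "hmap y x"] by (metis mult.commute not_less zero_le_mult_iff less_le_not_le)
  show "norm x < 1 \<Longrightarrow> norm (hmap y x) < 1"
    using norm_hmap[of x y] d sq(2)[of x] sq(2)[of "hmap y x"] by (metis less_imp_le zero_less_mult_pos)
  show "norm x = 1 \<Longrightarrow> norm (hmap y x) = 1"
    using norm_hmap[of x y] d sq(3)[of x] sq(3)[of "hmap y x"] by (metis less_irrefl mult_eq_0_iff order_refl)
qed

lemma hmap_inverse:
  assumes "norm x \<le> 1" shows "hmap (- y) (hmap y x) = x"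
proof -
  have n: "norm (hmap y x) \<le> 1" by (rule norm_hmap_cases(1)[OF assms])
  have "(1::real, x) = boost (- y) (den y x *\<^sub>R (1, hmap y x))"
    using boost_inverse[of y "(1, x)"] unfolding boost_chart[OF assms] by simp
  also have "\<dots> = den y x *\<^sub>R (den (- y) (hmap y x) *\<^sub>R (1, hmap (- y) (hmap y x)))"
    by (simp only: linear_scale[OF linear_boost] boost_chart[OF n])
  finally have eq: "(1::real, x) = den y x *\<^sub>R (den (- y) (hmap y x) *\<^sub>R (1, hmap (- y) (hmap y x)))" .
  have 1: "den y x * den (- y) (hmap y x) = 1" using arg_cong[OF eq, of fst] by simp
  have "x = (den y x * den (- y) (hmap y x)) *\<^sub>R hmap (- y) (hmap y x)"
    using arg_cong[OF eq, of snd] by (simp only: snd_conv snd_scaleR scaleR_scaleR)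
  then show ?thesis unfolding 1 scaleR_one by (rule sym)
qed

lemma inj_on_hmap: "inj_on (hmap y) (cball 0 1)"
  by (rule inj_on_inverseI[where g = "hmap (- y)"]) (simp add: hmap_inverse)

text \<open>The left side is the Lorentz product of \<open>(1, hmap y x)\<close> with the null vector \<open>(1, p)\<close>. The boost can be
moved to the other side, where it permutes the null directions up to scaling.\<close>

lemma one_minus_inner_hmap:
  assumes "norm x \<le> 1" "norm p = 1"
  shows "1 - p \<bullet> hmap y x = den (- y) p * (1 - hmap (- y) p \<bullet> x) / den y x"
proof -
  have "lform (boost y (1, x)) (1, p) = lform (1, x) (boost (- y) (1, p))" by (rule lform_boost)
  then have "den y x * (1 - p \<bullet> hmap y x) = den (- y) p * (1 - hmap (- y) p \<bullet> x)"
    using assms by (simp add: boost_chart lform_def inner_commute algebra_simps)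
  then show ?thesis using den_pos[OF assms(1), of y] by (simp add: field_simps)
qed

lemma continuous_on_den: "continuous_on S (den y)"
  unfolding den_def[abs_def] by (intro continuous_intros)

lemma continuous_on_hmap:
  assumes "S \<subseteq> cball 0 1" shows "continuous_on S (hmap y)"
proof -
  have "den y x \<noteq> 0" if "x \<in> S" for x using den_pos[of x y] that assms by force
  moreover have "1 + hyp y \<noteq> 0" using hyp_ge_one[of y] by simp
  ultimately show ?thesis
    unfolding hmap_def[abs_def] stretch_def[abs_def] by (intro continuous_intros continuous_on_den) auto
qed

text \<open>A convex combination of images is the image of a convex combination, with weights rescaled by the
denominators of the projective map.\<close>

lemma convex_hmap_image:
  assumes "convex K" "K \<subseteq> cball 0 1"
  shows "convex (hmap y ` K)"
  unfolding convex_alt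
proof clarify
  fix x z and u :: real assume x: "x \<in> K" "z \<in> K" and u: "0 \<le> u" "u \<le> 1"
  define a b where "a = (1 - u) / den y x" and "b = u / den y z"
  define s where "s = a + b"
  have d: "0 < den y x" "0 < den y z" using den_pos[of x y] den_pos[of z y] x assms(2) by (auto simp: subset_iff)
  have a0: "0 \<le> a" "0 \<le> b" using d u by (auto simp: a_def b_def)
  have s0: "0 < s"
  proof (cases "u = 0")
    case True
    then show ?thesis using d by (simp add: s_def a_def b_def)
  next
    case False
    then have "0 < b" using d u by (simp add: b_def)
    then show ?thesis using a0 by (simp add: s_def)
  qed
  define w where "w = (a / s) *\<^sub>R x + (b / s) *\<^sub>R z"
  have "a / s + b / s = 1" using s0 by (simp add: s_def add_divide_distrib[symmetric])
  then have w: "w \<in> K"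
    unfolding w_def using assms(1) x a0 s0 by (intro convexD) auto
  have sw: "s *\<^sub>R w = a *\<^sub>R x + b *\<^sub>R z" using s0 by (simp add: w_def algebra_simps)
  have lin: "a * (y \<bullet> x) + b * (y \<bullet> z) = s * (y \<bullet> w)"
    using arg_cong[OF sw, of "inner y"] by (simp add: inner_add_right)
  have "s * den y w = a * den y x + b * den y z"
    unfolding den_def using lin by (simp add: s_def algebra_simps)
  also have "\<dots> = 1" using d by (simp add: a_def b_def)
  finally have dw: "den y w = 1 / s" using s0 by (simp add: field_simps)
  have "a *\<^sub>R (stretch y x - y) + b *\<^sub>R (stretch y z - y) = s *\<^sub>R (stretch y w - y)"
  proof -
    have "a *\<^sub>R stretch y x + b *\<^sub>R stretch y z = s *\<^sub>R w + ((a * (y \<bullet> x) + b * (y \<bullet> z)) / (1 + hyp y)) *\<^sub>R y"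
      unfolding sw by (simp add: stretch_def algebra_simps add_divide_distrib)
    also have "\<dots> = s *\<^sub>R stretch y w" unfolding lin by (simp add: stretch_def algebra_simps)
    finally show ?thesis by (simp add: s_def algebra_simps)
  qed
  then have "(1 - u) *\<^sub>R hmap y x + u *\<^sub>R hmap y z = hmap y w"
    by (simp add: hmap_def dw a_def b_def divide_inverse)
  then show "(1 - u) *\<^sub>R hmap y x + u *\<^sub>R hmap y z \<in> hmap y ` K" using w by auto
qed

section \<open>The Jacobian determinant of a boost\<close>

text \<open>The rows \<open>i \<in> S\<close> are reduced to unit vectors by subtracting multiples of row \<open>k\<close>.\<close>

lemma det_replace_row:
  fixes c y :: "real ^ 'n"
  assumes "k \<notin> S"
  shows "det (\<chi> i. if i = k then y else if i \<in> S then axis i 1 + c $ i *\<^sub>R y else axis i 1) = y $ k"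
proof -
  have "finite S" by simp
  then show ?thesis using assms
  proof (induction S rule: finite_induct)
    case empty
    have rows: "row i (mat 1) = axis i (1::real)" for i :: 'n
      by (auto simp: row_def mat_def axis_def vec_eq_iff)
    show ?case
      using cramer_lemma_transpose[where A = "mat 1 :: real^'n^'n" and x = y and k = k]
      by (simp only: rows basis_expansion empty_iff if_False det_I mult_1_right)
  next
    case (insert j S)
    let ?A = "\<chi> i. if i = k then y else if i \<in> S then axis i 1 + c $ i *\<^sub>R y else axis i (1::real)"
    have "(\<chi> i. if i = k then y else if i \<in> insert j S then axis i 1 + c $ i *\<^sub>R y else axis i (1::real))
      = (\<chi> i. if i = j then row j ?A + c $ j *s row k ?A else row i ?A)"
      using insert by (auto simp: vec_eq_iff row_def)
    moreover have "det \<dots> = det ?A" using insert by (intro det_row_operation) auto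
    ultimately show ?case using insert by simp
  qed
qed

lemma det_identity_plus_rank_one:
  fixes c y :: "real ^ 'n"
  shows "det (\<chi> i j. (if i = j then 1 else 0) + c $ i * y $ j) = 1 + c \<bullet> y"
proof -
  have "det (\<chi> i. if i \<in> S then axis i 1 + c $ i *\<^sub>R y else axis i (1::real)) = 1 + (\<Sum>i\<in>S. c $ i * y $ i)"
    if "finite S" for S
    using that
  proof (induction S rule: finite_induct)
    case empty
    have "(\<chi> i. axis i (1::real)) = (mat 1 :: real^'n^'n)"
      by (auto simp: mat_def axis_def vec_eq_iff)
    then show ?case by simp
  next
    case (insert k S)
    let ?r = "\<lambda>i. if i \<in> S then axis i 1 + c $ i *\<^sub>R y else axis i (1::real)"
    have "(\<chi> i. if i \<in> insert k S then axis i 1 + c $ i *\<^sub>R y else axis i (1::real))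
      = (\<chi> i. if i = k then axis k 1 + c $ k *s y else ?r i)"
      by (auto simp: vec_eq_iff)
    also have "det \<dots> = det (\<chi> i. if i = k then axis k 1 else ?r i) + c $ k * det (\<chi> i. if i = k then y else ?r i)"
      by (simp only: det_row_add det_row_mul)
    also have "(\<chi> i. if i = k then axis k 1 else ?r i) = (\<chi> i. ?r i)"
      using insert by (auto simp: vec_eq_iff)
    also have "det (\<chi> i. if i = k then y else ?r i) = y $ k"
      by (rule det_replace_row[OF insert(2)])
    finally show ?case using insert by simp
  qed
  from this[of UNIV] have "det (\<chi> i. axis i 1 + c $ i *\<^sub>R y) = 1 + c \<bullet> y"
    by (simp add: inner_vec_def)
  moreover have "(\<chi> i. axis i 1 + c $ i *\<^sub>R y) = (\<chi> i j. (if i = j then 1 else 0) + c $ i * y $ j)"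
    by (auto simp: vec_eq_iff axis_def)
  ultimately show ?thesis by simp
qed

lemma hmap_has_derivative:
  assumes "norm x \<le> 1"
  shows "(hmap y has_derivative
    (\<lambda>v. (v + (y \<bullet> v) *\<^sub>R (y /\<^sub>R (1 + hyp y) + hmap y x)) /\<^sub>R den y x)) (at x within S)"
proof -
  have d: "den y x \<noteq> 0" using den_pos[OF assms, of y] by simp
  have den': "(den y has_derivative (\<lambda>v. - (y \<bullet> v))) (at x within S)"
    unfolding den_def[abs_def] by (auto intro!: derivative_eq_intros)
  have str': "((\<lambda>x. stretch y x - y) has_derivative (\<lambda>v. stretch y v)) (at x within S)"
    unfolding stretch_def[abs_def] by (auto intro!: derivative_eq_intros simp: divide_inverse algebra_simps)
  have "((\<lambda>x. inverse (den y x) *\<^sub>R (stretch y x - y)) has_derivative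
     (\<lambda>v. inverse (den y x) *\<^sub>R stretch y v
        + (- (inverse (den y x) * (- (y \<bullet> v)) * inverse (den y x))) *\<^sub>R (stretch y x - y))) (at x within S)"
    by (rule has_derivative_scaleR[OF Deriv.has_derivative_inverse[OF d den'] str'])
  moreover have "inverse (den y x) *\<^sub>R stretch y v
        + (- (inverse (den y x) * (- (y \<bullet> v)) * inverse (den y x))) *\<^sub>R (stretch y x - y)
     = (v + (y \<bullet> v) *\<^sub>R (y /\<^sub>R (1 + hyp y) + hmap y x)) /\<^sub>R den y x" for v
    by (simp add: hmap_def stretch_def[of y v] scaleR_add_right divide_inverse mult_ac)
  ultimately show ?thesis by (simp add: hmap_def[abs_def])
qed

text \<open>The derivative of the boost is a multiple of the identity plus a map of rank one.\<close>

lemma det_hmap_derivative: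
  fixes x y :: "real ^ 'n"
  assumes "norm x \<le> 1"
  shows "det (matrix (\<lambda>v. (v + (y \<bullet> v) *\<^sub>R (y /\<^sub>R (1 + hyp y) + hmap y x)) /\<^sub>R den y x))
    = 1 / den y x ^ (CARD('n) + 1)"
proof -
  define c where "c = y /\<^sub>R (1 + hyp y) + hmap y x"
  define D where "D = den y x"
  have D: "0 < D" using den_pos[OF assms, of y] by (simp add: D_def)
  have "matrix (\<lambda>v. (v + (y \<bullet> v) *\<^sub>R c) /\<^sub>R D)
    = (\<chi> i. inverse D *s (\<chi> i j. (if i = j then 1 else 0) + c $ i * y $ j) $ i)"
    by (auto simp: matrix_def vec_eq_iff inner_axis) (auto simp: axis_def algebra_simps)
  then have "det (matrix (\<lambda>v. (v + (y \<bullet> v) *\<^sub>R c) /\<^sub>R D)) = inverse D ^ CARD('n) * (1 + c \<bullet> y)"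
    using det_rows_mul[of "\<lambda>_. inverse D" "\<lambda>i. (\<chi> i j. (if i = j then 1 else 0) + c $ i * y $ j) $ i"]
      det_identity_plus_rank_one[of c y] by simp
  also have "1 + c \<bullet> y = 1 / D"
  proof -
    have nz: "1 + hyp y \<noteq> 0" using hyp_ge_one[of y] by simp
    have yy: "y \<bullet> y = (hyp y - 1) * (1 + hyp y)" using hyp_square[of y] by (simp add: algebra_simps)
    have "y \<bullet> hmap y x = (hyp y * (y \<bullet> x) - (hyp y - 1) * (1 + hyp y)) / D"
      by (simp add: hmap_def inner_diff_right inner_stretch yy D_def divide_inverse mult.commute)
    moreover have "y \<bullet> (y /\<^sub>R (1 + hyp y)) = hyp y - 1" using nz by (simp add: yy field_simps)
    moreover have "c \<bullet> y = y \<bullet> (y /\<^sub>R (1 + hyp y)) + y \<bullet> hmap y x"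
      unfolding inner_commute[of c y] unfolding c_def by (rule inner_add_right)
    ultimately have "1 + c \<bullet> y = hyp y + (hyp y * (y \<bullet> x) - (hyp y - 1) * (1 + hyp y)) / D"
      by simp
    also have "\<dots> = (hyp y * D + hyp y * (y \<bullet> x) - (hyp y - 1) * (1 + hyp y)) / D"
      using D by (simp add: field_simps)
    also have "hyp y * D + hyp y * (y \<bullet> x) - (hyp y - 1) * (1 + hyp y) = 1"
      by (simp add: D_def den_def algebra_simps)
    finally show ?thesis .
  qed
  finally show ?thesis using D by (simp add: c_def D_def power_inverse divide_inverse)
qed

section \<open>Change of variables under boosts and rotations\<close>

text \<open>The change of variables theorem concerns spaces whose coordinates are indexed by a well-ordered type. A
well-ordered copy of the index type gives an isometric space, and boosts commute with isometries because they
are defined by inner products.\<close>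

typedef ('n::finite) ordered_index = "{..<CARD('n)}"
  by (intro exI[of _ 0]) simp

instantiation ordered_index :: (finite) wellorder
begin

definition "x \<le> y \<longleftrightarrow> Rep_ordered_index x \<le> Rep_ordered_index y"

definition "x < y \<longleftrightarrow> Rep_ordered_index x < Rep_ordered_index y"

instance
proof
  fix P :: "'a ordered_index \<Rightarrow> bool" and a
  assume step: "\<And>x. (\<And>y. y < x \<Longrightarrow> P y) \<Longrightarrow> P x"
  show "P a"
    by (induction a rule: measure_induct_rule[where f = Rep_ordered_index])
      (rule step, simp add: less_ordered_index_def)
qed (auto simp: less_eq_ordered_index_def less_ordered_index_def Rep_ordered_index_inject)

end

instance ordered_index :: (finite) finite
proof
  have "finite (Abs_ordered_index ` {..<CARD('a)} :: 'a ordered_index set)" by simp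
  moreover have "(UNIV :: 'a ordered_index set) = Abs_ordered_index ` {..<CARD('a)}"
    using type_definition.Abs_image[OF type_definition_ordered_index[where 'n = 'a]] by simp
  ultimately show "finite (UNIV :: 'a ordered_index set)" by simp
qed

lemma card_ordered_index: "CARD('n::finite ordered_index) = CARD('n)"
  using type_definition.card[OF type_definition_ordered_index[where 'n = 'n]] by simp

definition reindex :: "'n::finite \<Rightarrow> 'n ordered_index" where
  "reindex = (SOME f. bij f)"

lemma bij_reindex: "bij (reindex :: 'n::finite \<Rightarrow> 'n ordered_index)"
proof -
  have "\<exists>f :: 'n \<Rightarrow> 'n ordered_index. bij_betw f UNIV UNIV"
    by (rule finite_same_card_bij) (simp_all add: card_ordered_index)
  then show ?thesis unfolding reindex_def by (rule someI_ex)
qed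

definition sort_coords :: "real ^ 'n::finite \<Rightarrow> real ^ 'n ordered_index" where
  "sort_coords x = (\<chi> j. x $ inv reindex j)"

definition unsort_coords :: "real ^ 'n::finite ordered_index \<Rightarrow> real ^ 'n" where
  "unsort_coords x = (\<chi> i. x $ reindex i)"

lemma inv_reindex [simp]: "inv reindex (reindex i) = i" "reindex (inv reindex j) = j"
  by (simp_all add: inv_f_f[OF bij_is_inj[OF bij_reindex]] surj_f_inv_f[OF bij_is_surj[OF bij_reindex]])

lemma unsort_sort [simp]: "unsort_coords (sort_coords x) = x" "sort_coords (unsort_coords z) = z"
  by (simp_all add: unsort_coords_def sort_coords_def vec_eq_iff)

lemma sort_inject [simp]: "sort_coords x = sort_coords y \<longleftrightarrow> x = y"
proof
  assume "sort_coords x = sort_coords y"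
  from arg_cong[OF this, of unsort_coords] show "x = y" by simp
qed simp

lemma inner_sort: "sort_coords x \<bullet> sort_coords y = x \<bullet> y"
proof -
  have "(\<Sum>j\<in>UNIV. x $ inv reindex j * y $ inv reindex j) = (\<Sum>i\<in>UNIV. x $ i * y $ i)"
    by (rule sum.reindex_bij_betw[of "inv reindex" UNIV UNIV "\<lambda>i. x $ i * y $ i"])
      (use bij_imp_bij_inv[OF bij_reindex] in auto)
  then show ?thesis by (simp add: inner_vec_def sort_coords_def)
qed

lemma linear_sort: "linear sort_coords" "linear unsort_coords"
  by (auto intro!: linearI simp: sort_coords_def unsort_coords_def vec_eq_iff)

lemma norm_sort [simp]: "norm (sort_coords x) = norm x"
  by (simp add: norm_eq_sqrt_inner inner_sort)

lemma continuous_on_sort: "continuous_on S sort_coords" "continuous_on T unsort_coords"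
  using linear_sort linear_continuous_on by (auto simp: linear_conv_bounded_linear)

lemma prod_Basis_cart: "(\<Prod>b\<in>Basis. h (b :: real ^ 'n)) = (\<Prod>i\<in>UNIV. h (axis i 1))"
proof -
  have 1: "(Basis :: (real^'n) set) = (\<lambda>i. axis i 1) ` UNIV" by (auto simp: Basis_vec_def)
  have 2: "inj (\<lambda>i. axis i 1 :: real^'n)" by (auto simp: inj_def axis_eq_axis)
  have "prod h (range (\<lambda>i. axis i 1)) = prod (h \<circ> (\<lambda>i. axis i 1)) UNIV"
    by (rule prod.reindex[OF 2])
  then show ?thesis unfolding 1 o_def .
qed

lemma emeasure_lborel_box_cart:
  fixes l u :: "real ^ 'n"
  assumes "\<And>i. l $ i \<le> u $ i"
  shows "emeasure lborel (box l u) = ennreal (\<Prod>i\<in>UNIV. u $ i - l $ i)"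
proof -
  have "emeasure lborel (box l u) = ennreal (\<Prod>b\<in>Basis. (u - l) \<bullet> b)"
    using assms by (intro emeasure_lborel_box) (auto simp: Basis_vec_def inner_axis)
  also have "(\<Prod>b\<in>Basis. (u - l) \<bullet> b) = (\<Prod>i\<in>UNIV. u $ i - l $ i)"
    by (simp add: prod_Basis_cart inner_axis)
  finally show ?thesis .
qed

lemma lborel_distr_sort: "distr lborel borel sort_coords = (lborel :: (real ^ 'n::finite ordered_index) measure)"
proof (rule lborel_eqI[symmetric])
  have [measurable]: "sort_coords \<in> borel_measurable borel"
    by (rule borel_measurable_continuous_onI[OF continuous_on_sort(1)])
  fix l u :: "real ^ 'n ordered_index"
  assume *: "\<And>b. b \<in> Basis \<Longrightarrow> l \<bullet> b \<le> u \<bullet> b"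
  have le: "l $ j \<le> u $ j" for j
    using *[of "axis j 1"] by (auto simp: Basis_vec_def inner_axis)
  have "sort_coords -` box l u = box (unsort_coords l) (unsort_coords u)"
  proof (rule set_eqI)
    fix x :: "real ^ 'n"
    have "(\<forall>j. l $ j < x $ inv reindex j \<and> x $ inv reindex j < u $ j)
      \<longleftrightarrow> (\<forall>i. l $ reindex i < x $ i \<and> x $ i < u $ reindex i)" (is "(\<forall>j. ?P j) \<longleftrightarrow> (\<forall>i. ?Q i)")
    proof safe
      fix i assume "\<forall>j. ?P j"
      from this[rule_format, of "reindex i"] show "l $ reindex i < x $ i" "x $ i < u $ reindex i" by auto
    next
      fix j assume "\<forall>i. ?Q i"
      from this[rule_format, of "inv reindex j"] show "l $ j < x $ inv reindex j" "x $ inv reindex j < u $ j" by auto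
    qed
    then show "x \<in> sort_coords -` box l u \<longleftrightarrow> x \<in> box (unsort_coords l) (unsort_coords u)"
      by (simp add: mem_box_cart sort_coords_def unsort_coords_def)
  qed
  then have "emeasure (distr lborel borel sort_coords) (box l u)
    = emeasure lborel (box (unsort_coords l) (unsort_coords u))"
    by (subst emeasure_distr) auto
  also have "\<dots> = ennreal (\<Prod>i\<in>UNIV. u $ reindex i - l $ reindex i)"
    using le by (subst emeasure_lborel_box_cart) (auto simp: unsort_coords_def)
  also have "(\<Prod>i\<in>UNIV. u $ reindex i - l $ reindex i) = (\<Prod>j\<in>UNIV. u $ j - l $ j)"
    by (rule prod.reindex_bij_betw[of reindex UNIV UNIV "\<lambda>j. u $ j - l $ j"]) (use bij_reindex in auto)
  also have "\<dots> = (\<Prod>b\<in>Basis. (u - l) \<bullet> b)"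
    by (simp add: prod_Basis_cart inner_axis)
  finally show "emeasure (distr lborel borel sort_coords) (box l u) = (\<Prod>b\<in>Basis. (u - l) \<bullet> b)" .
qed simp

lemma set_integral_sort:
  fixes f :: "real ^ 'n::finite ordered_index \<Rightarrow> real"
  assumes f: "continuous_on (sort_coords ` K) f" and K: "compact K"
  shows "(LINT x:sort_coords ` K|lborel. f x) = (LINT x:K|lborel. f (sort_coords x))"
proof -
  have [measurable]: "sort_coords \<in> borel_measurable borel"
    by (rule borel_measurable_continuous_onI[OF continuous_on_sort(1)])
  have "compact (sort_coords ` K)" using K by (intro compact_continuous_image continuous_on_sort)
  then have "(\<lambda>x. indicator (sort_coords ` K) x *\<^sub>R f x) \<in> borel_measurable borel"
    using borel_measurable_integrable[OF borel_integrable_compact[OF _ f]] by simp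
  then have "(LINT x:sort_coords ` K|distr lborel borel sort_coords. f x)
    = (LINT x|lborel. indicator (sort_coords ` K) (sort_coords x) *\<^sub>R f (sort_coords x))"
    unfolding set_lebesgue_integral_def by (intro integral_distr) auto
  moreover have "indicator (sort_coords ` K) (sort_coords x) = (indicator K x :: real)" for x
    by (auto simp: indicator_def)
  ultimately show ?thesis by (simp add: lborel_distr_sort set_lebesgue_integral_def)
qed

lemma set_integral_eq_integral_compact:
  fixes f :: "'a::euclidean_space \<Rightarrow> 'b::euclidean_space"
  assumes "compact K" "continuous_on K f"
  shows "(LINT x:K|lborel. f x) = integral K f" "f integrable_on K"
proof -
  have "set_integrable lborel K f"
    using borel_integrable_compact[OF assms] by (simp add: set_integrable_def)
  then show "(LINT x:K|lborel. f x) = integral K f" "f integrable_on K"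
    by (auto intro: set_borel_integral_eq_integral)
qed

text \<open>The vector-valued theorem, read in one coordinate.\<close>

lemma change_of_variables_wellorder:
  fixes F :: "real ^ 'm::{finite,wellorder} \<Rightarrow> real ^ 'm::_" and g :: "real ^ 'm::_ \<Rightarrow> real"
  assumes K: "compact K" and F: "\<And>x. x \<in> K \<Longrightarrow> (F has_derivative F' x) (at x within K)"
    and inj: "inj_on F K" and J: "\<And>x. x \<in> K \<Longrightarrow> \<bar>det (matrix (F' x))\<bar> = J x"
    and g: "continuous_on (F ` K) g" and Jc: "continuous_on K J"
  shows "(LINT x:F ` K|lborel. g x) = (LINT x:K|lborel. J x * g (F x))"
proof -
  have Fc: "continuous_on K F"
    using F by (meson continuous_on_eq_continuous_within has_derivative_continuous)
  have FK: "compact (F ` K)" by (rule compact_continuous_image[OF Fc K])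
  define h :: "real ^ 'm::_ \<Rightarrow> real ^ 1" where "h x = vec (g x)" for x
  have hc: "continuous_on (F ` K) h"
    unfolding h_def vec_def by (intro continuous_on_vec_lambda g)
  have hi: "h absolutely_integrable_on (F ` K)"
  proof -
    have "integrable lborel (\<lambda>x. indicator (F ` K) x *\<^sub>R h x)"
      by (rule borel_integrable_compact[OF FK hc])
    then show ?thesis
      unfolding set_integrable_def using integrable_completion borel_measurable_integrable by blast
  qed
  have gF: "continuous_on K (\<lambda>x. J x * g (F x))"
    by (intro continuous_intros Jc continuous_on_compose2[OF g Fc]) auto
  have "K \<in> sets lebesgue" using K by (simp add: lmeasurable_compact fmeasurableD)
  then have "integral (F ` K) h = integral K (\<lambda>x. \<bar>det (matrix (F' x))\<bar> *\<^sub>R h (F x))"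
    by (rule integral_change_of_variables[OF _ F inj disjI1[OF hi]])
  also have "\<dots> = integral K (\<lambda>x. J x *\<^sub>R h (F x))"
    by (intro integral_cong) (simp add: J)
  finally have eq: "integral (F ` K) h $ 1 = integral K (\<lambda>x. J x *\<^sub>R h (F x)) $ 1" by simp
  have "integral (F ` K) h $ 1 = integral (F ` K) g"
    using integral_component_eq_cart[OF set_integral_eq_integral_compact(2)[OF FK hc], of 1]
    by (simp add: h_def)
  moreover have "integral K (\<lambda>x. J x *\<^sub>R h (F x)) $ 1 = integral K (\<lambda>x. J x * g (F x))"
  proof -
    have "continuous_on K (\<lambda>x. J x *\<^sub>R h (F x))"
      by (intro continuous_intros Jc continuous_on_compose2[OF hc Fc]) auto
    from integral_component_eq_cart[OF set_integral_eq_integral_compact(2)[OF K this], of 1]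
    show ?thesis by (simp add: h_def)
  qed
  ultimately show ?thesis
    using eq by (simp add: set_integral_eq_integral_compact(1)[OF FK g] set_integral_eq_integral_compact(1)[OF K gF])
qed

lemma change_of_variables_sorted:
  fixes F :: "real ^ 'n::finite \<Rightarrow> real ^ 'n" and g :: "real ^ 'n \<Rightarrow> real"
  assumes K: "compact K"
    and F: "\<And>z. z \<in> sort_coords ` K \<Longrightarrow>
      ((\<lambda>z. sort_coords (F (unsort_coords z))) has_derivative F' z) (at z within sort_coords ` K)"
    and inj: "inj_on F K" and J: "\<And>x. x \<in> K \<Longrightarrow> \<bar>det (matrix (F' (sort_coords x)))\<bar> = J x"
    and g: "continuous_on (F ` K) g" and Jc: "continuous_on K J" and Fc: "continuous_on K F"
  shows "(LINT x:F ` K|lborel. g x) = (LINT x:K|lborel. J x * g (F x))"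
proof -
  let ?R = "sort_coords :: real^'n \<Rightarrow> _" and ?L = "unsort_coords :: _ \<Rightarrow> real^'n"
  let ?G = "\<lambda>z. ?R (F (?L z))"
  have RK: "compact (?R ` K)" using K by (intro compact_continuous_image continuous_on_sort)
  have FK: "compact (F ` K)" by (rule compact_continuous_image[OF Fc K])
  have L: "continuous_on (?R ` S) (\<lambda>z. h (?L z))" if "continuous_on S h" for S and h :: "_ \<Rightarrow> real"
    by (rule continuous_on_compose2[OF that continuous_on_sort(2)]) auto
  have GK: "?G ` ?R ` K = ?R ` F ` K" by (simp add: image_image)
  have "(LINT x:F ` K|lborel. g x) = (LINT x:F ` K|lborel. g (?L (?R x)))" by simp
  also have "\<dots> = (LINT z:?R ` F ` K|lborel. g (?L z))"
    by (rule set_integral_sort[symmetric, OF L[OF g] FK])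
  also have "\<dots> = (LINT z:?R ` K|lborel. J (?L z) * g (?L (?G z)))"
    unfolding GK[symmetric]
  proof (rule change_of_variables_wellorder[OF RK F])
    show "inj_on ?G (?R ` K)"
    proof (rule inj_onI)
      fix z w assume "z \<in> ?R ` K" "w \<in> ?R ` K" "?G z = ?G w"
      then obtain a b where ab: "z = ?R a" "w = ?R b" "a \<in> K" "b \<in> K" "?R (F a) = ?R (F b)" by auto
      from arg_cong[OF ab(5), of ?L] have "F a = F b" by simp
      then show "z = w" using inj ab by (auto simp: inj_on_def)
    qed
    show "continuous_on (?G ` ?R ` K) (\<lambda>z. g (?L z))" unfolding GK by (rule L[OF g])
    show "continuous_on (?R ` K) (\<lambda>z. J (?L z))" by (rule L[OF Jc])
  qed (use J in auto)
  also have "\<dots> = (LINT x:K|lborel. J (?L (?R x)) * g (?L (?G (?R x))))"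
  proof (rule set_integral_sort[OF _ K])
    have "continuous_on (?R ` K) (\<lambda>z. J (?L z) * g (F (?L z)))"
      by (rule L[of _ "\<lambda>x. J x * g (F x)"])
        (intro continuous_intros Jc continuous_on_compose2[OF g Fc], auto)
    then show "continuous_on (?R ` K) (\<lambda>z. J (?L z) * g (?L (?G z)))" by simp
  qed
  finally show ?thesis by simp
qed

lemma set_integral_hmap:
  fixes y :: "real ^ 'n::finite" and g :: "real ^ 'n \<Rightarrow> real"
  assumes K: "compact K" "K \<subseteq> cball 0 1" and g: "continuous_on (hmap y ` K) g"
  shows "(LINT x:hmap y ` K|lborel. g x) = (LINT x:K|lborel. g (hmap y x) / den y x ^ (CARD('n) + 1))"
proof -
  have dp: "0 < den y x" if "x \<in> K" for x using den_pos[of x y] that K by auto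
  have conj: "sort_coords (hmap y (unsort_coords z)) = hmap (sort_coords y) z" for z
  proof -
    have "hyp (sort_coords y) = hyp y" by (simp add: hyp_def inner_sort)
    moreover have "sort_coords y \<bullet> z = y \<bullet> unsort_coords z"
      using inner_sort[of y "unsort_coords z"] by simp
    ultimately show ?thesis
      by (simp add: hmap_def stretch_def den_def linear_sort linear_add linear_diff linear_scale)
  qed
  have den: "den (sort_coords y) (sort_coords x) = den y x" for x
    by (simp add: den_def hyp_def inner_sort)
  have "(LINT x:hmap y ` K|lborel. g x) = (LINT x:K|lborel. (1 / den y x ^ (CARD('n) + 1)) * g (hmap y x))"
  proof (rule change_of_variables_sorted[OF K(1)])
    fix z assume "z \<in> sort_coords ` K"
    then have z: "norm z \<le> 1" using K by auto
    show "((\<lambda>z. sort_coords (hmap y (unsort_coords z))) has_derivative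
       (\<lambda>z v. (v + (sort_coords y \<bullet> v) *\<^sub>R (sort_coords y /\<^sub>R (1 + hyp (sort_coords y)) + hmap (sort_coords y) z))
          /\<^sub>R den (sort_coords y) z) z) (at z within sort_coords ` K)"
      unfolding conj by (rule hmap_has_derivative[OF z])
  next
    fix x assume x: "x \<in> K"
    then have n: "norm (sort_coords x) \<le> 1" using K by auto
    show "\<bar>det (matrix (\<lambda>v. (v + (sort_coords y \<bullet> v) *\<^sub>R
        (sort_coords y /\<^sub>R (1 + hyp (sort_coords y)) + hmap (sort_coords y) (sort_coords x)))
          /\<^sub>R den (sort_coords y) (sort_coords x)))\<bar> = 1 / den y x ^ (CARD('n) + 1)"
      using det_hmap_derivative[OF n, of "sort_coords y"] dp[OF x]
      unfolding den card_ordered_index by simp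
  next
    show "inj_on (hmap y) K" by (rule inj_on_subset[OF inj_on_hmap K(2)])
    show "continuous_on K (\<lambda>x. 1 / den y x ^ (CARD('n) + 1))"
      using dp by (intro continuous_intros continuous_on_den) force
  qed (use g continuous_on_hmap[OF K(2)] in auto)
  then show ?thesis by simp
qed

lemma set_integral_orthogonal:
  fixes U :: "real ^ 'n::finite \<Rightarrow> real ^ 'n" and g :: "real ^ 'n \<Rightarrow> real"
  assumes U: "orthogonal_transformation U" and K: "compact K" and g: "continuous_on (U ` K) g"
  shows "(LINT x:U ` K|lborel. g x) = (LINT x:K|lborel. g (U x))"
proof -
  let ?G = "\<lambda>z. sort_coords (U (unsort_coords z))"
  have lU: "linear U" using U by (simp add: orthogonal_transformation_def)
  have lin: "linear ?G"
    using linear_compose[OF linear_compose[OF linear_sort(2) lU] linear_sort(1)] by (simp add: o_def)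
  have "norm (?G z) = norm z" for z
    using norm_sort[of "unsort_coords z"] U by (simp add: orthogonal_transformation)
  then have "orthogonal_transformation ?G" using lin by (simp add: orthogonal_transformation)
  then have "orthogonal_matrix (matrix ?G)"
    using orthogonal_transformation_matrix by blast
  then have det: "\<bar>det (matrix ?G)\<bar> = 1"
    using det_orthogonal_matrix by fastforce
  have "(LINT x:U ` K|lborel. g x) = (LINT x:K|lborel. 1 * g (U x))"
  proof (rule change_of_variables_sorted[OF K])
    show "(?G has_derivative (\<lambda>_. ?G) z) (at z within sort_coords ` K)" for z
      by (rule linear_imp_has_derivative[OF lin])
    show "inj_on U K" by (rule inj_on_subset[OF orthogonal_transformation_inj[OF U]]) simp
    show "continuous_on K U" using lU by (simp add: linear_continuous_on linear_conv_bounded_linear)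
  qed (use det g in auto)
  then show ?thesis by simp
qed

section \<open>Integrals of continuous functions over compact sets\<close>

lemma set_integral_const: "(LINT x:K|lborel. c) = c * measure lborel (K :: 'a::euclidean_space set)" for c :: real
  by (simp add: set_lebesgue_integral_def)

lemma set_integrable_compact:
  fixes f :: "'a::euclidean_space \<Rightarrow> real"
  shows "compact K \<Longrightarrow> continuous_on K f \<Longrightarrow> set_integrable lborel K f"
  using borel_integrable_compact[of K f] by (simp add: set_integrable_def)

lemma set_integral_mono_compact:
  fixes f g :: "'a::euclidean_space \<Rightarrow> real"
  assumes "compact K" "continuous_on K f" "continuous_on K g" "\<And>x. x \<in> K \<Longrightarrow> f x \<le> g x"
  shows "(LINT x:K|lborel. f x) \<le> (LINT x:K|lborel. g x)"
  using assms by (intro set_integral_mono set_integrable_compact)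

lemma set_integral_pos_compact:
  fixes f :: "'a::euclidean_space \<Rightarrow> real"
  assumes K: "compact K" "0 < measure lborel K" and f: "continuous_on K f" "\<And>x. x \<in> K \<Longrightarrow> 0 < f x"
  shows "0 < (LINT x:K|lborel. f x)"
proof -
  have "K \<noteq> {}" using K(2) by auto
  then obtain z where z: "z \<in> K" "\<And>x. x \<in> K \<Longrightarrow> f z \<le> f x"
    using continuous_attains_inf[OF K(1) _ f(1)] by blast
  have "0 < f z * measure lborel K" using f(2)[OF z(1)] K(2) by simp
  also have "\<dots> = (LINT x:K|lborel. f z)" by (simp add: set_integral_const)
  also have "\<dots> \<le> (LINT x:K|lborel. f x)"
    by (rule set_integral_mono_compact) (use K f z in auto)
  finally show ?thesis .
qed

section \<open>Second moments of bodies of small width\<close>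

text \<open>Boosts are hyperbolic isometries: the factors by which they change \<open>1 - p \<bullet> x\<close> split into one depending on \<open>p\<close> and
one depending on \<open>x\<close>, and both cancel in a cross-ratio.\<close>

lemma cr_bounded_hmap:
  assumes K: "cr_bounded C K" "K \<subseteq> ball 0 1"
  shows "cr_bounded C (hmap y ` K)"
  unfolding cr_bounded_def
proof (clarify)
  fix p q x x' :: 'a assume p: "norm p = 1" and q: "norm q = 1" and x: "x \<in> K" "x' \<in> K"
  have n: "norm x \<le> 1" "norm x' \<le> 1" using x K(2) by auto
  define a b where "a = den (- y) p / den y x" and "b = den (- y) q / den y x'"
  define a' b' where "a' = den (- y) q / den y x" and "b' = den (- y) p / den y x'"
  have pos: "0 < den (- y) p" "0 < den (- y) q" "0 < den y x" "0 < den y x'"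
    using den_pos[of p "- y"] den_pos[of q "- y"] den_pos[of x y] den_pos[of x' y] p q n by auto
  have ab: "a' * b' = a * b" "0 \<le> a * b" using pos by (auto simp: a_def b_def a'_def b'_def)
  have eqs: "1 - p \<bullet> hmap y x = a * (1 - hmap (- y) p \<bullet> x)" "1 - q \<bullet> hmap y x' = b * (1 - hmap (- y) q \<bullet> x')"
    "1 - q \<bullet> hmap y x = a' * (1 - hmap (- y) q \<bullet> x)" "1 - p \<bullet> hmap y x' = b' * (1 - hmap (- y) p \<bullet> x')"
    by (simp_all add: one_minus_inner_hmap n p q a_def b_def a'_def b'_def)
  have "(1 - hmap (- y) p \<bullet> x) * (1 - hmap (- y) q \<bullet> x')
      \<le> C * ((1 - hmap (- y) q \<bullet> x) * (1 - hmap (- y) p \<bullet> x'))"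
    using K(1) x norm_hmap_cases(3)[OF p] norm_hmap_cases(3)[OF q] by (auto simp: cr_bounded_def)
  then have "a * b * ((1 - hmap (- y) p \<bullet> x) * (1 - hmap (- y) q \<bullet> x'))
      \<le> a * b * (C * ((1 - hmap (- y) q \<bullet> x) * (1 - hmap (- y) p \<bullet> x')))"
    using ab(2) by (rule mult_left_mono)
  also have "\<dots> = C * ((a' * (1 - hmap (- y) q \<bullet> x)) * (b' * (1 - hmap (- y) p \<bullet> x')))"
    unfolding ab(1)[symmetric] by (simp only: mult_ac)
  finally show "(1 - p \<bullet> hmap y x) * (1 - q \<bullet> hmap y x') \<le> C * ((1 - q \<bullet> hmap y x) * (1 - p \<bullet> hmap y x'))"
    unfolding eqs by (simp only: mult_ac)
qed

lemma cr_bounded_orthogonal: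
  fixes U :: "'a::euclidean_space \<Rightarrow> 'a"
  assumes K: "cr_bounded C K" and U: "orthogonal_transformation U"
  shows "cr_bounded C (U ` K)"
  unfolding cr_bounded_def
proof (clarify)
  fix p q x x' :: 'a assume p: "norm p = 1" and q: "norm q = 1" and x: "x \<in> K" "x' \<in> K"
  obtain p' q' where pq: "p = U p'" "q = U q'"
    using surjD[OF orthogonal_transformation_surj[OF U], of p] surjD[OF orthogonal_transformation_surj[OF U], of q] by auto
  have inner: "U v \<bullet> U w = v \<bullet> w" for v w using U by (simp add: orthogonal_transformation_def)
  have "norm p' = 1" "norm q' = 1" using p q pq U by (auto simp: orthogonal_transformation_norm)
  then show "(1 - p \<bullet> U x) * (1 - q \<bullet> U x') \<le> C * ((1 - q \<bullet> U x) * (1 - p \<bullet> U x'))"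
    using K x unfolding cr_bounded_def pq inner by blast
qed

text \<open>The half-length \<open>s\<close> for which a uniform distribution on \<open>[-s, s]\<close> has variance \<open>1/(d + 2)\<close>; the width bound is
the hyperbolic distance between \<open>-s u\<close> and \<open>s u\<close> for a unit vector \<open>u\<close>.\<close>

definition critical_radius :: "nat \<Rightarrow> real" where "critical_radius d = sqrt (3 / (real d + 2))"

lemma critical_radius_bounds: "2 \<le> d \<Longrightarrow> 0 < critical_radius d" "2 \<le> d \<Longrightarrow> critical_radius d < 1" "(critical_radius d)\<^sup>2 = 3 / (real d + 2)"
  by (auto simp: critical_radius_def)

text \<open>The bounds on \<open>K\<close> in the direction \<open>e\<close> are two parallel hyperplanes, and their cross-ratio with the tangent
hyperplanes orthogonal to \<open>e\<close> is smaller than that of the slab of half-width \<open>s\<close> around the origin. Since moving a slab off the center increases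
the cross-ratio, the half-width of \<open>K\<close> is smaller than \<open>s\<close>.\<close>

lemma second_moment_less:
  fixes K :: "'a::euclidean_space set"
  assumes d: "2 \<le> DIM('a)" and K: "compact K" "convex K" "K \<subseteq> ball 0 1" "0 < measure lborel K"
    and C: "cr_bounded C K" "C < ((1 + critical_radius DIM('a)) / (1 - critical_radius DIM('a)))\<^sup>2" and e: "norm e = 1"
    and mean: "(LINT x:K|lborel. e \<bullet> x) = 0"
  shows "(real DIM('a) + 2) * (LINT x:K|lborel. (e \<bullet> x)\<^sup>2) < measure lborel K"
proof -
  define s where "s = critical_radius DIM('a)"
  have s: "0 < s" "s < 1" "s\<^sup>2 = 3 / (real DIM('a) + 2)" using critical_radius_bounds(1,2)[OF d] critical_radius_bounds(3) by (auto simp: s_def)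
  have ne: "K \<noteq> {}" using K(4) by auto
  have cont: "continuous_on K (\<lambda>x. e \<bullet> x)" by (intro continuous_intros)
  obtain xa where xa: "xa \<in> K" "\<And>x. x \<in> K \<Longrightarrow> e \<bullet> xa \<le> e \<bullet> x"
    using continuous_attains_inf[OF K(1) ne cont] by blast
  obtain xb where xb: "xb \<in> K" "\<And>x. x \<in> K \<Longrightarrow> e \<bullet> x \<le> e \<bullet> xb"
    using continuous_attains_sup[OF K(1) ne cont] by blast
  define a b where "a = e \<bullet> xa" and "b = e \<bullet> xb"
  have lt1: "\<bar>e \<bullet> x\<bar> < 1" if "x \<in> K" for x
    using Cauchy_Schwarz_ineq2[of e x] e K(3) that by auto
  have ab1: "-1 < a" "a \<le> b" "b < 1"
    using lt1[OF xa(1)] lt1[OF xb(1)] xa(2)[OF xb(1)] by (auto simp: a_def b_def)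
  define h c where "h = (b - a) / 2" and "c = (a + b) / 2"
  have h: "0 \<le> h" "h < s"
  proof -
    show "0 \<le> h" using ab1 by (simp add: h_def)
    show "h < s"
    proof (rule ccontr)
      assume "\<not> h < s"
      define \<sigma> where "\<sigma> = (1 + s) / (1 - s)"
      have \<sigma>: "1 < \<sigma>" using s by (simp add: \<sigma>_def)
      have pos: "0 < (1 - h)\<^sup>2 - c\<^sup>2"
      proof -
        have "(1 - h)\<^sup>2 - c\<^sup>2 = (1 - b) * (1 + a)"
          by (simp add: h_def c_def power2_eq_square field_simps)
        then show ?thesis using ab1 by simp
      qed
      have "(1 - (- e) \<bullet> xb) * (1 - e \<bullet> xa) \<le> C * ((1 - e \<bullet> xb) * (1 - (- e) \<bullet> xa))"
        using C(1) e xa(1) xb(1) unfolding cr_bounded_def by (metis norm_minus_cancel)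
      then have "(1 + b) * (1 - a) \<le> C * ((1 - b) * (1 + a))" by (simp add: a_def b_def)
      then have "(1 + h)\<^sup>2 - c\<^sup>2 \<le> C * ((1 - h)\<^sup>2 - c\<^sup>2)"
        by (simp add: h_def c_def power2_eq_square field_simps)
      also have "\<dots> < \<sigma>\<^sup>2 * ((1 - h)\<^sup>2 - c\<^sup>2)"
        using C(2) pos by (simp add: \<sigma>_def s_def)
      finally have 1: "(1 + h)\<^sup>2 - c\<^sup>2 < \<sigma>\<^sup>2 * (1 - h)\<^sup>2 - \<sigma>\<^sup>2 * c\<^sup>2" by (simp add: algebra_simps)
      have "h < 1" using ab1 by (simp add: h_def)
      moreover have "(1 - h) * (1 + s) \<le> (1 + h) * (1 - s)" using \<open>\<not> h < s\<close> by (simp add: algebra_simps)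
      ultimately have "\<sigma> * (1 - h) \<le> 1 + h"
        using s by (simp add: \<sigma>_def pos_divide_le_eq mult.commute)
      then have "(\<sigma> * (1 - h))\<^sup>2 \<le> (1 + h)\<^sup>2"
        using \<sigma> \<open>h < 1\<close> by (intro power_mono) auto
      then have "\<sigma>\<^sup>2 * (1 - h)\<^sup>2 \<le> (1 + h)\<^sup>2" by (simp add: power_mult_distrib)
      then have "\<sigma>\<^sup>2 * c\<^sup>2 < c\<^sup>2" using 1 by simp
      moreover have "1 * c\<^sup>2 \<le> \<sigma>\<^sup>2 * c\<^sup>2" using \<sigma> by (intro mult_right_mono) auto
      ultimately show False by simp
    qed
  qed
  show ?thesis
  proof (cases "a < b")
    case True
    have "(LINT x:K|lborel. (e \<bullet> x)\<^sup>2) \<le> (b - a)\<^sup>2 / 12 * measure lborel K"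
      by (rule convex_second_moment_le[OF K(1,2) e _ True mean]) (use xa xb in \<open>auto simp: a_def b_def\<close>)
    also have "\<dots> = h\<^sup>2 / 3 * measure lborel K" by (simp add: h_def power_divide)
    also have "\<dots> < s\<^sup>2 / 3 * measure lborel K"
      using h K(4) by (intro mult_strict_right_mono divide_strict_right_mono power_strict_mono) auto
    also have "\<dots> = measure lborel K / (real DIM('a) + 2)" by (simp add: s(3) field_simps)
    finally show ?thesis by (simp add: pos_less_divide_eq mult.commute)
  next
    case False
    then have const: "e \<bullet> x = a" if "x \<in> K" for x
      using xa(2)[OF that] xb(2)[OF that] ab1 by (simp add: a_def b_def)
    have "(LINT x:K|lborel. e \<bullet> x) = (LINT x:K|lborel. a)"
      using K(1) const by (intro set_lebesgue_integral_cong) (auto simp: borel_compact)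
    then have "a = 0" using mean K by (simp add: set_lebesgue_integral_def)
    then have "(LINT x:K|lborel. (e \<bullet> x)\<^sup>2) = (LINT x:K|lborel. 0)"
      using K(1) const by (intro set_lebesgue_integral_cong) (auto simp: borel_compact)
    then show ?thesis using K(4) by (simp add: set_lebesgue_integral_def)
  qed
qed

section \<open>Moments along a geodesic\<close>

text \<open>Differentiation under the integral sign. The difference quotients converge uniformly by the mean value
theorem and the uniform continuity of \<open>f'\<close> on compact sets.\<close>

lemma has_derivative_set_integral_compact:
  fixes f f' :: "real \<Rightarrow> 'a::euclidean_space \<Rightarrow> real"
  assumes K: "compact K"
    and f: "\<And>t x. x \<in> K \<Longrightarrow> ((\<lambda>t. f t x) has_real_derivative f' t x) (at t)"
    and fc: "\<And>t. continuous_on K (f t)"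
    and f'c: "continuous_on (UNIV \<times> K) (\<lambda>(t, x). f' t x)"
  shows "((\<lambda>t. LINT x:K|lborel. f t x) has_real_derivative (LINT x:K|lborel. f' t x)) (at t)"
proof -
  define m where "m = measure lborel K"
  have m: "0 \<le> m" by (simp add: m_def)
  have f'ct: "continuous_on K (f' s)" for s
    using continuous_on_compose2[OF f'c, of K "\<lambda>x. (s, x)"] by (simp add: continuous_intros image_subset_iff)
  have "\<exists>d>0. \<forall>s. norm (s - t) < d \<longrightarrow>
      norm ((LINT x:K|lborel. f s x) - (LINT x:K|lborel. f t x) - (LINT x:K|lborel. f' t x) * (s - t)) \<le> e * norm (s - t)"
    if e: "0 < e" for e
  proof -
    define \<epsilon> where "\<epsilon> = e / (m + 1)"
    have \<epsilon>: "0 < \<epsilon>" "\<epsilon> * m \<le> e" using e m by (auto simp: \<epsilon>_def field_simps)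
    have "uniformly_continuous_on (cball t 1 \<times> K) (\<lambda>(t, x). f' t x)"
      by (intro compact_uniformly_continuous compact_Times K compact_cball continuous_on_subset[OF f'c]) auto
    then obtain d where d: "0 < d" "\<And>z z'. z \<in> cball t 1 \<times> K \<Longrightarrow> z' \<in> cball t 1 \<times> K \<Longrightarrow> dist z' z < d \<Longrightarrow>
        dist ((\<lambda>(t, x). f' t x) z') ((\<lambda>(t, x). f' t x) z) < \<epsilon>"
      using \<epsilon>(1) unfolding uniformly_continuous_on_def by metis
    have "norm ((LINT x:K|lborel. f s x) - (LINT x:K|lborel. f t x) - (LINT x:K|lborel. f' t x) * (s - t)) \<le> e * norm (s - t)"
      if s: "norm (s - t) < min d 1" for s
    proof -
      have pt: "\<bar>f s x - f t x - f' t x * (s - t)\<bar> \<le> \<epsilon> * \<bar>s - t\<bar>" if x: "x \<in> K" for x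
      proof -
        obtain z where z: "\<bar>z - t\<bar> \<le> \<bar>s - t\<bar>" "f s x - f t x = (s - t) * f' z x"
        proof (cases t s rule: linorder_cases)
          case less
          obtain z where "t < z" "z < s" "f s x - f t x = (s - t) * f' z x"
            using MVT2[OF less, of "\<lambda>t. f t x" "\<lambda>t. f' t x"] f[OF x] by blast
          then show thesis by (intro that[of z]) auto
        next
          case equal
          then show thesis by (intro that[of t]) auto
        next
          case greater
          obtain z where "s < z" "z < t" "f t x - f s x = (t - s) * f' z x"
            using MVT2[OF greater, of "\<lambda>t. f t x" "\<lambda>t. f' t x"] f[OF x] by blast
          then show thesis by (intro that[of z]) (auto simp: algebra_simps)
        qed
        have "dist (f' z x) (f' t x) < \<epsilon>"
          using d(2)[of "(t, x)" "(z, x)"] z(1) s x by (auto simp: dist_Pair_Pair dist_real_def)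
        then have "\<bar>s - t\<bar> * \<bar>f' z x - f' t x\<bar> \<le> \<bar>s - t\<bar> * \<epsilon>"
          by (intro mult_left_mono) (auto simp: dist_real_def)
        moreover have "f s x - f t x - f' t x * (s - t) = (s - t) * (f' z x - f' t x)"
          unfolding z(2) by (simp add: algebra_simps)
        ultimately show ?thesis by (simp add: abs_mult mult.commute)
      qed
      have ic: "continuous_on K (\<lambda>x. f s x - f t x - f' t x * (s - t))"
        by (intro continuous_intros fc f'ct)
      have "(LINT x:K|lborel. f s x) - (LINT x:K|lborel. f t x) - (LINT x:K|lborel. f' t x) * (s - t)
        = (LINT x:K|lborel. f s x - f t x - f' t x * (s - t))"
        using set_integrable_compact[OF K fc] set_integrable_compact[OF K f'ct]
        by (simp add: set_integral_diff set_integral_mult_left)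
      also have "\<bar>\<dots>\<bar> \<le> \<epsilon> * \<bar>s - t\<bar> * m"
      proof -
        have const: "(LINT x:K|lborel. k) = k * m" for k :: real
          by (simp add: set_lebesgue_integral_def m_def)
        have "(LINT x:K|lborel. f s x - f t x - f' t x * (s - t)) \<le> (LINT x:K|lborel. \<epsilon> * \<bar>s - t\<bar>)"
          using pt by (intro set_integral_mono_compact K ic continuous_intros) (auto simp: abs_le_iff)
        moreover have "(LINT x:K|lborel. - (\<epsilon> * \<bar>s - t\<bar>)) \<le> (LINT x:K|lborel. f s x - f t x - f' t x * (s - t))"
          using pt by (intro set_integral_mono_compact K ic continuous_intros) (force simp: abs_le_iff)
        ultimately show ?thesis unfolding const by (simp add: abs_le_iff)
      qed
      also have "\<dots> \<le> e * \<bar>s - t\<bar>"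
        using mult_right_mono[OF \<epsilon>(2), of "\<bar>s - t\<bar>"] by (simp add: mult_ac)
      finally show ?thesis by simp
    qed
    then show ?thesis using d(1) by (intro exI[of _ "min d 1"]) auto
  qed
  then show ?thesis
    unfolding has_field_derivative_def has_derivative_at_alt
    by (auto simp: bounded_linear_mult_right)
qed

text \<open>Between two zeros at which \<open>h\<close> decreases it would have to increase through a zero.\<close>

lemma no_two_descending_zeros:
  fixes h h' :: "real \<Rightarrow> real"
  assumes h: "\<And>t. (h has_real_derivative h' t) (at t)" and neg: "\<And>t. h t = 0 \<Longrightarrow> h' t < 0"
    and z: "h 0 = 0" "h \<tau> = 0" "0 < \<tau>"
  shows False
proof -
  have cont: "continuous_on S h" for S using h by (meson DERIV_isCont continuous_at_imp_continuous_on)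
  obtain d1 where d1: "0 < d1" "\<And>k. 0 < k \<Longrightarrow> k < d1 \<Longrightarrow> h (0 + k) < h 0"
    using DERIV_neg_dec_right[OF h neg[OF z(1)]] by blast
  obtain d2 where d2: "0 < d2" "\<And>k. 0 < k \<Longrightarrow> k < d2 \<Longrightarrow> h \<tau> < h (\<tau> - k)"
    using DERIV_neg_dec_left[OF h neg[OF z(2)]] by blast
  define k where "k = min (min (d1 / 2) (d2 / 2)) (\<tau> / 3)"
  have k: "0 < k" "k < d1" "k < d2" "k < \<tau> - k" using d1(1) d2(1) z(3) by (auto simp: k_def)
  have ha: "h k < 0" and hb: "0 < h (\<tau> - k)" using d1(2)[OF k(1,2)] d2(2)[OF k(1,3)] z by auto
  define Z where "Z = {k..\<tau> - k} \<inter> h -` {0}"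
  have "closed Z" unfolding Z_def by (intro continuous_closed_preimage cont) auto
  then have "compact Z" unfolding Z_def by (metis Int_lower1 bounded_closed_interval bounded_subset compact_eq_bounded_closed)
  moreover have "Z \<noteq> {}"
    using IVT'[of h k 0 "\<tau> - k"] ha hb k cont by (force simp: Z_def)
  ultimately obtain c where c: "c \<in> Z" "\<And>t. t \<in> Z \<Longrightarrow> t \<le> c" using compact_attains_sup by metis
  have hc: "h c = 0" "k \<le> c" "c \<le> \<tau> - k" using c(1) by (auto simp: Z_def)
  have cb: "c < \<tau> - k" using hc hb by (cases "c = \<tau> - k") auto
  obtain d3 where d3: "0 < d3" "\<And>r. 0 < r \<Longrightarrow> r < d3 \<Longrightarrow> h (c + r) < h c"
    using DERIV_neg_dec_right[OF h neg[OF hc(1)]] by blast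
  define r where "r = min (d3 / 2) ((\<tau> - k - c) / 2)"
  have r: "0 < r" "r < d3" "c + r < \<tau> - k" using d3(1) cb by (auto simp: r_def min_def field_simps)
  have "h (c + r) < 0" using d3(2)[OF r(1,2)] hc by simp
  then obtain t where "c + r \<le> t" "t \<le> \<tau> - k" "h t = 0"
    using IVT'[of h "c + r" 0 "\<tau> - k"] hb r cont by auto
  then have "t \<in> Z" "c < t" using r hc by (auto simp: Z_def)
  then show False using c(2) by fastforce
qed

lemma hyp_ray:
  assumes "norm u = 1" shows "hyp (sinh t *\<^sub>R u) = cosh t"
proof -
  have "u \<bullet> u = 1" using assms by (simp add: norm_eq_1)
  moreover have "1 + sinh t * sinh t = (cosh t)\<^sup>2"
    using cosh_square_eq[of t] by (simp add: power2_eq_square)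
  ultimately show ?thesis by (simp add: hyp_def)
qed

lemma den_ray: "norm u = 1 \<Longrightarrow> den (sinh t *\<^sub>R u) x = cosh t - sinh t * (u \<bullet> x)"
  by (simp add: den_def hyp_ray)

lemma inner_hmap_ray:
  assumes u: "norm u = 1"
  shows "u \<bullet> hmap (sinh t *\<^sub>R u) x = ((u \<bullet> x) * cosh t - sinh t) / den (sinh t *\<^sub>R u) x"
proof -
  have uu: "u \<bullet> u = 1" using u by (simp add: norm_eq_1)
  have nz: "1 + cosh t \<noteq> 0" using cosh_real_ge_1[of t] by linarith
  have "sinh t * sinh t = (cosh t - 1) * (1 + cosh t)"
    using sinh_square_eq[of t] by (simp add: power2_eq_square algebra_simps)
  then have ss: "sinh t * sinh t / (1 + cosh t) = cosh t - 1" using nz by simp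
  have "u \<bullet> stretch (sinh t *\<^sub>R u) x = u \<bullet> x + (u \<bullet> x) * (sinh t * sinh t / (1 + cosh t))"
    by (simp add: stretch_def hyp_ray[OF u] inner_add_right uu)
  also have "\<dots> = (u \<bullet> x) * cosh t" unfolding ss by (simp add: algebra_simps)
  finally show ?thesis by (simp add: hmap_def inner_diff_right uu divide_inverse mult.commute)
qed

text \<open>For \<open>n = d + 1\<close> this is the integral of \<open>u \<bullet> x\<close> over the image of \<open>K\<close> under the boost by \<open>sinh t *\<^sub>R u\<close>, the point
at distance \<open>t\<close> from the origin on the geodesic in the direction \<open>u\<close>.\<close>

definition ray_moment :: "nat \<Rightarrow> 'a::euclidean_space \<Rightarrow> 'a set \<Rightarrow> real \<Rightarrow> real" where
  "ray_moment n u K t = (LINT x:K|lborel. ((u \<bullet> x) * cosh t - sinh t) / den (sinh t *\<^sub>R u) x ^ Suc n)"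

text \<open>For \<open>n = d + 1\<close> these are the first and, up to the factor \<open>n\<close>, the second variation of the volume of the boosted body.\<close>

lemma ray_derivatives:
  fixes K :: "'a::euclidean_space set"
  assumes K: "compact K" "K \<subseteq> ball 0 1" and u: "norm u = 1"
  shows "((\<lambda>t. LINT x:K|lborel. 1 / den (sinh t *\<^sub>R u) x ^ n) has_real_derivative
      real n * ray_moment n u K t) (at t)"
    and "(ray_moment n u K has_real_derivative
      (LINT x:K|lborel. (real (Suc n) * (u \<bullet> hmap (sinh t *\<^sub>R u) x)\<^sup>2 - 1) / den (sinh t *\<^sub>R u) x ^ n)) (at t)"
proof -
  have dp: "0 < cosh t - sinh t * (u \<bullet> x)" if "x \<in> K" for x t
  proof -
    have "norm x \<le> 1" using that K(2) by auto
    then show ?thesis using den_pos[of x "sinh t *\<^sub>R u"] by (simp add: den_ray[OF u])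
  qed
  have ne: "cosh t - sinh t * (u \<bullet> x) \<noteq> 0" if "x \<in> K" for x t using dp[OF that, of t] by simp
  have sq: "((u \<bullet> x) * cosh t - sinh t) * ((u \<bullet> x) * cosh t - sinh t) / (D * D) = (u \<bullet> hmap (sinh t *\<^sub>R u) x)\<^sup>2"
    if "D = cosh t - sinh t * (u \<bullet> x)" for D x t
    using that by (simp add: inner_hmap_ray[OF u] den_ray[OF u] power2_eq_square)
  have "((\<lambda>t. LINT x:K|lborel. 1 / (cosh t - sinh t * (u \<bullet> x)) ^ n) has_real_derivative
      (LINT x:K|lborel. real n * (((u \<bullet> x) * cosh t - sinh t) / (cosh t - sinh t * (u \<bullet> x)) ^ Suc n))) (at t)"
  proof (rule has_derivative_set_integral_compact[OF K(1)])
    fix t x assume x: "x \<in> K"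
    define D where "D = cosh t - sinh t * (u \<bullet> x)"
    have D: "0 < D" using dp[OF x] by (simp add: D_def)
    have "((\<lambda>t. (cosh t - sinh t * (u \<bullet> x)) powi (- int n)) has_real_derivative
       of_int (- int n) * D powi (- int n - 1) * (sinh t - cosh t * (u \<bullet> x))) (at t)"
      unfolding D_def using ne[OF x, of t] by (auto intro!: derivative_eq_intros)
    moreover have "of_int (- int n) * D powi (- int n - 1) * (sinh t - cosh t * (u \<bullet> x))
       = real n * (((u \<bullet> x) * cosh t - sinh t) / D ^ Suc n)"
    proof -
      have "- int n - 1 = - int (Suc n)" by simp
      then have "D powi (- int n - 1) = inverse (D ^ Suc n)" by (simp only: power_int_minus power_int_of_nat)
      then show ?thesis by (simp add: divide_inverse algebra_simps del: power_Suc)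
    qed
    moreover have "(\<lambda>t. (cosh t - sinh t * (u \<bullet> x)) powi (- int n)) = (\<lambda>t. 1 / (cosh t - sinh t * (u \<bullet> x)) ^ n)"
      by (simp add: power_int_minus divide_inverse)
    ultimately show "((\<lambda>t. 1 / (cosh t - sinh t * (u \<bullet> x)) ^ n) has_real_derivative
        real n * (((u \<bullet> x) * cosh t - sinh t) / (cosh t - sinh t * (u \<bullet> x)) ^ Suc n)) (at t)"
      by (simp add: D_def)
  next
    show "continuous_on K (\<lambda>x. 1 / (cosh t - sinh t * (u \<bullet> x)) ^ n)" for t
      using ne by (intro continuous_intros) auto
    show "continuous_on (UNIV \<times> K) (\<lambda>(t, x). real n * (((u \<bullet> x) * cosh t - sinh t) / (cosh t - sinh t * (u \<bullet> x)) ^ Suc n))"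
      unfolding case_prod_beta using ne by (intro continuous_intros) auto
  qed
  then show "((\<lambda>t. LINT x:K|lborel. 1 / den (sinh t *\<^sub>R u) x ^ n) has_real_derivative
      real n * ray_moment n u K t) (at t)"
    unfolding ray_moment_def den_ray[OF u] set_integral_mult_right .
  have "((\<lambda>t. LINT x:K|lborel. ((u \<bullet> x) * cosh t - sinh t) / (cosh t - sinh t * (u \<bullet> x)) ^ Suc n) has_real_derivative
      (LINT x:K|lborel. (real (Suc n) * (((u \<bullet> x) * cosh t - sinh t) / (cosh t - sinh t * (u \<bullet> x)))\<^sup>2 - 1)
         / (cosh t - sinh t * (u \<bullet> x)) ^ n)) (at t)"
  proof (rule has_derivative_set_integral_compact[OF K(1)])
    fix t x assume x: "x \<in> K"
    define D N where "D = cosh t - sinh t * (u \<bullet> x)" and "N = (u \<bullet> x) * cosh t - sinh t"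
    have D: "0 < D" using dp[OF x] by (simp add: D_def)
    have "((\<lambda>t. ((u \<bullet> x) * cosh t - sinh t) / (cosh t - sinh t * (u \<bullet> x)) ^ Suc n) has_real_derivative
       (((u \<bullet> x) * sinh t - cosh t) * D ^ Suc n - N * (real (Suc n) * D ^ n * (sinh t - cosh t * (u \<bullet> x))))
         / (D ^ Suc n * D ^ Suc n)) (at t)"
      unfolding D_def N_def using ne[OF x, of t]
      by (intro DERIV_divide) (auto intro!: derivative_eq_intros simp del: power_Suc)
    also have "(((u \<bullet> x) * sinh t - cosh t) * D ^ Suc n - N * (real (Suc n) * D ^ n * (sinh t - cosh t * (u \<bullet> x))))
        = D ^ n * (real (Suc n) * N\<^sup>2 - D\<^sup>2)"
    proof -
      have 1: "(u \<bullet> x) * sinh t - cosh t = - D" "sinh t - cosh t * (u \<bullet> x) = - N"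
        by (simp_all add: D_def N_def mult.commute)
      show ?thesis unfolding 1 by (simp add: power2_eq_square algebra_simps)
    qed
    also have "D ^ n * (real (Suc n) * N\<^sup>2 - D\<^sup>2) / (D ^ Suc n * D ^ Suc n) = (real (Suc n) * (N / D)\<^sup>2 - 1) / D ^ n"
      using D by (simp add: field_simps power2_eq_square)
    finally show "((\<lambda>t. ((u \<bullet> x) * cosh t - sinh t) / (cosh t - sinh t * (u \<bullet> x)) ^ Suc n) has_real_derivative
      (real (Suc n) * (((u \<bullet> x) * cosh t - sinh t) / (cosh t - sinh t * (u \<bullet> x)))\<^sup>2 - 1)
         / (cosh t - sinh t * (u \<bullet> x)) ^ n) (at t)"
      by (simp only: D_def N_def)
  next
    show "continuous_on K (\<lambda>x. ((u \<bullet> x) * cosh t - sinh t) / (cosh t - sinh t * (u \<bullet> x)) ^ Suc n)" for t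
      using ne by (intro continuous_intros) auto
    show "continuous_on (UNIV \<times> K) (\<lambda>(t, x). (real (Suc n) * (((u \<bullet> x) * cosh t - sinh t) / (cosh t - sinh t * (u \<bullet> x)))\<^sup>2 - 1)
         / (cosh t - sinh t * (u \<bullet> x)) ^ n)"
      unfolding case_prod_beta using ne by (intro continuous_intros) auto
  qed
  then show "(ray_moment n u K has_real_derivative
      (LINT x:K|lborel. (real (Suc n) * (u \<bullet> hmap (sinh t *\<^sub>R u) x)\<^sup>2 - 1) / den (sinh t *\<^sub>R u) x ^ n)) (at t)"
    unfolding ray_moment_def[abs_def] inner_hmap_ray[OF u] den_ray[OF u] .
qed

section \<open>Uniqueness of the centering point\<close>

text \<open>Along the geodesic from the origin to \<open>z\<close> the moment in the direction of the geodesic would vanish at both ends, while it decreases at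
each zero by \<open>second_moment_less\<close>, applied to the boosted body.\<close>

lemma centered_at_unique_point:
  fixes K :: "(real ^ 'n) set" and z :: "real ^ 'n"
  assumes d: "2 \<le> CARD('n)" and K: "compact K" "convex K" "K \<subseteq> ball 0 1" "0 < measure lborel K"
    and C: "cr_bounded C K" "C < ((1 + critical_radius CARD('n)) / (1 - critical_radius CARD('n)))\<^sup>2"
    and mean: "\<And>e. (LINT x:K|lborel. e \<bullet> x) = 0" "\<And>e. (LINT x:hmap z ` K|lborel. e \<bullet> x) = 0"
  shows "z = 0"
proof (rule ccontr)
  assume z: "z \<noteq> 0"
  define u where "u = z /\<^sub>R norm z"
  define \<tau> where "\<tau> = arsinh (norm z)"
  have u: "norm u = 1" using z by (simp add: u_def)
  have \<tau>: "0 < \<tau>" "sinh \<tau> *\<^sub>R u = z" using z by (simp_all add: \<tau>_def u_def)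
  define n where "n = CARD('n) + 1"
  let ?K = "\<lambda>t. hmap (sinh t *\<^sub>R u) ` K"
  have Kc: "K \<subseteq> cball 0 1" using K(3) by auto
  have dp: "0 < den y x" if "x \<in> K" for x y using den_pos[of x y] that Kc by auto
  have Kt: "compact (?K t)" "convex (?K t)" "?K t \<subseteq> ball 0 1" "cr_bounded C (?K t)" for t
  proof -
    show "compact (?K t)" by (rule compact_continuous_image[OF continuous_on_hmap[OF Kc] K(1)])
    show "convex (?K t)" by (rule convex_hmap_image[OF K(2) Kc])
    show "?K t \<subseteq> ball 0 1" by (auto intro!: norm_hmap_cases(2) dest!: subsetD[OF K(3)])
    show "cr_bounded C (?K t)" by (rule cr_bounded_hmap[OF C(1) K(3)])
  qed
  have cov: "(LINT x:?K t|lborel. g x) = (LINT x:K|lborel. g (hmap (sinh t *\<^sub>R u) x) / den (sinh t *\<^sub>R u) x ^ n)"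
    if "continuous_on (?K t) g" for g t
    unfolding n_def by (rule set_integral_hmap[OF K(1) Kc that])
  have moment: "ray_moment n u K t = (LINT x:?K t|lborel. u \<bullet> x)" for t
  proof -
    have "(LINT x:?K t|lborel. u \<bullet> x) = (LINT x:K|lborel. (u \<bullet> hmap (sinh t *\<^sub>R u) x) / den (sinh t *\<^sub>R u) x ^ n)"
      by (rule cov) (intro continuous_intros)
    also have "\<dots> = ray_moment n u K t"
      unfolding ray_moment_def inner_hmap_ray[OF u] by simp
    finally show ?thesis by simp
  qed
  have mpos: "0 < measure lborel (?K t)" for t
  proof -
    have "0 < (LINT x:K|lborel. 1 / den (sinh t *\<^sub>R u) x ^ n)"
      using dp by (intro set_integral_pos_compact K continuous_intros continuous_on_den) (auto simp: less_imp_neq[symmetric])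
    also have "\<dots> = (LINT x:?K t|lborel. 1)" by (rule cov[symmetric]) (intro continuous_intros)
    finally show ?thesis by (simp add: set_integral_const)
  qed
  have deriv: "(ray_moment n u K has_real_derivative
      (real (Suc n) * (LINT x:?K t|lborel. (u \<bullet> x)\<^sup>2) - measure lborel (?K t))) (at t)" for t
  proof -
    have "(LINT x:K|lborel. (real (Suc n) * (u \<bullet> hmap (sinh t *\<^sub>R u) x)\<^sup>2 - 1) / den (sinh t *\<^sub>R u) x ^ n)
      = (LINT x:?K t|lborel. real (Suc n) * (u \<bullet> x)\<^sup>2 - 1)"
      by (rule cov[symmetric]) (intro continuous_intros)
    also have "\<dots> = (LINT x:?K t|lborel. real (Suc n) * (u \<bullet> x)\<^sup>2) - (LINT x:?K t|lborel. 1)"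
      by (intro set_integral_diff set_integrable_compact Kt continuous_intros)
    also have "\<dots> = real (Suc n) * (LINT x:?K t|lborel. (u \<bullet> x)\<^sup>2) - measure lborel (?K t)"
      by (simp only: set_integral_mult_right set_integral_const mult_1_left)
    finally show ?thesis using ray_derivatives(2)[OF K(1,3) u, of n t] by simp
  qed
  show False
  proof (rule no_two_descending_zeros[OF deriv _ _ _ \<tau>(1)])
    fix t assume "ray_moment n u K t = 0"
    then have mean0: "(LINT x:?K t|lborel. u \<bullet> x) = 0" by (simp add: moment)
    have "(real DIM(real ^ 'n) + 2) * (LINT x:?K t|lborel. (u \<bullet> x)\<^sup>2) < measure lborel (?K t)"
      by (rule second_moment_less[OF _ Kt(1-3) mpos Kt(4) _ u mean0]) (use d C(2) in simp_all)
    then show "real (Suc n) * (LINT x:?K t|lborel. (u \<bullet> x)\<^sup>2) - measure lborel (?K t) < 0"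
      by (simp add: n_def algebra_simps)
  next
    show "ray_moment n u K \<tau> = 0" using mean(2) by (simp add: moment \<tau>(2))
    have "den 0 x = 1" for x :: "real ^ 'n" by (simp add: den_def hyp_def)
    then have "ray_moment n u K 0 = (LINT x:K|lborel. u \<bullet> x)" by (simp add: ray_moment_def)
    then show "ray_moment n u K 0 = 0" using mean(1) by simp
  qed
qed

section \<open>Existence of a centering point\<close>

lemma continuous_on_set_integral_compact:
  fixes f :: "'b::metric_space \<Rightarrow> 'a::euclidean_space \<Rightarrow> real"
  assumes K: "compact K" and S: "compact S" and f: "continuous_on (S \<times> K) (\<lambda>(y, x). f y x)"
  shows "continuous_on S (\<lambda>y. LINT x:K|lborel. f y x)"
  unfolding continuous_on_iff
proof (intro ballI allI impI)
  fix y :: 'b and e :: real assume y: "y \<in> S" and e: "0 < e"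
  define m where "m = measure lborel K"
  have m: "0 \<le> m" by (simp add: m_def)
  define \<epsilon> where "\<epsilon> = e / (m + 1)"
  have \<epsilon>: "0 < \<epsilon>" "\<epsilon> * m < e" using e m by (auto simp: \<epsilon>_def field_simps)
  have "uniformly_continuous_on (S \<times> K) (\<lambda>(y, x). f y x)"
    by (intro compact_uniformly_continuous f compact_Times S K)
  then obtain d where d: "0 < d" "\<And>z z'. z \<in> S \<times> K \<Longrightarrow> z' \<in> S \<times> K \<Longrightarrow> dist z' z < d \<Longrightarrow>
      dist ((\<lambda>(y, x). f y x) z') ((\<lambda>(y, x). f y x) z) < \<epsilon>"
    using \<epsilon>(1) unfolding uniformly_continuous_on_def by metis
  have fc: "continuous_on K (f z)" if "z \<in> S" for z
    using continuous_on_compose2[OF f, of K "\<lambda>x. (z, x)"] that by (simp add: continuous_intros image_subset_iff)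
  have "dist (LINT x:K|lborel. f z x) (LINT x:K|lborel. f y x) < e" if z: "z \<in> S" "dist z y < d" for z
  proof -
    have pt: "\<bar>f z x - f y x\<bar> \<le> \<epsilon>" if "x \<in> K" for x
      using d(2)[of "(y, x)" "(z, x)"] that y z by (simp add: dist_Pair_Pair dist_real_def)
    have ic: "continuous_on K (\<lambda>x. f z x - f y x)" by (intro continuous_intros fc z y)
    have "(LINT x:K|lborel. f z x) - (LINT x:K|lborel. f y x) = (LINT x:K|lborel. f z x - f y x)"
      by (intro set_integral_diff(2)[symmetric] set_integrable_compact K fc z y)
    also have "\<bar>\<dots>\<bar> \<le> \<epsilon> * m"
    proof -
      have "(LINT x:K|lborel. f z x - f y x) \<le> (LINT x:K|lborel. \<epsilon>)"
        using pt by (intro set_integral_mono_compact K ic continuous_intros) (auto simp: abs_le_iff)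
      moreover have "(LINT x:K|lborel. - \<epsilon>) \<le> (LINT x:K|lborel. f z x - f y x)"
        using pt by (intro set_integral_mono_compact K ic continuous_intros) (force simp: abs_le_iff)
      ultimately show ?thesis unfolding set_integral_const m_def by (simp add: abs_le_iff)
    qed
    finally show ?thesis using \<epsilon>(2) by (simp add: dist_real_def)
  qed
  then show "\<exists>d>0. \<forall>z\<in>S. dist z y < d \<longrightarrow> dist (LINT x:K|lborel. f z x) (LINT x:K|lborel. f y x) < e"
    using d(1) by blast
qed

text \<open>The volume of the image of \<open>K\<close> under the boost by \<open>y\<close>.\<close>

definition hvol :: "(real ^ 'n) set \<Rightarrow> real ^ 'n \<Rightarrow> real" where
  "hvol K y = (LINT x:K|lborel. 1 / den y x ^ (CARD('n) + 1))"

lemma continuous_on_den_pair: "continuous_on S (\<lambda>p. den (fst p) (snd p))"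
  unfolding den_def hyp_def by (intro continuous_intros)

text \<open>If \<open>K\<close> lies in a ball of radius \<open>r < 1\<close>, then the denominators are at least 1 for \<open>|y| \<ge> 1/(1 - r)\<close>, and the
volume is at most its value at 0. So the maximum over a compact ball is global.\<close>

lemma hvol_attains_max:
  fixes K :: "(real ^ 'n) set"
  assumes K: "compact K" "K \<subseteq> ball 0 1"
  obtains y where "\<And>z. hvol K z \<le> hvol K y"
proof (cases "K = {}")
  case True
  then show ?thesis by (intro that[of 0]) (simp add: hvol_def set_lebesgue_integral_def)
next
  case False
  define n where "n = CARD('n) + 1"
  have dp: "0 < den y x" if "x \<in> K" for x y using den_pos[of x y] that K(2) by auto
  obtain w where w: "w \<in> K" "\<And>x. x \<in> K \<Longrightarrow> norm x \<le> norm w"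
    using continuous_attains_sup[OF K(1) False continuous_on_norm_id] by blast
  define r where "r = norm w"
  have r: "r < 1" using w(1) K(2) by (auto simp: r_def)
  \<comment> \<open>Far from the origin every denominator is at least 1, its value at the origin.\<close>
  have far: "hvol K y \<le> hvol K 0" if y: "1 / (1 - r) \<le> norm y" for y
  proof -
    have den1: "1 \<le> den y x" if "x \<in> K" for x
    proof -
      have "y \<bullet> x \<le> norm y * norm x" by (rule norm_cauchy_schwarz)
      also have "\<dots> \<le> norm y * r" using w(2)[OF that] by (simp add: r_def mult_left_mono)
      finally have "(1 - r) * norm y \<le> den y x"
        using norm_less_hyp[of y] by (simp add: den_def algebra_simps)
      moreover have "1 \<le> (1 - r) * norm y" using y r by (simp add: field_simps)
      ultimately show ?thesis by simp
    qed
    have "hvol K y \<le> (LINT x:K|lborel. 1)"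
      unfolding hvol_def n_def[symmetric]
    proof (rule set_integral_mono_compact[OF K(1)])
      show "continuous_on K (\<lambda>x. 1 / den y x ^ n)"
        using dp by (intro continuous_intros continuous_on_den) (simp add: less_imp_neq[symmetric])
      show "1 / den y x ^ n \<le> 1" if "x \<in> K" for x
        using den1[OF that] by (simp add: one_le_power)
    qed (intro continuous_intros)
    also have "\<dots> = hvol K 0" by (simp add: hvol_def den_def hyp_def)
    finally show ?thesis .
  qed
  define R where "R = 1 / (1 - r)"
  have "continuous_on (cball 0 R) (hvol K)"
    unfolding hvol_def[abs_def] n_def[symmetric]
  proof (rule continuous_on_set_integral_compact[OF K(1) compact_cball])
    show "continuous_on (cball 0 R \<times> K) (\<lambda>(y, x). 1 / den y x ^ n)"
      unfolding case_prod_beta using dp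
      by (intro continuous_intros continuous_on_den_pair) (auto simp: less_imp_neq[symmetric])
  qed
  moreover have "0 \<le> R" using r by (simp add: R_def)
  then have "cball 0 R \<noteq> ({} :: (real ^ 'n) set)" by simp
  ultimately obtain y where y: "y \<in> cball 0 R" "\<And>z. z \<in> cball 0 R \<Longrightarrow> hvol K z \<le> hvol K y"
    using continuous_attains_sup[OF compact_cball] by blast
  show thesis
  proof (rule that[of y])
    fix z show "hvol K z \<le> hvol K y"
    proof (cases "norm z \<le> R")
      case True
      then show ?thesis using y(2) by simp
    next
      case False
      then have "hvol K z \<le> hvol K 0" using far[of z] by (simp add: R_def)
      also have "\<dots> \<le> hvol K y" using y(2)[of 0] \<open>0 \<le> R\<close> by simp
      finally show ?thesis .
    qed
  qed
qed

text \<open>A convex function lies above its tangent.\<close>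

lemma inverse_power_tangent:
  fixes a b :: real
  assumes "0 < a" "0 < b"
  shows "1 / a ^ n - real n * (b - a) / a ^ Suc n \<le> 1 / b ^ n"
proof -
  define q where "q = a / b"
  have q: "0 < q" using assms by (simp add: q_def)
  have "1 - real n * (1 / q - 1) \<le> 1 + real n * (q - 1)"
  proof -
    have "0 \<le> (q - 1)\<^sup>2 / q" using q by simp
    also have "(q - 1)\<^sup>2 / q = (q - 1) - (1 - 1 / q)" using q by (simp add: field_simps power2_eq_square)
    finally have "real n * (1 - 1 / q) \<le> real n * (q - 1)" by (intro mult_left_mono) auto
    then show ?thesis by (simp add: algebra_simps)
  qed
  also have "\<dots> \<le> (1 + (q - 1)) ^ n" using q by (intro Bernoulli_inequality) simp
  finally have "(1 - real n * (1 / q - 1)) * (1 / a ^ n) \<le> q ^ n * (1 / a ^ n)"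
    using assms by (intro mult_right_mono) auto
  moreover have "q ^ n * (1 / a ^ n) = 1 / b ^ n" using assms by (simp add: q_def power_divide)
  moreover have "(1 - real n * (1 / q - 1)) * (1 / a ^ n) = 1 / a ^ n - real n * (b - a) / a ^ Suc n"
    using assms by (simp add: q_def field_simps)
  ultimately show ?thesis by simp
qed

lemma hyp_line_derivative: "((\<lambda>s. hyp (y + s *\<^sub>R w)) has_real_derivative (y \<bullet> w) / hyp y) (at 0)"
proof -
  have eq: "hyp (y + s *\<^sub>R w) = sqrt (1 + y \<bullet> y + 2 * (y \<bullet> w) * s + (w \<bullet> w) * s\<^sup>2)" for s
    unfolding hyp_def by (simp add: inner_add inner_commute[of w y] power2_eq_square algebra_simps)
  have pos: "0 < 1 + y \<bullet> y" by (simp add: add_pos_nonneg)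
  have "((\<lambda>s. sqrt (1 + y \<bullet> y + 2 * (y \<bullet> w) * s + (w \<bullet> w) * s\<^sup>2)) has_real_derivative
      (y \<bullet> w) / sqrt (1 + y \<bullet> y)) (at 0)"
    using pos by (auto intro!: derivative_eq_intros simp: field_simps)
  then show ?thesis unfolding eq unfolding hyp_def .
qed

text \<open>Convexity of the inverse power bounds \<open>hvol\<close> from below by a function that is affine on the ambient
Minkowski space, with equality at \<open>y\<close>. So a maximum of \<open>hvol\<close> is an extremum of this affine function on the
hyperboloid, and its criticality there says that the moment vector vanishes.\<close>

lemma hvol_max_centered:
  fixes K :: "(real ^ 'n) set"
  assumes K: "compact K" "K \<subseteq> ball 0 1" and y: "\<And>z. hvol K z \<le> hvol K y"
  shows "(LINT x:hmap y ` K|lborel. e \<bullet> x) = 0"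
proof -
  define n where "n = CARD('n) + 1"
  have n: "0 < real n" by (simp add: n_def)
  have Kc: "K \<subseteq> cball 0 1" using K(2) by auto
  have dp: "0 < den z x" if "x \<in> K" for x z using den_pos[of x z] that K(2) by auto
  have dn: "den z x \<noteq> 0" if "x \<in> K" for x z using dp[OF that, of z] by simp
  define I where "I = (LINT x:K|lborel. 1 / den y x ^ Suc n)"
  define B where "B w = (LINT x:K|lborel. (w \<bullet> x) / den y x ^ Suc n)" for w
  have cont: "continuous_on K (\<lambda>x. 1 / den z x ^ k)" "continuous_on K (\<lambda>x. (w \<bullet> x) / den z x ^ k)" for k z w
    using dn by (auto intro!: continuous_intros continuous_on_den)
  have ineq: "B w * s \<le> (hyp (y + s *\<^sub>R w) - hyp y) * I" for w s
  proof -
    define z where "z = y + s *\<^sub>R w"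
    have diff: "den z x - den y x = (hyp z - hyp y) - s * (w \<bullet> x)" for x
      by (simp add: den_def z_def inner_add_left)
    have c: "continuous_on K (\<lambda>x. real n * (den z x - den y x) / den y x ^ Suc n)"
      using dn by (intro continuous_intros continuous_on_den) auto
    have "hvol K y - (LINT x:K|lborel. real n * (den z x - den y x) / den y x ^ Suc n)
      = (LINT x:K|lborel. 1 / den y x ^ n - real n * (den z x - den y x) / den y x ^ Suc n)"
      unfolding hvol_def n_def[symmetric]
      by (intro set_integral_diff(2)[symmetric] set_integrable_compact K cont c)
    also have "\<dots> \<le> hvol K z"
      unfolding hvol_def n_def[symmetric]
      by (intro set_integral_mono_compact K cont continuous_on_diff c inverse_power_tangent dp)
    also have "\<dots> \<le> hvol K y" by (rule y)
    finally have "0 \<le> (LINT x:K|lborel. real n * (den z x - den y x) / den y x ^ Suc n)" by simp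
    also have "\<dots> = (LINT x:K|lborel. (real n * (hyp z - hyp y)) * (1 / den y x ^ Suc n) - (real n * s) * ((w \<bullet> x) / den y x ^ Suc n))"
      unfolding diff by (simp add: algebra_simps diff_divide_distrib add_divide_distrib)
    also have "\<dots> = (LINT x:K|lborel. (real n * (hyp z - hyp y)) * (1 / den y x ^ Suc n)) - (LINT x:K|lborel. (real n * s) * ((w \<bullet> x) / den y x ^ Suc n))"
      by (intro set_integral_diff set_integrable_compact K continuous_on_mult_left cont)
    also have "\<dots> = (real n * (hyp z - hyp y)) * I - (real n * s) * B w"
      unfolding set_integral_mult_right I_def B_def ..
    also have "\<dots> = real n * ((hyp z - hyp y) * I - s * B w)" by (simp add: algebra_simps)
    finally have "0 \<le> (hyp z - hyp y) * I - s * B w" using n by (simp add: zero_le_mult_iff)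
    then show ?thesis by (simp add: z_def mult.commute)
  qed
  \<comment> \<open>The two sides of the inequality agree at \<open>s = 0\<close>, so their derivatives there agree as well.\<close>
  have crit: "B w = (y \<bullet> w) / hyp y * I" for w
  proof -
    have h0: "0 < hyp y" using hyp_ge_one[of y] by simp
    have "((\<lambda>s. hyp (y + s *\<^sub>R w)) has_real_derivative (y \<bullet> w) / hyp y) (at 0)"
      by (rule hyp_line_derivative)
    then have "((\<lambda>s. (hyp (y + s *\<^sub>R w) - hyp y) * I - B w * s) has_real_derivative (y \<bullet> w) / hyp y * I - B w) (at 0)"
      by (auto intro!: derivative_eq_intros)
    then have "(y \<bullet> w) / hyp y * I - B w = 0"
      by (rule DERIV_local_min[where d = 1]) (use ineq in auto)
    then show ?thesis by simp
  qed
  have "(LINT x:hmap y ` K|lborel. e \<bullet> x) = (LINT x:K|lborel. (e \<bullet> hmap y x) / den y x ^ n)"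
    unfolding n_def by (rule set_integral_hmap[OF K(1) Kc]) (intro continuous_intros)
  also have "\<dots> = (LINT x:K|lborel. (stretch y e \<bullet> x) / den y x ^ Suc n - (e \<bullet> y) * (1 / den y x ^ Suc n))"
  proof (intro set_lebesgue_integral_cong allI impI)
    show "K \<in> sets lborel" using K(1) by (simp add: borel_compact)
    fix x assume "x \<in> K"
    have "e \<bullet> stretch y x = stretch y e \<bullet> x"
      by (simp add: stretch_def inner_add_left inner_add_right inner_commute[of e y] divide_inverse mult_ac)
    then have "e \<bullet> hmap y x = (stretch y e \<bullet> x - e \<bullet> y) / den y x"
      by (simp add: hmap_def inner_diff_right divide_inverse mult.commute)
    then show "(e \<bullet> hmap y x) / den y x ^ n = (stretch y e \<bullet> x) / den y x ^ Suc n - (e \<bullet> y) * (1 / den y x ^ Suc n)"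
      by (simp add: diff_divide_distrib)
  qed
  also have "\<dots> = B (stretch y e) - (e \<bullet> y) * I"
    unfolding B_def I_def set_integral_mult_right[symmetric]
    by (intro set_integral_diff set_integrable_compact K continuous_on_mult_left cont)
  also have "\<dots> = 0"
    using hyp_ge_one[of y] by (simp add: crit inner_stretch inner_commute[of e y])
  finally show ?thesis .
qed

section \<open>Projective transformations that preserve the ball\<close>

lemma span_scaleR_singleton:
  fixes v :: "'b::real_vector"
  assumes "c \<noteq> 0" shows "span {c *\<^sub>R v} = span {v}"
proof -
  have "v = (1 / c) *\<^sub>R (c *\<^sub>R v)" using assms by simp
  then have "v \<in> span {c *\<^sub>R v}" by (metis span_base span_scale singletonI)
  then have "span {v} \<subseteq> span {c *\<^sub>R v}" by (intro span_minimal) auto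
  moreover have "span {c *\<^sub>R v} \<subseteq> span {v}" by (intro span_minimal) (auto intro: span_scale span_base)
  ultimately show ?thesis by auto
qed

lemma chart_inject [simp]: "chart x = chart y \<longleftrightarrow> x = y"
proof
  assume "chart x = chart y"
  then have "span {(1::real, x)} = span {(1, y)}" using Rep_chart by metis
  then have "(1, x) \<in> span {(1::real, y)}" by (metis span_base singletonI)
  then obtain k where "(1, x) = k *\<^sub>R (1::real, y)" by (auto simp: span_singleton)
  then show "x = y" by simp
qed simp

lemma proj_map_chart:
  assumes A: "linear A" "inj A" and Ax: "A (1, x) = c *\<^sub>R (1, x')" "c \<noteq> 0"
  shows "proj_map A (chart x) = chart x'"
proof -
  have "Rep_proj_space (proj_map A (chart x)) = A ` span {(1, x)}"
    by (simp add: Rep_proj_map[OF A] Rep_chart)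
  also have "\<dots> = span {A (1, x)}" using linear_span_image[OF A(1), of "{(1, x)}"] by simp
  also have "\<dots> = Rep_proj_space (chart x')" unfolding Ax(1) Rep_chart by (rule span_scaleR_singleton[OF Ax(2)])
  finally show ?thesis by (simp add: Rep_proj_space_inject)
qed

lemma proj_map_chartD:
  assumes A: "linear A" "inj A" and eq: "proj_map A (chart x) = chart x'"
  obtains c where "c \<noteq> 0" "A (1, x) = c *\<^sub>R (1, x')"
proof -
  have "span {A (1, x)} = span {(1::real, x')}"
    using arg_cong[OF eq, of Rep_proj_space] linear_span_image[OF A(1), of "{(1, x)}"]
    by (simp add: Rep_proj_map[OF A] Rep_chart)
  then have "A (1, x) \<in> span {(1::real, x')}" by (metis span_base singletonI)
  then obtain c where c: "A (1, x) = c *\<^sub>R (1, x')" by (auto simp: span_singleton)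
  have "A (1, x) \<noteq> 0"
  proof
    assume "A (1, x) = 0"
    then have "(1::real, x) = 0" using A linear_injective_0[OF A(1)] by blast
    then show False by (simp add: zero_prod_def)
  qed
  then have "c \<noteq> 0" using c by (auto simp: zero_prod_def)
  then show thesis using c that by blast
qed

lemma proj_map_comp:
  assumes A: "linear A" "inj A" and B: "linear B" "inj B"
  shows "proj_map A (proj_map B L) = proj_map (A \<circ> B) L"
proof -
  have "linear (A \<circ> B)" "inj (A \<circ> B)" using A B by (auto intro: linear_compose inj_compose)
  then have "Rep_proj_space (proj_map A (proj_map B L)) = Rep_proj_space (proj_map (A \<circ> B) L)"
    using A B by (simp add: Rep_proj_map image_comp)
  then show ?thesis by (simp add: Rep_proj_space_inject)
qed

lemma proj_map_scale:
  assumes A: "linear A" "inj A" and c: "c \<noteq> 0"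
  shows "proj_map (\<lambda>v. c *\<^sub>R A v) = proj_map A"
proof
  fix L :: "'a proj_space"
  obtain v where v: "Rep_proj_space L = span {v}" using Rep_proj_space[of L] by auto
  have lin: "linear (\<lambda>v. c *\<^sub>R A v)" using A(1) by (simp add: linear_compose_scale_right)
  have "inj (\<lambda>v. c *\<^sub>R A v)" using A(2) c by (auto simp: inj_def)
  then have "Rep_proj_space (proj_map (\<lambda>v. c *\<^sub>R A v) L) = span {c *\<^sub>R A v}"
    using linear_span_image[OF lin, of "{v}"] by (simp add: Rep_proj_map[OF lin] v)
  also have "\<dots> = span {A v}" by (rule span_scaleR_singleton[OF c])
  also have "\<dots> = Rep_proj_space (proj_map A L)"
    using linear_span_image[OF A(1), of "{v}"] by (simp add: Rep_proj_map[OF A] v)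
  finally show "proj_map (\<lambda>v. c *\<^sub>R A v) L = proj_map A L" by (simp add: Rep_proj_space_inject)
qed

lemma proj_map_id: "proj_map (\<lambda>v. v) = id"
proof
  fix L :: "'a proj_space"
  have "Rep_proj_space (proj_map (\<lambda>v. v) L) = Rep_proj_space L"
    by (subst Rep_proj_map) (auto simp: linear_id[unfolded id_def])
  then show "proj_map (\<lambda>v. v) L = id L" by (simp add: Rep_proj_space_inject)
qed

lemma boost_zero: "boost 0 = (\<lambda>v. v)"
  by (auto simp: boost_def stretch_def hyp_def)

lemma proj_map_boost_chart:
  assumes "norm x \<le> 1"
  shows "proj_map (boost y) (chart x) = chart (hmap y x)"
  using boost_chart[OF assms, of y] den_pos[OF assms, of y]
  by (intro proj_map_chart[where c = "den y x"] linear_boost bij_is_inj[OF bij_boost]) auto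

lemma linear_ext: "linear U \<Longrightarrow> linear (\<lambda>(t :: real, x). (t, U x))"
  by (auto intro!: linearI simp: linear_add linear_scale)

lemma inj_ext: "inj U \<Longrightarrow> inj (\<lambda>(t :: real, x). (t, U x))"
  by (auto simp: inj_def)

definition lightcone :: "(real \<times> 'a::euclidean_space) set" where
  "lightcone = {v. norm (snd v) \<le> \<bar>fst v\<bar>}"

text \<open>The lightcone is the union of the lines that represent the points of the ball.\<close>

lemma ball_preserving_iff_lightcone:
  fixes A :: "real \<times> 'a::euclidean_space \<Rightarrow> real \<times> 'a"
  assumes A: "linear A" "inj A" and ball: "proj_map A ` chart ` cball 0 1 = chart ` cball 0 1"
  shows "A v \<in> lightcone \<longleftrightarrow> v \<in> lightcone"
proof
  assume v: "v \<in> lightcone"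
  show "A v \<in> lightcone"
  proof (cases "fst v = 0")
    case True
    then have "v = 0" using v by (cases v) (simp add: lightcone_def zero_prod_def)
    then show ?thesis using linear_0[OF A(1)] by (simp add: lightcone_def zero_prod_def)
  next
    case False
    define x where "x = snd v /\<^sub>R fst v"
    have vx: "v = fst v *\<^sub>R (1, x)" using False by (cases v) (simp add: x_def)
    have "norm x \<le> 1" using v False by (simp add: x_def lightcone_def field_simps)
    then have "proj_map A (chart x) \<in> chart ` cball 0 1" using ball by auto
    then obtain x' where x': "norm x' \<le> 1" "proj_map A (chart x) = chart x'" by auto
    obtain c where c: "A (1, x) = c *\<^sub>R (1, x')" using proj_map_chartD[OF A x'(2)] by metis
    have "A v = fst v *\<^sub>R A (1, x)"
      using arg_cong[OF vx, of A] unfolding linear_scale[OF A(1)] .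
    then have "A v = (fst v * c) *\<^sub>R (1, x')" by (simp add: c)
    then show ?thesis using x'(1) by (simp add: lightcone_def mult_left_le)
  qed
next
  assume v: "A v \<in> lightcone"
  show "v \<in> lightcone"
  proof (cases "fst (A v) = 0")
    case True
    then have "A v = 0" using v by (cases "A v") (simp add: lightcone_def zero_prod_def)
    then have "v = 0" using A linear_injective_0[OF A(1)] by blast
    then show ?thesis by (simp add: lightcone_def)
  next
    case False
    define x' where "x' = snd (A v) /\<^sub>R fst (A v)"
    have vx: "A v = fst (A v) *\<^sub>R (1, x')" using False by (cases "A v") (simp add: x'_def)
    have "norm x' \<le> 1" using v False by (simp add: x'_def lightcone_def field_simps)
    then have "chart x' \<in> proj_map A ` chart ` cball 0 1" unfolding ball by auto
    then obtain x where x: "norm x \<le> 1" "proj_map A (chart x) = chart x'" by auto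
    obtain c where c: "c \<noteq> 0" "A (1, x) = c *\<^sub>R (1, x')" using proj_map_chartD[OF A x(2)] by metis
    have "A ((fst (A v) / c) *\<^sub>R (1, x)) = (fst (A v) / c) *\<^sub>R c *\<^sub>R (1, x')"
      unfolding linear_scale[OF A(1)] c(2) ..
    also have "\<dots> = fst (A v) *\<^sub>R (1, x')" using c(1) by simp
    also have "\<dots> = A v" by (rule vx[symmetric])
    finally have "A ((fst (A v) / c) *\<^sub>R (1, x)) = A v" .
    then obtain r where "v = r *\<^sub>R (1, x)" using injD[OF A(2)] by metis
    then show ?thesis using x(1) by (simp add: lightcone_def mult_left_le)
  qed
qed

text \<open>If a null vector were sent into the interior of the cone, then so would nearby vectors outside
the cone.\<close>

lemma lightcone_preserving_null:
  fixes A :: "real \<times> 'a::euclidean_space \<Rightarrow> real \<times> 'a"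
  assumes A: "linear A" and pres: "\<And>v. A v \<in> lightcone \<longleftrightarrow> v \<in> lightcone"
    and v: "norm (snd v) = \<bar>fst v\<bar>"
  shows "norm (snd (A v)) = \<bar>fst (A v)\<bar>"
proof (rule ccontr)
  assume "\<not> ?thesis"
  moreover have "v \<in> lightcone" using v by (simp add: lightcone_def)
  then have "A v \<in> lightcone" by (simp add: pres)
  ultimately have lt: "norm (snd (A v)) < \<bar>fst (A v)\<bar>" by (simp add: lightcone_def)
  have "v \<noteq> 0" using lt linear_0[OF A] by auto
  then have x: "snd v \<noteq> 0" using v by (cases v) (auto simp: zero_prod_def)
  define w where "w = A (0, snd v)"
  have "((\<lambda>\<epsilon>. \<bar>fst (A v + \<epsilon> *\<^sub>R w)\<bar> - norm (snd (A v + \<epsilon> *\<^sub>R w)))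
      \<longlongrightarrow> \<bar>fst (A v + 0 *\<^sub>R w)\<bar> - norm (snd (A v + 0 *\<^sub>R w))) (at_right 0)"
    by (intro tendsto_intros)
  then have "eventually (\<lambda>\<epsilon>. 0 < \<bar>fst (A v + \<epsilon> *\<^sub>R w)\<bar> - norm (snd (A v + \<epsilon> *\<^sub>R w))) (at_right 0)"
    by (rule order_tendstoD) (use lt in simp)
  then have "eventually (\<lambda>\<epsilon>. 0 < \<bar>fst (A v + \<epsilon> *\<^sub>R w)\<bar> - norm (snd (A v + \<epsilon> *\<^sub>R w)) \<and> 0 < \<epsilon>) (at_right 0)"
    using eventually_at_right_less by (rule eventually_conj)
  then obtain \<epsilon> :: real where \<epsilon>: "0 < \<bar>fst (A v + \<epsilon> *\<^sub>R w)\<bar> - norm (snd (A v + \<epsilon> *\<^sub>R w))" "0 < \<epsilon>"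
    using eventually_happens trivial_limit_at_right_real by blast
  have "A (v + \<epsilon> *\<^sub>R (0, snd v)) = A v + \<epsilon> *\<^sub>R w"
    by (simp only: linear_add[OF A] linear_scale[OF A] w_def)
  then have "A (v + \<epsilon> *\<^sub>R (0, snd v)) \<in> lightcone" using \<epsilon>(1) by (simp add: lightcone_def)
  then have "norm (snd v + \<epsilon> *\<^sub>R snd v) \<le> \<bar>fst v\<bar>" unfolding pres by (simp add: lightcone_def)
  moreover have "snd v + \<epsilon> *\<^sub>R snd v = (1 + \<epsilon>) *\<^sub>R snd v" by (simp add: scaleR_left_distrib)
  ultimately have "(1 + \<epsilon>) * norm (snd v) \<le> norm (snd v)" using \<epsilon>(2) v by simp
  moreover have "0 < \<epsilon> * norm (snd v)" using \<epsilon>(2) x by simp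
  ultimately show False by (simp add: algebra_simps)
qed

lemma lightcone_lform: "v \<in> lightcone \<longleftrightarrow> 0 \<le> lform v v"
proof -
  have "lform v v = \<bar>fst v\<bar>\<^sup>2 - (norm (snd v))\<^sup>2"
    unfolding lform_def power2_norm_eq_inner by (simp add: power2_eq_square)
  then show ?thesis by (simp add: lightcone_def abs_le_square_iff[symmetric])
qed

lemma boost_lightcone: "boost y v \<in> lightcone \<longleftrightarrow> v \<in> lightcone"
  by (simp add: lightcone_lform lform_boost_boost)

text \<open>Undoing a boost and a scaling, the linear map fixes \<open>(1, 0)\<close> and maps null vectors to null vectors.
Applied to \<open>(1, x)\<close> and \<open>(1, -x)\<close> for unit vectors \<open>x\<close>, the latter leaves only a rotation of the second component.\<close>

lemma ball_preserving_decomposition: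
  fixes A :: "real \<times> 'a::euclidean_space \<Rightarrow> real \<times> 'a"
  assumes A: "linear A" "bij A" and ball: "proj_map A ` chart ` cball 0 1 = chart ` cball 0 1"
  obtains U y where "orthogonal_transformation U" "proj_map A = proj_ext U \<circ> proj_map (boost y)"
proof -
  have injA: "inj A" using A(2) by (rule bij_is_inj)
  note pres = ball_preserving_iff_lightcone[OF A(1) injA ball]
  obtain v where v: "A v = (1, 0)" using A(2) by (metis bij_is_surj surjD)
  obtain t x where tx: "v = (t, x)" by (cases v)
  have "v \<in> lightcone" using pres[of v] v by (simp add: lightcone_def)
  moreover have "norm (snd v) \<noteq> \<bar>fst v\<bar>"
    using lightcone_preserving_null[OF A(1) pres, of v] v by auto
  ultimately have lt: "norm x < \<bar>t\<bar>" by (simp add: tx lightcone_def)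
  define k where "k = sgn t * sqrt (t\<^sup>2 - (norm x)\<^sup>2)"
  have pos: "0 < t\<^sup>2 - (norm x)\<^sup>2"
    using power_strict_mono[OF lt, of 2] by simp
  have t0: "t \<noteq> 0" using lt by auto
  have k: "k \<noteq> 0" "k\<^sup>2 = t\<^sup>2 - (norm x)\<^sup>2"
    using pos t0 by (auto simp: k_def sgn_if power_mult_distrib)
  define y where "y = x /\<^sub>R k"
  have "hyp y = t / k"
  proof -
    have "y \<bullet> y = (norm x)\<^sup>2 / k\<^sup>2" 
      unfolding y_def power2_norm_eq_inner by (simp add: power2_eq_square divide_inverse)
    then have "1 + y \<bullet> y = (k\<^sup>2 + (norm x)\<^sup>2) / k\<^sup>2" using k(1) by (simp add: add_divide_distrib)
    also have "\<dots> = (t / k)\<^sup>2" by (simp add: k(2) power_divide)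
    finally have "1 + y \<bullet> y = (t / k)\<^sup>2" .
    moreover have "0 < t / k" using t0 pos by (auto simp: k_def sgn_if zero_less_divide_iff)
    ultimately show ?thesis by (simp only: hyp_def real_sqrt_abs abs_of_pos)
  qed
  then have vk: "boost (- y) (1, 0) = (1 / k) *\<^sub>R v"
    using k(1) by (simp add: boost_def stretch_def tx y_def divide_inverse)
  define A' where "A' w = k *\<^sub>R A (boost (- y) w)" for w
  have lin: "linear A'"
    unfolding A'_def[abs_def]
    by (intro linear_compose_scale_right linear_compose[OF linear_boost A(1), unfolded o_def])
  have A'0: "A' (1, 0) = (1, 0)"
    unfolding A'_def vk linear_scale[OF A(1)] v using k(1) by simp
  have pres': "A' w \<in> lightcone \<longleftrightarrow> w \<in> lightcone" for w
  proof -
    have "k *\<^sub>R z \<in> lightcone \<longleftrightarrow> z \<in> lightcone" for z :: "real \<times> 'a"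
      using k(1) by (simp add: lightcone_def abs_mult)
    then show ?thesis by (simp add: A'_def pres boost_lightcone)
  qed
  define \<beta> where "\<beta> x = fst (A' (0, x))" for x
  define U where "U x = snd (A' (0, x))" for x
  have A'tx: "A' (t, x) = (t + \<beta> x, U x)" for t x
  proof -
    have "A' (t *\<^sub>R (1, 0) + (0, x)) = t *\<^sub>R A' (1, 0) + A' (0, x)"
      by (simp only: linear_add[OF lin] linear_scale[OF lin])
    then show ?thesis unfolding A'0 by (cases "A' (0, x)") (simp add: \<beta>_def U_def)
  qed
  have linU: "linear U" and lin\<beta>: "linear \<beta>"
  proof -
    have emb: "linear (\<lambda>x::'a. (0::real, x))" by (auto intro!: linearI)
    have "linear (\<lambda>x. A' (0, x))" using linear_compose[OF emb lin] by (simp add: o_def)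
    from linear_compose[OF this linear_snd] linear_compose[OF this linear_fst]
    show "linear U" "linear \<beta>" by (simp_all add: o_def U_def[abs_def] \<beta>_def[abs_def])
  qed
  have unit: "\<beta> x = 0 \<and> norm (U x) = 1" if "norm x = 1" for x
  proof -
    have "norm (U x) = \<bar>1 + \<beta> x\<bar>"
      using lightcone_preserving_null[OF lin pres', of "(1, x)"] that by (simp add: A'tx)
    moreover have "norm (U x) = \<bar>1 - \<beta> x\<bar>"
      using lightcone_preserving_null[OF lin pres', of "(1, - x)"] that linear_neg[OF linU] linear_neg[OF lin\<beta>]
      by (simp add: A'tx)
    ultimately show ?thesis by (auto simp: abs_if split: if_splits)
  qed
  have all: "\<beta> x = 0 \<and> norm (U x) = norm x" for x
  proof (cases "x = 0")
    case True
    then show ?thesis using linear_0[OF linU] linear_0[OF lin\<beta>] by simp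
  next
    case False
    then have x: "x = norm x *\<^sub>R (x /\<^sub>R norm x)" "norm (x /\<^sub>R norm x) = 1" by simp_all
    have "\<beta> x = norm x * \<beta> (x /\<^sub>R norm x)" "U x = norm x *\<^sub>R U (x /\<^sub>R norm x)"
      using linear_scale[OF lin\<beta>, of "norm x" "x /\<^sub>R norm x"] linear_scale[OF linU, of "norm x" "x /\<^sub>R norm x"] False
      by simp_all
    then show ?thesis using unit[OF x(2)] by simp
  qed
  have U: "orthogonal_transformation U" using linU all by (simp add: orthogonal_transformation)
  have injU: "inj U" by (rule orthogonal_transformation_inj[OF U])
  have "A w = (1 / k) *\<^sub>R ((\<lambda>(t, x). (t, U x)) \<circ> boost y) w" for w
  proof -
    have "A' (boost y w) = ((\<lambda>(t, x). (t, U x)) \<circ> boost y) w"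
      using all by (cases "boost y w") (simp add: A'tx)
    moreover have "A' (boost y w) = k *\<^sub>R A w" by (simp add: A'_def boost_inverse)
    ultimately show ?thesis using k(1) by (metis scaleR_scaleR divide_self_if mult.commute times_divide_eq_right mult.right_neutral scaleR_one)
  qed
  then have "A = (\<lambda>w. (1 / k) *\<^sub>R ((\<lambda>(t, x). (t, U x)) \<circ> boost y) w)" by (rule ext)
  moreover have "linear ((\<lambda>(t, x). (t, U x)) \<circ> boost y)" "inj ((\<lambda>(t, x). (t, U x)) \<circ> boost y)"
    using linear_compose[OF linear_boost linear_ext[OF linU]]
      inj_compose[OF inj_ext[OF injU] bij_is_inj[OF bij_boost]] by auto
  ultimately have "proj_map A = proj_map ((\<lambda>(t, x). (t, U x)) \<circ> boost y)"
    using proj_map_scale[of "(\<lambda>(t, x). (t, U x)) \<circ> boost y" "1 / k"] k(1) by simp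
  also have "\<dots> = proj_ext U \<circ> proj_map (boost y)"
    unfolding proj_ext_def
    by (rule ext) (simp add: proj_map_comp linear_ext linU inj_ext injU linear_boost bij_is_inj[OF bij_boost])
  finally show thesis using that U by blast
qed

section \<open>Centering a body below the width bound\<close>

lemma inner_set_integral:
  fixes S :: "'a::euclidean_space set"
  assumes "compact S"
  shows "e \<bullet> (LINT x:S|lborel. x) = (LINT x:S|lborel. e \<bullet> x)"
proof -
  have "integrable lborel (\<lambda>x::'a. indicator S x *\<^sub>R x)"
    by (rule borel_integrable_compact[OF assms]) (intro continuous_intros)
  then have "(LINT x|lborel. e \<bullet> (indicator S x *\<^sub>R x)) = e \<bullet> (LINT x|lborel. indicator S x *\<^sub>R x)"
    by (intro integral_inner_right)
  then show ?thesis by (simp add: set_lebesgue_integral_def)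
qed

lemma centroid_zeroI:
  fixes S :: "'a::euclidean_space set"
  assumes "compact S" "\<And>e. (LINT x:S|lborel. e \<bullet> x) = 0"
  shows "centroid S = 0"
proof -
  have "(LINT x:S|lborel. x) \<bullet> (LINT x:S|lborel. x) = 0"
    using assms by (simp add: inner_set_integral)
  then show ?thesis by (simp add: centroid_def)
qed

text \<open>The volume is assumed positive because the centroid of a null set is 0 by convention.\<close>

lemma centroid_zeroD:
  fixes S :: "'a::euclidean_space set"
  assumes "compact S" "0 < measure lborel S" "centroid S = 0"
  shows "(LINT x:S|lborel. e \<bullet> x) = 0"
proof -
  have "(LINT x:S|lborel. x) = 0" using assms(2,3) by (simp add: centroid_def)
  then show ?thesis using inner_set_integral[OF assms(1), of e] by simp
qed

lemma convex_body_measure_pos: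
  fixes K :: "'a::euclidean_space set"
  assumes "convex_body K"
  shows "0 < measure lborel K"
proof -
  obtain x r where r: "0 < r" "cball x r \<subseteq> K"
    using assms by (auto simp: convex_body_def mem_interior_cball)
  have "0 < measure lborel (ball x r)" using r(1) by (rule content_ball_pos)
  also have "\<dots> \<le> measure lborel K"
  proof (rule measure_mono_fmeasurable)
    show "ball x r \<subseteq> K" using r(2) ball_subset_cball by blast
    show "K \<in> fmeasurable lborel" using assms by (auto simp: convex_body_def intro: fmeasurable_compact)
  qed simp
  finally show ?thesis .
qed

lemma measure_hmap_image_pos:
  fixes K :: "(real ^ 'n) set"
  assumes K: "compact K" "K \<subseteq> ball 0 1" "0 < measure lborel K"
  shows "0 < measure lborel (hmap y ` K)"
proof -
  have dp: "0 < den y x" if "x \<in> K" for x using den_pos[of x y] that K(2) by auto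
  have "0 < (LINT x:K|lborel. 1 / den y x ^ (CARD('n) + 1))"
    using dp by (intro set_integral_pos_compact K continuous_intros continuous_on_den) (auto simp: less_imp_neq[symmetric])
  also have "\<dots> = (LINT x:hmap y ` K|lborel. 1)"
    by (rule set_integral_hmap[symmetric]) (use K in \<open>auto intro!: continuous_intros\<close>)
  finally show ?thesis by (simp add: set_integral_const)
qed

lemma ball_image_boost:
  "proj_map (boost y) ` chart ` cball 0 1 = chart ` cball 0 (1::real)" for y :: "'a::euclidean_space"
proof -
  have "hmap y ` cball 0 1 = cball 0 1"
  proof safe
    fix x :: 'a assume "x \<in> cball 0 1"
    then have n: "norm x \<le> 1" by simp
    then show "hmap y x \<in> cball 0 1" using norm_hmap_cases(1) by simp
    have "x = hmap y (hmap (- y) x)" using hmap_inverse[OF n, of "- y"] by simp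
    then show "x \<in> hmap y ` cball 0 1" using norm_hmap_cases(1)[OF n] by auto
  qed
  moreover have "proj_map (boost y) ` chart ` cball 0 1 = chart ` hmap y ` cball 0 1"
    by (auto simp: image_image proj_map_boost_chart intro!: image_cong)
  ultimately show ?thesis by simp
qed

lemma image_boost_chart:
  assumes "K \<subseteq> cball 0 1" shows "proj_map (boost y) ` chart ` K = chart ` hmap y ` K"
  using assms by (auto simp: image_image proj_map_boost_chart subset_iff intro!: image_cong)

lemma image_ext_chart:
  assumes "orthogonal_transformation U" shows "proj_ext U ` chart ` K = chart ` U ` K"
  using proj_ext_chart[OF orthogonal_transformation_linear[OF assms] orthogonal_transformation_inj[OF assms]]
  by (simp add: image_image)

lemma chart_vimage_image [simp]: "chart -` chart ` K = K"
  by (rule inj_vimage_image_eq) (simp add: inj_def)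

lemma projective_boost: "projective_transformation (proj_map (boost y))"
  unfolding projective_transformation_def using linear_boost bij_boost by blast

lemma centering_boostI:
  fixes K :: "(real ^ 'n) set"
  assumes K: "compact K" "K \<subseteq> cball 0 1" and y: "\<And>e. (LINT x:hmap y ` K|lborel. e \<bullet> x) = 0"
  shows "centering K (proj_map (boost y))"
  unfolding centering_def
proof (intro conjI projective_boost ball_image_boost)
  have "compact (hmap y ` K)" by (rule compact_continuous_image[OF continuous_on_hmap[OF K(2)] K(1)])
  then show "centroid (chart -` proj_map (boost y) ` chart ` K) = 0"
    unfolding image_boost_chart[OF K(2)] chart_vimage_image by (rule centroid_zeroI[OF _ y])
qed

lemma linear_inv_bij:
  fixes A :: "'b::real_vector \<Rightarrow> 'b"
  assumes "linear A" "bij A" shows "linear (inv A)"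
proof (rule linearI)
  have s: "A (inv A v) = v" for v using assms(2) by (simp add: bij_is_surj surj_f_inv_f)
  have i: "inv A (A v) = v" for v using assms(2) by (simp add: bij_is_inj inv_f_f)
  show "inv A (v + w) = inv A v + inv A w" for v w
    using i[of "inv A v + inv A w"] by (simp add: linear_add[OF assms(1)] s)
  show "inv A (c *\<^sub>R v) = c *\<^sub>R inv A v" for c v
    using i[of "c *\<^sub>R inv A v"] by (simp add: linear_scale[OF assms(1)] s)
qed

text \<open>For uniqueness, \<open>K\<close> is replaced by its image \<open>L\<close> under the first centering. The transition to the second one
is a boost by some \<open>z\<close> followed by a rotation, both \<open>L\<close> and its boosted image have mean zero, and so \<open>z = 0\<close>.\<close>

lemma uniquely_centerable_if_cr_bounded:
  fixes K :: "(real ^ 'n) set"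
  assumes d: "2 \<le> CARD('n)" and body: "convex_body K" and ball: "K \<subseteq> ball 0 1"
    and C: "cr_bounded C K" "C < ((1 + critical_radius CARD('n)) / (1 - critical_radius CARD('n)))\<^sup>2"
  shows "uniquely_centerable K"
  unfolding uniquely_centerable_def
proof (intro conjI allI impI)
  have K: "compact K" "convex K" "0 < measure lborel K"
    using body convex_body_measure_pos by (auto simp: convex_body_def)
  have Kc: "K \<subseteq> cball 0 1" using ball by auto
  obtain y where "\<And>z. hvol K z \<le> hvol K y" using hvol_attains_max[OF K(1) ball] by blast
  then have "\<And>e. (LINT x:hmap y ` K|lborel. e \<bullet> x) = 0" by (rule hvol_max_centered[OF K(1) ball])
  then show "\<exists>\<phi>. centering K \<phi>" using centering_boostI[OF K(1) Kc] by blast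
  fix \<phi> \<psi> assume *: "centering K \<phi> \<and> centering K \<psi>"
  obtain A where A: "linear A" "bij A" "\<phi> = proj_map A"
    using * by (auto simp: centering_def projective_transformation_def)
  obtain B where B: "linear B" "bij B" "\<psi> = proj_map B"
    using * by (auto simp: centering_def projective_transformation_def)
  have \<phi>ball: "\<phi> ` chart ` cball 0 1 = chart ` cball 0 1" and \<psi>ball: "\<psi> ` chart ` cball 0 1 = chart ` cball 0 1"
    using * by (auto simp: centering_def)
  obtain U\<^sub>1 y\<^sub>1 where U1: "orthogonal_transformation U\<^sub>1" "\<phi> = proj_ext U\<^sub>1 \<circ> proj_map (boost y\<^sub>1)"
    using ball_preserving_decomposition[OF A(1,2)] \<phi>ball A(3) by metis
  define L where "L = U\<^sub>1 ` hmap y\<^sub>1 ` K"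
  have \<phi>K: "\<phi> ` chart ` K = chart ` L"
    unfolding U1(2) L_def image_comp[symmetric] image_boost_chart[OF Kc] image_ext_chart[OF U1(1)] ..
  define \<kappa> where "\<kappa> = proj_map (B \<circ> inv A)"
  have invA: "linear (inv A)" "bij (inv A)" using A linear_inv_bij bij_imp_bij_inv by auto
  have lin: "linear (B \<circ> inv A)" "bij (B \<circ> inv A)"
    using B invA by (auto intro: linear_compose bij_comp)
  have \<psi>: "\<psi> = \<kappa> \<circ> \<phi>"
  proof
    fix P
    have BA: "(B \<circ> inv A) \<circ> A = B" using A(2) by (simp add: o_assoc[symmetric] bij_is_inj)
    have "proj_map (B \<circ> inv A) (proj_map A P) = proj_map ((B \<circ> inv A) \<circ> A) P"
      by (rule proj_map_comp[OF lin(1) bij_is_inj[OF lin(2)] A(1) bij_is_inj[OF A(2)]])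
    then show "\<psi> P = (\<kappa> \<circ> \<phi>) P"
      unfolding BA \<kappa>_def A(3) B(3) by simp
  qed
  have "proj_map (B \<circ> inv A) ` chart ` cball 0 1 = chart ` cball 0 1"
    using \<psi>ball unfolding \<psi> image_comp[symmetric] \<phi>ball \<kappa>_def .
  then obtain U z where U: "orthogonal_transformation U" "\<kappa> = proj_ext U \<circ> proj_map (boost z)"
    using ball_preserving_decomposition[OF lin] unfolding \<kappa>_def by metis
  have H: "compact (hmap y ` S)" "convex S \<Longrightarrow> convex (hmap y ` S)" "hmap y ` S \<subseteq> ball 0 1"
    if "compact S" "S \<subseteq> ball 0 1" for S and y :: "real ^ 'n"
  proof -
    have Sc: "S \<subseteq> cball 0 1" using that(2) by auto
    show "compact (hmap y ` S)" by (rule compact_continuous_image[OF continuous_on_hmap[OF Sc] that(1)])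
    show "convex S \<Longrightarrow> convex (hmap y ` S)" by (rule convex_hmap_image[OF _ Sc])
    show "hmap y ` S \<subseteq> ball 0 1" by (auto intro!: norm_hmap_cases(2) dest!: subsetD[OF that(2)])
  qed
  have O: "compact (V ` S)" "measure lborel (V ` S) = measure lborel S"
    if "orthogonal_transformation V" "compact S" for V :: "real ^ 'n \<Rightarrow> real ^ 'n" and S
  proof -
    show "compact (V ` S)"
      using that orthogonal_transformation_linear[OF that(1)]
      by (intro compact_continuous_image linear_continuous_on) (auto simp: linear_conv_bounded_linear)
    have "(LINT x:V ` S|lborel. 1) = (LINT x:S|lborel. 1 :: real)"
      by (rule set_integral_orthogonal[OF that(1,2)]) (intro continuous_intros)
    then show "measure lborel (V ` S) = measure lborel S" by (simp add: set_integral_const)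
  qed
  have L: "compact L" "convex L" "L \<subseteq> ball 0 1" "0 < measure lborel L" "cr_bounded C L"
  proof -
    note H1 = H[OF K(1) ball, of y\<^sub>1]
    show "compact L" unfolding L_def by (rule O(1)[OF U1(1) H1(1)])
    show "convex L" unfolding L_def
      by (rule convex_linear_image[OF orthogonal_transformation_linear[OF U1(1)] H1(2)[OF K(2)]])
    show "L \<subseteq> ball 0 1"
      using H1(3) orthogonal_transformation_norm[OF U1(1)] by (auto simp: L_def subset_iff)
    show "0 < measure lborel L"
      unfolding L_def O(2)[OF U1(1) H1(1)] by (rule measure_hmap_image_pos[OF K(1) ball K(3)])
    show "cr_bounded C L"
      unfolding L_def by (rule cr_bounded_orthogonal[OF cr_bounded_hmap[OF C(1) ball] U1(1)])
  qed
  have Lc: "L \<subseteq> cball 0 1" using L(3) by auto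
  note HL = H[OF L(1,3), of z]
  have "\<psi> ` chart ` K = chart ` U ` hmap z ` L"
    unfolding \<psi> image_comp[symmetric] \<phi>K unfolding U(2) image_comp[symmetric] image_boost_chart[OF Lc] image_ext_chart[OF U(1)] ..
  then have c2: "centroid (U ` hmap z ` L) = 0" using * by (simp add: centering_def)
  have c1: "centroid L = 0" using * by (simp add: centering_def \<phi>K)
  have "z = 0"
  proof (rule centered_at_unique_point[OF d L(1-4) L(5) C(2)])
    show "(LINT x:L|lborel. e \<bullet> x) = 0" for e by (rule centroid_zeroD[OF L(1) L(4) c1])
    show "(LINT x:hmap z ` L|lborel. e \<bullet> x) = 0" for e
    proof -
      have "U e \<bullet> U x = e \<bullet> x" for x using U(1) by (simp add: orthogonal_transformation_def)
      then have "(LINT x:hmap z ` L|lborel. e \<bullet> x) = (LINT x:hmap z ` L|lborel. U e \<bullet> U x)" by simp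
      also have "\<dots> = (LINT x:U ` hmap z ` L|lborel. U e \<bullet> x)"
        by (rule set_integral_orthogonal[OF U(1) HL(1), symmetric]) (intro continuous_intros)
      also have "\<dots> = 0"
        by (rule centroid_zeroD[OF O(1)[OF U(1) HL(1)] _ c2])
          (use O(2)[OF U(1) HL(1)] measure_hmap_image_pos[OF L(1,3,4)] in simp)
      finally show ?thesis .
    qed
  qed
  then have "\<kappa> = proj_ext U" unfolding U(2) by (simp add: boost_zero proj_map_id)
  then show "\<exists>U. orthogonal_transformation U \<and> \<psi> = proj_ext U \<circ> \<phi>" using U(1) \<psi> by blast
qed

lemma width_bound_critical_radius: "width_bound d = ln ((1 + critical_radius d) / (1 - critical_radius d))"
  by (simp add: width_bound_def critical_radius_def)

lemma centerable_below_width_bound: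
  fixes K :: "(real ^ 'n) set"
  assumes d: "2 \<le> CARD('n)" and K: "convex_body K" "K \<subseteq> cball 0 1"
    and W: "hyperbolic_width K < ereal (width_bound CARD('n))"
  shows "uniquely_centerable K"
proof -
  define s where "s = critical_radius CARD('n)"
  have s: "0 < s" "s < 1" using critical_radius_bounds(1,2)[OF d] by (auto simp: s_def)
  have w0: "0 < width_bound CARD('n)" using s by (simp add: width_bound_critical_radius s_def)
  obtain w where w: "hyperbolic_width K \<le> ereal w" "0 \<le> w" "w < width_bound CARD('n)"
  proof (cases "hyperbolic_width K")
    case (real r)
    then show thesis using W w0 that[of "max 0 r"] by simp
  next
    case PInf
    then show thesis using W by simp
  next
    case MInf
    then show thesis using w0 that[of 0] by simp
  qed
  have d': "2 \<le> DIM(real ^ 'n)" using d by simp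
  have ball: "K \<subseteq> ball 0 1"
    by (rule finite_width_imp_subset_ball[OF d' K]) (use W in \<open>auto intro: less_trans\<close>)
  have "exp (2 * w) < exp (2 * width_bound CARD('n))" using w(3) by simp
  also have "\<dots> = ((1 + s) / (1 - s))\<^sup>2"
  proof -
    have "exp (2 * width_bound CARD('n)) = (exp (width_bound CARD('n)))\<^sup>2"
      by (simp add: power2_eq_square flip: exp_add)
    then show ?thesis using s by (simp add: width_bound_critical_radius s_def)
  qed
  finally show ?thesis
    using uniquely_centerable_if_cr_bounded[OF d K(1) ball width_bounds_cross_ratio[OF d' K w(1,2)]]
    by (simp add: s_def)
qed

section \<open>Sharpness: thin cylinders around a chord\<close>

text \<open>The segment \<open>[-a u, a u]\<close> thickened by \<open>\<epsilon>\<close> in the directions orthogonal to \<open>u\<close>. Its marginal along \<open>u\<close> is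
uniform, the extreme case of \<open>convex_second_moment_le\<close>.\<close>

definition capped_cylinder :: "'a::euclidean_space \<Rightarrow> real \<Rightarrow> real \<Rightarrow> 'a set" where
  "capped_cylinder u a \<epsilon> = {x. \<bar>u \<bullet> x\<bar> \<le> a \<and> norm (x - (u \<bullet> x) *\<^sub>R u) \<le> \<epsilon>}"

lemma capped_cylinder_subset_cball:
  assumes u: "norm u = 1" and "0 \<le> a" "0 \<le> \<epsilon>"
  shows "capped_cylinder u a \<epsilon> \<subseteq> cball 0 (a + \<epsilon>)"
proof
  fix x assume x: "x \<in> capped_cylinder u a \<epsilon>"
  have "norm ((u \<bullet> x) *\<^sub>R u + (x - (u \<bullet> x) *\<^sub>R u)) \<le> norm ((u \<bullet> x) *\<^sub>R u) + norm (x - (u \<bullet> x) *\<^sub>R u)"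
    by (rule norm_triangle_ineq)
  also have "\<dots> \<le> a + \<epsilon>" using x u by (simp add: capped_cylinder_def)
  finally show "x \<in> cball 0 (a + \<epsilon>)" by simp
qed

lemma capped_cylinder_convex_body:
  fixes u :: "'a::euclidean_space"
  assumes u: "norm u = 1" and a: "0 < a" and \<epsilon>: "0 < \<epsilon>"
  shows "convex_body (capped_cylinder u a \<epsilon>)"
  unfolding convex_body_def
proof (intro conjI)
  have eq: "capped_cylinder u a \<epsilon> = {x. \<bar>u \<bullet> x\<bar> \<le> a} \<inter> {x. norm (x - (u \<bullet> x) *\<^sub>R u) \<le> \<epsilon>}"
    by (auto simp: capped_cylinder_def)
  have "closed (capped_cylinder u a \<epsilon>)"
    unfolding eq by (intro closed_Int closed_Collect_le continuous_intros)
  moreover have "bounded (capped_cylinder u a \<epsilon>)"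
    using capped_cylinder_subset_cball[OF u] a \<epsilon> bounded_cball bounded_subset by (metis less_imp_le)
  ultimately show "compact (capped_cylinder u a \<epsilon>)" by (simp add: compact_eq_bounded_closed)
  have "linear (\<lambda>x. x - (u \<bullet> x) *\<^sub>R u)" "linear (\<lambda>x. u \<bullet> x)"
    by (auto intro!: linearI simp: inner_add_right algebra_simps)
  then have "convex ((\<lambda>x. u \<bullet> x) -` cball 0 a \<inter> (\<lambda>x. x - (u \<bullet> x) *\<^sub>R u) -` cball 0 \<epsilon>)"
    by (intro convex_Int convex_linear_vimage convex_cball)
  moreover have "(\<lambda>x. u \<bullet> x) -` cball 0 a \<inter> (\<lambda>x. x - (u \<bullet> x) *\<^sub>R u) -` cball 0 \<epsilon> = capped_cylinder u a \<epsilon>"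
    by (auto simp: capped_cylinder_def dist_real_def)
  ultimately show "convex (capped_cylinder u a \<epsilon>)" by simp
  define G where "G = {x. \<bar>u \<bullet> x\<bar> < a} \<inter> {x. norm (x - (u \<bullet> x) *\<^sub>R u) < \<epsilon>}"
  have "open G" unfolding G_def by (intro open_Int open_Collect_less continuous_intros)
  moreover have "G \<subseteq> capped_cylinder u a \<epsilon>" by (auto simp: G_def capped_cylinder_def)
  moreover have "0 \<in> G" using a \<epsilon> by (simp add: G_def)
  ultimately show "interior (capped_cylinder u a \<epsilon>) \<noteq> {}" by (metis empty_iff interior_maximal subsetD)
qed

lemma capped_cylinder_second_moment:
  fixes u :: "'a::euclidean_space"
  assumes u: "norm u = 1" and a: "0 < a" and \<epsilon>: "0 < \<epsilon>"
  shows "(LINT x:capped_cylinder u a \<epsilon>|lborel. (u \<bullet> x)\<^sup>2) = a\<^sup>2 / 3 * measure lborel (capped_cylinder u a \<epsilon>)"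
proof -
  let ?K = "capped_cylinder u a \<epsilon>"
  define Q where "Q = {x. norm (x - (u \<bullet> x) *\<^sub>R u) \<le> \<epsilon>}"
  have uu: "u \<bullet> u = 1" using u by (simp add: norm_eq_1)
  have comp: "compact ?K" using capped_cylinder_convex_body[OF u a \<epsilon>] by (simp add: convex_body_def)
  have "closed Q" unfolding Q_def by (intro closed_Collect_le continuous_intros)
  then have Qb: "Q \<in> sets borel" by simp
  have Qinv: "x + s *\<^sub>R u \<in> Q \<longleftrightarrow> x \<in> Q" for x s
    by (simp add: Q_def inner_add_right uu algebra_simps)
  have "bounded {x \<in> Q. 0 \<le> u \<bullet> x \<and> u \<bullet> x \<le> 1}"
    by (rule bounded_subset[OF bounded_cball[of 0 "1 + \<epsilon>"] subset_trans[OF _ capped_cylinder_subset_cball[OF u]]])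
      (use \<epsilon> in \<open>auto simp: Q_def capped_cylinder_def\<close>)
  then have "emeasure lborel {x \<in> Q. 0 \<le> u \<bullet> x \<and> u \<bullet> x \<le> 1} < \<infinity>" by (rule emeasure_bounded_finite)
  then obtain c where c: "emeasure lborel {x \<in> Q. 0 \<le> u \<bullet> x \<and> u \<bullet> x \<le> 1} = ennreal c" "0 \<le> c"
    by (metis ennreal_enn2real enn2real_nonneg infinity_ennreal_def less_top)
  have moment: "(LINT x:?K|lborel. q (u \<bullet> x)) = (F a - F (- a)) * c"
    if q: "continuous_on UNIV q" "\<And>r. 0 \<le> q r" and F: "\<And>r. (F has_real_derivative q r) (at r)" for q F :: "real \<Rightarrow> real"
  proof -
    have [measurable]: "q \<in> borel_measurable borel" using q(1) by (rule borel_measurable_continuous_onI)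
    have int: "integrable lborel (\<lambda>x. indicator ?K x *\<^sub>R q (u \<bullet> x))"
      by (intro borel_integrable_compact comp continuous_on_compose2[OF q(1)] continuous_intros) auto
    have Fa: "F (- a) \<le> F a" using DERIV_nonneg_imp_nondecreasing[of "- a" a F] F q(2) a by force
    have "ennreal (LINT x:?K|lborel. q (u \<bullet> x)) = (\<integral>\<^sup>+x. ennreal (indicator ?K x *\<^sub>R q (u \<bullet> x)) \<partial>lborel)"
      unfolding set_lebesgue_integral_def
      by (rule nn_integral_eq_integral[symmetric, OF int]) (use q(2) in auto)
    also have "\<dots> = (\<integral>\<^sup>+x. (\<lambda>r. ennreal (q r) * indicator {-a..a} r) (u \<bullet> x) * indicator Q x \<partial>lborel)"
      by (intro nn_integral_cong) (auto simp: capped_cylinder_def Q_def indicator_def abs_le_iff)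
    also have "\<dots> = (\<integral>\<^sup>+r. ennreal (q r) * indicator {-a..a} r \<partial>lborel) * ennreal c"
      unfolding c(1)[symmetric] by (rule nn_integral_cylinder[OF Qb _ u Qinv]) measurable
    also have "(\<integral>\<^sup>+r. ennreal (q r) * indicator {-a..a} r \<partial>lborel) = ennreal (F a - F (- a))"
      by (rule nn_integral_FTC_Icc) (use F q a in auto)
    also have "\<dots> * ennreal c = ennreal ((F a - F (- a)) * c)"
      using Fa c(2) by (simp add: ennreal_mult)
    finally show ?thesis
      using Fa c(2) q(2) by (simp add: set_lebesgue_integral_def)
  qed
  have "(LINT x:?K|lborel. 1) = (a - (- a)) * c"
    by (rule moment[of "\<lambda>_. 1" "\<lambda>r. r"]) (auto intro!: continuous_intros derivative_eq_intros)
  moreover have "(LINT x:?K|lborel. (u \<bullet> x)\<^sup>2) = (a ^ 3 / 3 - (- a) ^ 3 / 3) * c"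
    by (rule moment[of "\<lambda>r. r\<^sup>2" "\<lambda>r. r ^ 3 / 3"]) (auto intro!: continuous_intros derivative_eq_intros)
  ultimately show ?thesis
    by (simp add: set_integral_const power2_eq_square power3_eq_cube)
qed

lemma capped_cylinder_mean:
  fixes u :: "real ^ 'n"
  assumes u: "norm u = 1" "0 < a" "0 < \<epsilon>"
  shows "(LINT x:capped_cylinder u a \<epsilon>|lborel. e \<bullet> x) = 0"
proof -
  let ?K = "capped_cylinder u a \<epsilon>"
  have comp: "compact ?K" using capped_cylinder_convex_body[OF u] by (simp add: convex_body_def)
  have orth: "orthogonal_transformation (uminus :: real ^ 'n \<Rightarrow> real ^ 'n)"
    by (simp add: orthogonal_transformation_def linear_uminus)
  have sym: "- x \<in> ?K \<longleftrightarrow> x \<in> ?K" for x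
  proof -
    have "- x - (u \<bullet> (- x)) *\<^sub>R u = - (x - (u \<bullet> x) *\<^sub>R u)" by simp
    then show ?thesis unfolding capped_cylinder_def mem_Collect_eq by (simp only: norm_minus_cancel) simp
  qed
  have "uminus ` ?K = ?K"
    using sym by (auto intro: image_eqI[where x = "- _"])
  then have "(LINT x:?K|lborel. e \<bullet> x) = (LINT x:?K|lborel. e \<bullet> (- x))"
    using set_integral_orthogonal[OF orth comp, of "\<lambda>x. e \<bullet> x"] by (simp add: continuous_intros)
  then show ?thesis by (simp add: set_lebesgue_integral_def)
qed

text \<open>The symmetric body is centered by the identity and by the boost to a maximum of the volume. If these
agreed up to a rotation, the maximum would be at the origin, where the volume is strictly increasing along the geodesic in the direction \<open>u\<close>.\<close>

lemma not_uniquely_centerable_cylinder: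
  fixes u :: "real ^ 'n"
  assumes d: "2 \<le> CARD('n)" and u: "norm u = 1" and a: "critical_radius CARD('n) < a" and \<epsilon>: "0 < \<epsilon>" "a + \<epsilon> < 1"
  shows "\<not> uniquely_centerable (capped_cylinder u a \<epsilon>)"
proof
  let ?K = "capped_cylinder u a \<epsilon>"
  assume uniq: "uniquely_centerable ?K"
  have a0: "0 < a" using a critical_radius_bounds(1)[OF d] by simp
  have body: "convex_body ?K" by (rule capped_cylinder_convex_body[OF u a0 \<epsilon>(1)])
  have comp: "compact ?K" using body by (simp add: convex_body_def)
  have "?K \<subseteq> cball 0 (a + \<epsilon>)" by (rule capped_cylinder_subset_cball[OF u]) (use a0 \<epsilon> in auto)
  then have ball: "?K \<subseteq> ball 0 1" using \<epsilon>(2) by (force simp: subset_iff)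
  then have cball: "?K \<subseteq> cball 0 1" by auto
  have zero: "hmap 0 x = x" "den 0 x = 1" for x :: "real ^ 'n"
    by (simp_all add: hmap_def stretch_def den_def hyp_def)
  have c0: "centering ?K (proj_map (boost 0))"
    by (rule centering_boostI[OF comp cball]) (simp add: zero capped_cylinder_mean[OF u a0 \<epsilon>(1)])
  obtain y where y: "\<And>z. hvol ?K z \<le> hvol ?K y" using hvol_attains_max[OF comp ball] by blast
  have cy: "centering ?K (proj_map (boost y))"
    by (rule centering_boostI[OF comp cball hvol_max_centered[OF comp ball y]])
  obtain U where U: "orthogonal_transformation U" "proj_map (boost y) = proj_ext U \<circ> proj_map (boost 0)"
    using uniq c0 cy unfolding uniquely_centerable_def by blast
  have "proj_map (boost y) (chart 0) = proj_ext U (proj_map (boost 0) (chart 0))" by (simp add: U(2))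
  then have "chart (hmap y 0) = chart (U 0)"
    using proj_ext_chart[OF orthogonal_transformation_linear[OF U(1)] orthogonal_transformation_inj[OF U(1)]]
    by (simp add: proj_map_boost_chart zero)
  then have "hmap y 0 = 0" using linear_0[OF orthogonal_transformation_linear[OF U(1)]] by simp
  then have "y = 0" using den_pos[of 0 y] by (simp add: hmap_def stretch_def)
  define n where "n = CARD('n) + 1"
  define V where "V t = hvol ?K (sinh t *\<^sub>R u)" for t
  have Vmax: "V t \<le> V 0" for t using y \<open>y = 0\<close> by (simp add: V_def)
  have V': "(V has_real_derivative real n * ray_moment n u ?K t) (at t)" for t
    using ray_derivatives(1)[OF comp ball u, of n t] by (simp add: V_def[abs_def] hvol_def n_def)
  have m0: "ray_moment n u ?K 0 = 0"
    using capped_cylinder_mean[OF u a0 \<epsilon>(1), of u] by (simp add: ray_moment_def zero)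
  have "0 < (LINT x:?K|lborel. (real (Suc n) * (u \<bullet> x)\<^sup>2 - 1))"
  proof -
    have m: "0 < measure lborel ?K" by (rule convex_body_measure_pos[OF body])
    have "(LINT x:?K|lborel. (real (Suc n) * (u \<bullet> x)\<^sup>2 - 1)) = (LINT x:?K|lborel. real (Suc n) * (u \<bullet> x)\<^sup>2) - (LINT x:?K|lborel. 1)"
      by (intro set_integral_diff set_integrable_compact comp continuous_intros)
    also have "\<dots> = (real (Suc n) * (a\<^sup>2 / 3) - 1) * measure lborel ?K"
      by (simp only: set_integral_mult_right set_integral_const capped_cylinder_second_moment[OF u a0 \<epsilon>(1)])
        (simp add: algebra_simps)
    also have "0 < \<dots>"
    proof -
      have "(critical_radius CARD('n))\<^sup>2 < a\<^sup>2" using a critical_radius_bounds(1)[OF d] by (intro power_strict_mono) auto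
      then have "1 < real (Suc n) * (a\<^sup>2 / 3)" by (simp add: critical_radius_bounds(3) n_def field_simps)
      then show ?thesis using m by simp
    qed
    finally show ?thesis .
  qed
  moreover have "(ray_moment n u ?K has_real_derivative (LINT x:?K|lborel. (real (Suc n) * (u \<bullet> x)\<^sup>2 - 1))) (at 0)"
    using ray_derivatives(2)[OF comp ball u, of n 0] by (simp add: zero)
  ultimately obtain \<delta> where \<delta>: "0 < \<delta>" "\<And>h. 0 < h \<Longrightarrow> h < \<delta> \<Longrightarrow> ray_moment n u ?K 0 < ray_moment n u ?K (0 + h)"
    using DERIV_pos_inc_right by blast
  obtain z where z: "0 < z" "z < \<delta> / 2" "V (\<delta> / 2) - V 0 = (\<delta> / 2 - 0) * (real n * ray_moment n u ?K z)"
    using MVT2[of 0 "\<delta> / 2" V "\<lambda>t. real n * ray_moment n u ?K t"] V' \<delta>(1) by auto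
  have "0 < ray_moment n u ?K z" using \<delta>(2)[of z] z \<delta>(1) m0 by simp
  then have "0 < V (\<delta> / 2) - V 0" unfolding z(3) using \<delta>(1) by (simp add: n_def)
  then show False using Vmax[of "\<delta> / 2"] by simp
qed

lemma width_bound_sharp:
  assumes d: "2 \<le> CARD('n::finite)" and c: "width_bound CARD('n) < c"
  shows "\<exists>K :: (real ^ 'n) set. convex_body K \<and> K \<subseteq> cball 0 1 \<and> hyperbolic_width K < ereal c \<and>
    \<not> uniquely_centerable K"
proof -
  define s where "s = critical_radius CARD('n)"
  have s: "0 < s" "s < 1" using critical_radius_bounds(1,2)[OF d] by (auto simp: s_def)
  define w where "w \<rho> = ln ((1 + \<rho>) / (1 - \<rho>))" for \<rho> :: real
  have "isCont w s" unfolding w_def[abs_def] using s by (intro continuous_intros) auto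
  then have "(w \<longlongrightarrow> w s) (at_right s)"
    unfolding isCont_def by (rule filterlim_mono) (auto simp: at_le)
  then have "eventually (\<lambda>\<rho>. w \<rho> < c) (at_right s)"
  proof (rule order_tendstoD(2))
    show "w s < c" using c by (simp add: w_def s_def width_bound_critical_radius)
  qed
  moreover have "eventually (\<lambda>\<rho>. \<rho> \<in> {s<..<1}) (at_right s)"
    using s by (intro eventually_at_right_real)
  ultimately obtain \<rho> where \<rho>: "w \<rho> < c" "s < \<rho>" "\<rho> < 1"
    using eventually_happens[OF eventually_conj] trivial_limit_at_right_real by (metis (no_types, lifting) greaterThanLessThan_iff)
  define a \<epsilon> where "a = (s + \<rho>) / 2" and "\<epsilon> = (\<rho> - s) / 2"
  have a: "s < a" "0 < a" "0 < \<epsilon>" "a + \<epsilon> = \<rho>" using s \<rho> by (auto simp: a_def \<epsilon>_def field_simps)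
  obtain u :: "real ^ 'n" where u: "norm u = 1" by (metis norm_axis_1)
  let ?K = "capped_cylinder u a \<epsilon>"
  have sub: "?K \<subseteq> cball 0 \<rho>" using capped_cylinder_subset_cball[OF u, of a \<epsilon>] a by simp
  have "hyperbolic_width ?K \<le> ereal (w \<rho>)"
    unfolding w_def using s \<rho> d by (intro hyperbolic_width_le_ball[OF sub]) auto
  also have "\<dots> < ereal c" using \<rho>(1) by simp
  finally have "hyperbolic_width ?K < ereal c" .
  moreover have "?K \<subseteq> cball 0 1" using sub \<rho>(3) by (force simp: subset_iff)
  moreover have "convex_body ?K" by (rule capped_cylinder_convex_body[OF u a(2,3)])
  moreover have "\<not> uniquely_centerable ?K"
    using a \<rho>(3) by (intro not_uniquely_centerable_cylinder[OF d u]) (auto simp: s_def)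
  ultimately show ?thesis by blast
qed

theorem theorem7:
  assumes "CARD('d::finite) \<ge> 2"
  shows "(\<forall>K :: (real ^ 'd) set.
            convex_body K \<and> K \<subseteq> cball 0 1 \<and>
            hyperbolic_width K < ereal (width_bound CARD('d)) \<longrightarrow>
            uniquely_centerable K) \<and>
         (\<forall>c > width_bound CARD('d).
            \<not> (\<forall>K :: (real ^ 'd) set.
                 convex_body K \<and> K \<subseteq> cball 0 1 \<and> hyperbolic_width K < ereal c \<longrightarrow>
                 uniquely_centerable K))"
  using centerable_below_width_bound[OF assms] width_bound_sharp[OF assms] by blast

end
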